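(* For $q \in \{2, 4\}$, the dual split Cayley hexagon $\mathsf{H}(q)^D$ does not possess a distance-$2$ ovoid.
   Context: A point-line geometry is a triple $(\mathcal{P}, \mathcal{L}, \mathrm{I})$ with $\mathcal{P}$ (points) and $\mathcal{L}$ (lines) disjoint sets and $\mathrm{I} \subseteq \mathcal{P} \times \mathcal{L}$ the incidence relation. Its point graph has vertex set $\mathcal{P}$, two distinct points being adjacent iff they are incident with a common line; $\mathrm{d}(\cdot,\cdot)$ denotes its distance function, and for a point $x$ and a line $\ell$, $\mathrm{d}(x,\ell) = \min\{\mathrm{d}(x,y) : y \,\mathrm{I}\, \ell\}$. The dual split Cayley hexagon $\mathsf{H}(q)^D$ ($q$ a prime power) is the following point-line geometry (a generalized hexagon of order $(q,q)$). Let $Q:\mathbb{F}_q^7 \to \mathbb{F}_q$, $Q(x) = x_0x_4 + x_1x_5 + x_2x_6 - x_3^2$, with coordinates indexed by $0,\dots,6$. For a $2$-dimensional subspace of $\mathbb{F}_q^7$ with basis $x,y$, its Grassmann coordinates are $p_{ij} = x_iy_j - x_jy_i$ (well defined up to a common nonzero scalar). (a) The lines of $\mathsf{H}(q)^D$ are the $1$-dimensional subspaces of $\mathbb{F}_q^7$ on which $Q$ vanishes. (b) The points of $\mathsf{H}(q)^D$ are the $2$-dimensional subspaces of $\mathbb{F}_q^7$ on which $Q$ vanishes identically and whose Grassmann coordinates satisfy $p_{12}=p_{34}$, $p_{54}=p_{32}$, $p_{20}=p_{35}$, $p_{65}=p_{30}$, $p_{01}=p_{36}$ and $p_{46}=p_{31}$.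 (c) Incidence is reverse containment: a point (a $2$-space) is incident with a line (a $1$-space) iff the $2$-space contains the $1$-space. A distance-$2$ ovoid is a set of points $\mathcal{O}$ such that any two distinct points of $\mathcal{O}$ satisfy $\mathrm{d}(x,y)\ge 2$, every point $a$ of the geometry satisfies $\mathrm{d}(a,x)\le 1$ for some $x\in\mathcal{O}$, and every line $\ell$ satisfies $\mathrm{d}(x,\ell)\le 1/2$ (i.e. $x$ is incident with $\ell$) for some $x\in\mathcal{O}$. *)

theory Defs
  imports "HOL-Analysis.Analysis"
begin

section \<open>Point-line geometries\<close>

record ('p, 'l) geometry =
  pts :: "'p set"
  lns :: "'l set"
  inc :: "('p \<times> 'l) set"

text \<open>
  Points and lines may have different types. The disjointness of the two sets is only a
  condition when the types coincide, as for the hexagon below.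
\<close>

definition point_line_geometry :: "('a, 'a) geometry \<Rightarrow> bool" where
  "point_line_geometry G \<longleftrightarrow> pts G \<inter> lns G = {} \<and> inc G \<subseteq> pts G \<times> lns G"

definition collinear_pts :: "('p, 'l) geometry \<Rightarrow> 'p \<Rightarrow> 'p \<Rightarrow> bool" where
  "collinear_pts G x y \<longleftrightarrow>
     x \<in> pts G \<and> y \<in> pts G \<and> x \<noteq> y \<and> (\<exists>l\<in>lns G. (x, l) \<in> inc G \<and> (y, l) \<in> inc G)"

text \<open>
  The distance in the point graph is the least length of a walk; it is \<open>\<infinity>\<close> if there is none.
\<close>

definition point_dist :: "('p, 'l) geometry \<Rightarrow> 'p \<Rightarrow> 'p \<Rightarrow> enat" where
  "point_dist G x y = Inf {enat n |n. (collinear_pts G ^^ n) x y}"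

text \<open>Every nonempty set of extended naturals attains its infimum, so this is a minimum.\<close>

definition point_line_dist :: "('p, 'l) geometry \<Rightarrow> 'p \<Rightarrow> 'l \<Rightarrow> enat" where
  "point_line_dist G x l = Inf {point_dist G x y |y. (y, l) \<in> inc G}"

definition distance_2_ovoid :: "('p, 'l) geometry \<Rightarrow> 'p set \<Rightarrow> bool" where
  "distance_2_ovoid G X \<longleftrightarrow>
     X \<subseteq> pts G \<and>
     (\<forall>x\<in>X. \<forall>y\<in>X. x \<noteq> y \<longrightarrow> point_dist G x y \<ge> 2) \<and>
     (\<forall>a\<in>pts G. \<exists>x\<in>X. point_dist G a x \<le> 1) \<and>
     (\<forall>l\<in>lns G. \<exists>x\<in>X. ereal_of_enat (point_line_dist G x l) \<le> 1 / 2)"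


section \<open>The dual split Cayley hexagon\<close>

text \<open>
  The index type \<^typ>\<open>7\<close> has the elements \<open>0, \<dots>, 6\<close>, so \<open>x $ i\<close> is the
  coordinate with index \<open>i\<close> as in the usual numbering from \<open>0\<close>.
\<close>

definition hexagon_form :: "'a::field ^ 7 \<Rightarrow> 'a" where
  "hexagon_form x = x $ 0 * x $ 4 + x $ 1 * x $ 5 + x $ 2 * x $ 6 - (x $ 3)\<^sup>2"

definition grassmann :: "'a::field ^ 7 \<Rightarrow> 'a ^ 7 \<Rightarrow> 7 \<Rightarrow> 7 \<Rightarrow> 'a" where
  "grassmann x y i j = x $ i * y $ j - x $ j * y $ i"

definition hexagon_equations :: "'a::field ^ 7 \<Rightarrow> 'a ^ 7 \<Rightarrow> bool" where
  "hexagon_equations x y \<longleftrightarrow>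
     grassmann x y 1 2 = grassmann x y 3 4 \<and>
     grassmann x y 5 4 = grassmann x y 3 2 \<and>
     grassmann x y 2 0 = grassmann x y 3 5 \<and>
     grassmann x y 6 5 = grassmann x y 3 0 \<and>
     grassmann x y 0 1 = grassmann x y 3 6 \<and>
     grassmann x y 4 6 = grassmann x y 3 1"

definition is_basis2 :: "('a::field ^ 7) set \<Rightarrow> 'a ^ 7 \<Rightarrow> 'a ^ 7 \<Rightarrow> bool" where
  "is_basis2 V x y \<longleftrightarrow> x \<noteq> y \<and> vec.independent {x, y} \<and> vec.span {x, y} = V"

text \<open>
  The equations do not depend on the chosen basis; see \<open>hexagon_equations_any_basis\<close> below.
\<close>

definition hexagon_points :: "('a::field ^ 7) set set" where
  "hexagon_points =
     {V. vec.subspace V \<and> vec.dim V = 2 \<and> (\<forall>x\<in>V. hexagon_form x = 0) \<and>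
         (\<exists>x y. is_basis2 V x y \<and> hexagon_equations x y)}"

definition hexagon_lines :: "('a::field ^ 7) set set" where
  "hexagon_lines = {V. vec.subspace V \<and> vec.dim V = 1 \<and> (\<forall>x\<in>V. hexagon_form x = 0)}"

definition dual_split_Cayley_hexagon :: "(('a::field ^ 7) set, ('a ^ 7) set) geometry" where
  "dual_split_Cayley_hexagon =
     \<lparr>pts = hexagon_points, lns = hexagon_lines,
      inc = {(p, l). p \<in> hexagon_points \<and> l \<in> hexagon_lines \<and> l \<subseteq> p}\<rparr>"

lemma point_line_geometry_hexagon:
  "point_line_geometry (dual_split_Cayley_hexagon :: (('a::field ^ 7) set, _) geometry)"
  by (auto simp: point_line_geometry_def dual_split_Cayley_hexagon_def
      hexagon_points_def hexagon_lines_def)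

lemma grassmann_basis_change:
  "grassmann (a *s x + b *s y) (c *s x + d *s y) i j = (a * d - b * c) * grassmann x y i j"
  by (simp add: grassmann_def algebra_simps)

lemma hexagon_equations_any_basis:
  assumes "is_basis2 V x y" "hexagon_equations x y" "is_basis2 V u v"
  shows "hexagon_equations u v"
proof -
  have "u \<in> vec.span {x, y}" "v \<in> vec.span {x, y}"
    using assms vec.span_superset[of "{u, v}"] by (auto simp: is_basis2_def)
  then obtain a b c d where "u = a *s x + b *s y" "v = c *s x + d *s y"
    by (auto simp: vec.span_insert vec.span_singleton algebra_simps)
  with assms(2) show ?thesis
    by (simp add: hexagon_equations_def grassmann_basis_change)
qed

end

theory Submission
  imports Defs
begin

text \<open>
  A distance-2 ovoid of the dual split Cayley hexagon is a set \<open>X\<close> of hexagon points, that is of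
  2-spaces of singular vectors satisfying the Grassmann equations, such that each singular 1-space
  lies in exactly one member of \<open>X\<close> (\<open>ovoid_meets_line_once\<close>). So \<open>X\<close> partitions the nonzero
  singular vectors into hexagon planes, as the 2-spaces are called below. For two and four elements
  this is impossible for a reason of parity.

  Let \<open>P\<close> be a finite family of nonzero singular vectors with an odd number of members, and
  let \<open>R\<close> be a relation between \<open>P\<close> and the hexagon planes with two properties. If \<open>V\<close> and \<open>U\<close> have
  only 0 in common, then the members of \<open>P\<close> in \<open>V\<close> related to \<open>U\<close> are as many, modulo 2, as the
  members of \<open>P\<close> in \<open>U\<close> related to \<open>V\<close>. For each \<open>V\<close>, the number of members of \<open>P\<close> in \<open>V\<close> related
  to \<open>V\<close>, the number of all members of \<open>P\<close> related to \<open>V\<close>, and the number of members of \<open>P\<close> in \<open>V\<close>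
  have an even sum. Count the pairs \<open>(p, V)\<close> with \<open>V \<in> X\<close> and \<open>p\<close> related to \<open>V\<close>, sorting them by the
  unique \<open>U \<in> X\<close> that contains \<open>p\<close>. By the first property the contributions of \<open>(U, V)\<close> and
  \<open>(V, U)\<close> cancel modulo 2, so only those with \<open>U = V\<close> remain; by the second property summed over
  \<open>V \<in> X\<close>, the sizes of \<open>P \<inter> V\<close> have an even sum. But this sum is the size of \<open>P\<close>, which is odd
  (\<open>parity_obstruction\<close>).

  Both properties are linear equations over the field with two elements for the truth values of
  \<open>R\<close>. A solution, found by linear algebra, is recorded in the tables near the end. To keep it small, \<open>R\<close> is
  chosen invariant under a group of 27 monomial transformations, generated by a cyclic shift of
  the coordinates and diagonal matrices of cube roots of unity. Since 27 is odd, the family of all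
  translates of an odd number of vectors still has an odd number of members. It suffices to list
  representatives of vectors and planes, and for each pair of
  representatives an element of the group algebra over the field with two elements: the sum of the group
  elements that make the pair related. The first property becomes an identity between group
  algebra elements, which may fail only at group elements for which the two planes meet.

  That the translates of the listed planes include all hexagon planes is certified as well, without
  enumerating all 2-spaces. Every hexagon plane contains a vector whose middle coordinate is 0 and
  whose first three and last three coordinates are both not all 0 (\<open>exists_flag\<close>). For such a
  vector the equations leave few planes, described in \<open>check_flag_complete\<close>.

  The predicate \<open>certificate\<close> collects these finitely many conditions in executable form;
  \<open>no_spread\<close> shows that they contradict a partition by hexagon planes,
  and \<open>no_ovoid\<close> transfers this along a field isomorphism.
\<close>

section \<open>A parity argument for exact covers\<close>

text \<open>
  Off the diagonal the terms pair up to even numbers, so modulo 2 the double sum is the sum over the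
  diagonal.
\<close>

lemma even_symmetric_double_sum:
  fixes f :: "'a \<Rightarrow> 'a \<Rightarrow> nat"
  assumes "finite A" and "\<And>x y. x \<in> A \<Longrightarrow> y \<in> A \<Longrightarrow> x \<noteq> y \<Longrightarrow> even (f x y + f y x)"
  shows "even ((\<Sum>x\<in>A. \<Sum>y\<in>A. f x y) + (\<Sum>x\<in>A. f x x))"
  using assms
proof (induction A rule: finite_induct)
  case (insert z A)
  have "even (\<Sum>y\<in>A. f z y + f y z)"
    using insert.prems insert.hyps by (intro dvd_sum) auto
  moreover have "(\<Sum>x\<in>insert z A. \<Sum>y\<in>insert z A. f x y) + (\<Sum>x\<in>insert z A. f x x) =
      2 * f z z + (\<Sum>y\<in>A. f z y + f y z) + ((\<Sum>x\<in>A. \<Sum>y\<in>A. f x y) + (\<Sum>x\<in>A. f x x))"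
    using insert.hyps by (simp add: sum.distrib)
  ultimately show ?case
    using insert.IH insert.prems by simp
qed simp

text \<open>
  \<open>N\<close> divides \<open>P\<close> into the parts \<open>N v\<close>. Hence a count over
  \<open>P\<close> splits into counts over the parts, and the number of pairs \<open>(p, u)\<close>
  with \<open>R p u\<close> is a double sum over \<open>A\<close> that is even up to its diagonal.
\<close>

lemma parity_obstruction:
  fixes N :: "'v \<Rightarrow> 'p set" and R :: "'p \<Rightarrow> 'v \<Rightarrow> bool"
  assumes fin: "finite P" "finite A" and odd_P: "odd (card P)"
    and sub: "\<And>v. v \<in> A \<Longrightarrow> N v \<subseteq> P"
    and exact: "\<And>p. p \<in> P \<Longrightarrow> \<exists>!v. v \<in> A \<and> p \<in> N v"
    and sym: "\<And>v u. v \<in> A \<Longrightarrow> u \<in> A \<Longrightarrow> v \<noteq> u \<Longrightarrow>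
      even (card {p \<in> N v. R p u} + card {p \<in> N u. R p v})"
    and diag: "\<And>v. v \<in> A \<Longrightarrow> even (card {p \<in> N v. R p v} + card {p \<in> P. R p v} + card (N v))"
  shows False
proof -
  have finN: "finite (N v)" if "v \<in> A" for v
    using sub[OF that] fin(1) finite_subset by blast
  have cover: "\<exists>v\<in>A. p \<in> N v" if "p \<in> P" for p
    using exact[OF that] by blast
  have disjoint: "v = u" if "v \<in> A" "u \<in> A" "p \<in> N v" "p \<in> N u" for v u p
    using exact[of p] sub that by (metis subsetD)
  have split: "card {p \<in> P. Q p} = (\<Sum>v\<in>A. card {p \<in> N v. Q p})" for Q
  proof -
    have "{p \<in> P. Q p} = (\<Union>v\<in>A. {p \<in> N v. Q p})"
      using cover sub by fast
    also have "card \<dots> = (\<Sum>v\<in>A. card {p \<in> N v. Q p})"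
    proof (rule card_UN_disjoint)
      show "\<forall>i\<in>A. \<forall>j\<in>A. i \<noteq> j \<longrightarrow> {p \<in> N i. Q p} \<inter> {p \<in> N j. Q p} = {}"
        using disjoint by fast
    qed (use fin finN in auto)
    finally show ?thesis .
  qed
  have "even (\<Sum>v\<in>A. card {p \<in> N v. R p v} + card {p \<in> P. R p v} + card (N v))"
    using diag by (intro dvd_sum) auto
  moreover have "(\<Sum>v\<in>A. card (N v)) = card P"
    using split[of "\<lambda>_. True"] by simp
  moreover have "even ((\<Sum>v\<in>A. \<Sum>u\<in>A. card {p \<in> N v. R p u}) + (\<Sum>v\<in>A. card {p \<in> N v. R p v}))"
    using sym by (intro even_symmetric_double_sum fin) auto
  moreover have "(\<Sum>v\<in>A. card {p \<in> P. R p v}) = (\<Sum>v\<in>A. \<Sum>u\<in>A. card {p \<in> N v. R p u})"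
    by (subst sum.swap) (simp add: split)
  ultimately show False
    using odd_P by (simp add: sum.distrib)
qed

section \<open>Ovoids meet every line once\<close>

lemma Inf_enat_mem: "S \<noteq> {} \<Longrightarrow> Inf S \<in> S" for S :: "enat set"
  unfolding Inf_enat_def by (auto intro: LeastI)

text \<open>
  A distance between a point and a line is a natural number or infinite, so at most one half means 0,
  and a point at distance 0 lies on the line. Two points on a line are at distance at most 1, so an
  ovoid cannot contain both.
\<close>

lemma ovoid_meets_line_once:
  assumes ov: "distance_2_ovoid G X" and l: "l \<in> lns G" and inc: "inc G \<subseteq> pts G \<times> lns G"
  shows "\<exists>!x. x \<in> X \<and> (x, l) \<in> inc G"
proof -
  obtain x where x: "x \<in> X" "ereal_of_enat (point_line_dist G x l) \<le> 1 / 2"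
    using ov l by (auto simp: distance_2_ovoid_def)
  have "point_line_dist G x l = 0"
  proof (cases "point_line_dist G x l")
    case (enat n)
    then have "real n \<le> 1 / 2"
      using x(2) by (simp add: one_ereal_def)
    then show ?thesis
      using enat by (simp add: zero_enat_def)
  next
    case infinity
    then show ?thesis
      using x(2) by (simp add: one_ereal_def)
  qed
  then have d0: "Inf {point_dist G x y |y. (y, l) \<in> inc G} = 0"
    by (simp add: point_line_dist_def)
  have Inf_empty: "Inf S = 0 \<Longrightarrow> S \<noteq> {}" for S :: "enat set"
    by (auto simp: Inf_enat_def)
  from Inf_enat_mem[OF Inf_empty[OF d0]] obtain y where y: "(y, l) \<in> inc G" "point_dist G x y = 0"
    unfolding d0 by auto
  from Inf_enat_mem[OF Inf_empty[OF y(2)[unfolded point_dist_def]]] y(2) obtain n where "enat n = 0" "(collinear_pts G ^^ n) x y"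
    unfolding point_dist_def by auto
  then have "x = y"
    by (simp add: enat_0_iff)
  have unique: "v = u" if "v \<in> X" "(v, l) \<in> inc G" "u \<in> X" "(u, l) \<in> inc G" for v u
  proof (rule ccontr)
    assume "v \<noteq> u"
    then have "collinear_pts G v u"
      using that inc unfolding collinear_pts_def by blast
    then have "(collinear_pts G ^^ 1) v u"
      by (simp add: eq_OO)
    then have "point_dist G v u \<le> enat 1"
      unfolding point_dist_def by (intro Inf_lower CollectI exI[of _ 1] conjI refl)
    moreover have "point_dist G v u \<ge> 2"
      using ov that \<open>v \<noteq> u\<close> by (auto simp: distance_2_ovoid_def)
    ultimately have "(2 :: enat) \<le> enat 1"
      by (rule order_trans[rotated])
    then show False
      by (simp add: numeral_eq_enat)
  qed
  show ?thesis
  proof (intro ex1I[of _ x] conjI)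
    show "x \<in> X" "(x, l) \<in> inc G"
      using x(1) y(1) \<open>x = y\<close> by auto
    show "\<And>z. z \<in> X \<and> (z, l) \<in> inc G \<Longrightarrow> z = x"
      using unique x(1) y(1) \<open>x = y\<close> by blast
  qed
qed

section \<open>Arithmetic in the two fields\<close>

text \<open>
  The theorem is about an arbitrary field with the given number of elements. The computation needs a
  field with concrete elements, to which the arbitrary one is isomorphic.
\<close>

datatype f2 = B0 | B1
datatype f4 = F0 | F1 | Fw | Fv

instantiation f2 :: field
begin
definition "zero_f2 = B0"
definition "one_f2 = B1"
definition "plus_f2 x y = (case x of B0 \<Rightarrow> y | B1 \<Rightarrow> (case y of B0 \<Rightarrow> B1 | B1 \<Rightarrow> B0))"
definition "times_f2 x y = (case x of B0 \<Rightarrow> B0 | B1 \<Rightarrow> y)"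
definition "uminus_f2 (x :: f2) = x"
definition "minus_f2 (x :: f2) y = x + y"
definition "inverse_f2 (x :: f2) = x"
definition "divide_f2 (x :: f2) y = x * inverse y"
instance
  by standard (auto simp: zero_f2_def one_f2_def plus_f2_def times_f2_def uminus_f2_def
      minus_f2_def inverse_f2_def divide_f2_def split: f2.splits)
end

instantiation f4 :: field
begin
definition "zero_f4 = F0"
definition "one_f4 = F1"
definition "plus_f4 x y = (case x of
     F0 \<Rightarrow> y
   | F1 \<Rightarrow> (case y of F0 \<Rightarrow> F1 | F1 \<Rightarrow> F0 | Fw \<Rightarrow> Fv | Fv \<Rightarrow> Fw)
   | Fw \<Rightarrow> (case y of F0 \<Rightarrow> Fw | F1 \<Rightarrow> Fv | Fw \<Rightarrow> F0 | Fv \<Rightarrow> F1)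
   | Fv \<Rightarrow> (case y of F0 \<Rightarrow> Fv | F1 \<Rightarrow> Fw | Fw \<Rightarrow> F1 | Fv \<Rightarrow> F0))"
definition "times_f4 x y = (case x of
     F0 \<Rightarrow> F0
   | F1 \<Rightarrow> y
   | Fw \<Rightarrow> (case y of F0 \<Rightarrow> F0 | F1 \<Rightarrow> Fw | Fw \<Rightarrow> Fv | Fv \<Rightarrow> F1)
   | Fv \<Rightarrow> (case y of F0 \<Rightarrow> F0 | F1 \<Rightarrow> Fv | Fw \<Rightarrow> F1 | Fv \<Rightarrow> Fw))"
definition "uminus_f4 (x :: f4) = x"
definition "minus_f4 (x :: f4) y = x + y"
definition "inverse_f4 x = (case x of F0 \<Rightarrow> F0 | F1 \<Rightarrow> F1 | Fw \<Rightarrow> Fv | Fv \<Rightarrow> Fw)"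
definition "divide_f4 (x :: f4) y = x * inverse y"
instance
  by standard (auto simp: zero_f4_def one_f4_def plus_f4_def times_f4_def uminus_f4_def
      minus_f4_def inverse_f4_def divide_f4_def split: f4.splits)
end

section \<open>Vectors with seven coordinates\<close>

datatype 'f vec7 = Vec 'f 'f 'f 'f 'f 'f 'f

fun smul :: "'f::field \<Rightarrow> 'f vec7 \<Rightarrow> 'f vec7" where
  "smul t (Vec a b c d e f g) = Vec (t*a) (t*b) (t*c) (t*d) (t*e) (t*f) (t*g)"

fun vadd :: "'f::field vec7 \<Rightarrow> 'f vec7 \<Rightarrow> 'f vec7" where
  "vadd (Vec a b c d e f g) (Vec a' b' c' d' e' f' g') =
     Vec (a+a') (b+b') (c+c') (d+d') (e+e') (f+f') (g+g')"

definition vnull :: "'f::field vec7" where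
  "vnull = Vec 0 0 0 0 0 0 0"

fun qform :: "'f::field vec7 \<Rightarrow> 'f" where
  "qform (Vec a b c d e f g) = a*e + b*f + c*g - d*d"

text \<open>
  The six equations between Grassmann coordinates, written for two vectors that span the plane.
\<close>

fun hexeqs :: "'f::field vec7 \<Rightarrow> 'f vec7 \<Rightarrow> bool" where
  "hexeqs (Vec x0 x1 x2 x3 x4 x5 x6) (Vec y0 y1 y2 y3 y4 y5 y6) \<longleftrightarrow>
     x1*y2 - x2*y1 = x3*y4 - x4*y3 \<and> x5*y4 - x4*y5 = x3*y2 - x2*y3 \<and>
     x2*y0 - x0*y2 = x3*y5 - x5*y3 \<and> x6*y5 - x5*y6 = x3*y0 - x0*y3 \<and>
     x0*y1 - x1*y0 = x3*y6 - x6*y3 \<and> x4*y6 - x6*y4 = x3*y1 - x1*y3"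

fun lead :: "'f::field vec7 \<Rightarrow> 'f" where
  "lead (Vec a b c d e f g) = (if a \<noteq> 0 then a else if b \<noteq> 0 then b else if c \<noteq> 0 then c
     else if d \<noteq> 0 then d else if e \<noteq> 0 then e else if f \<noteq> 0 then f else g)"

text \<open>
  Nonzero multiples of a vector have the same normalization (\<open>normal_smul\<close>), so a 1-space can be looked
  up by a representative.
\<close>

definition normal :: "'f::field vec7 \<Rightarrow> 'f vec7" where
  "normal v = smul (inverse (lead v)) v"

section \<open>A group of 27 monomial transformations\<close>

datatype z3 = Z0 | Z1 | Z2

fun add3 :: "z3 \<Rightarrow> z3 \<Rightarrow> z3" where
  "add3 Z0 b = b"
| "add3 Z1 Z0 = Z1" | "add3 Z1 Z1 = Z2" | "add3 Z1 Z2 = Z0"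
| "add3 Z2 Z0 = Z2" | "add3 Z2 Z1 = Z0" | "add3 Z2 Z2 = Z1"

fun neg3 :: "z3 \<Rightarrow> z3" where
  "neg3 Z0 = Z0" | "neg3 Z1 = Z2" | "neg3 Z2 = Z1"

type_synonym mono = "z3 \<times> z3 \<times> z3"

fun tpow :: "'f::field \<Rightarrow> z3 \<Rightarrow> 'f" where
  "tpow w Z0 = 1" | "tpow w Z1 = w" | "tpow w Z2 = w * w"

text \<open>
  The form pairs the coordinates 0, 1, 2 with 4, 5, 6, and the Grassmann equations are invariant under
  rotating both triples simultaneously.
\<close>

fun shift :: "z3 \<Rightarrow> 'f vec7 \<Rightarrow> 'f vec7" where
  "shift Z0 v = v"
| "shift Z1 (Vec a b c d e f g) = Vec b c a d f g e"
| "shift Z2 (Vec a b c d e f g) = Vec c a b d g e f"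

text \<open>
  The product of the entries in the first triple is 1 and the entries in the second triple are the
  inverses. These diagonal matrices preserve the form, and multiply each equation by a scalar, if
  \<open>w\<close> is a cube root of unity. For the field with two elements \<open>w\<close> is 1 and
  the torus acts trivially: the action of the group need not be faithful, and vectors are then counted
  with multiplicity.
\<close>

fun torus :: "'f::field \<Rightarrow> z3 \<Rightarrow> z3 \<Rightarrow> 'f vec7 \<Rightarrow> 'f vec7" where
  "torus w a b (Vec x0 x1 x2 x3 x4 x5 x6) =
     Vec (tpow w a * x0) (tpow w b * x1) (tpow w (neg3 (add3 a b)) * x2) x3
       (tpow w (neg3 a) * x4) (tpow w (neg3 b) * x5) (tpow w (add3 a b) * x6)"

fun act :: "'f::field \<Rightarrow> mono \<Rightarrow> 'f vec7 \<Rightarrow> 'f vec7" where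
  "act w (c, a, b) v = torus w a b (shift c v)"

definition all_z3 :: "z3 list" where
  "all_z3 = [Z0, Z1, Z2]"

definition all_mono :: "mono list" where
  "all_mono = List.product all_z3 (List.product all_z3 all_z3)"

section \<open>Ternary trees\<close>

text \<open>
  Data are kept in ternary trees of depth four, with 81 leaves. An access by index then passes through
  four constructors only, and elementwise operations never move large terms.
\<close>

datatype 'a tri = T 'a 'a 'a

fun sel :: "z3 \<Rightarrow> 'a tri \<Rightarrow> 'a" where
  "sel Z0 (T x y z) = x" | "sel Z1 (T x y z) = y" | "sel Z2 (T x y z) = z"

fun rot :: "z3 \<Rightarrow> 'a tri \<Rightarrow> 'a tri" where
  "rot Z0 t = t" | "rot Z1 (T x y z) = T y z x" | "rot Z2 (T x y z) = T z x y"

fun map_tri :: "('a \<Rightarrow> 'b) \<Rightarrow> 'a tri \<Rightarrow> 'b tri" where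
  "map_tri f (T x y z) = T (f x) (f y) (f z)"

fun zip_tri :: "('a \<Rightarrow> 'b \<Rightarrow> 'c) \<Rightarrow> 'a tri \<Rightarrow> 'b tri \<Rightarrow> 'c tri" where
  "zip_tri f (T x y z) (T x' y' z') = T (f x x') (f y y') (f z z')"

fun all_tri :: "('a \<Rightarrow> bool) \<Rightarrow> 'a tri \<Rightarrow> bool" where
  "all_tri P (T x y z) \<longleftrightarrow> P x \<and> P y \<and> P z"

fun tri_list :: "'a tri \<Rightarrow> 'a list" where
  "tri_list (T x y z) = [x, y, z]"

fun parity3 :: "bool tri \<Rightarrow> bool" where
  "parity3 (T x y z) \<longleftrightarrow> (x \<noteq> (y \<noteq> z))"

type_synonym 'a tri4 = "'a tri tri tri tri"
type_synonym ix = "z3 \<times> z3 \<times> z3 \<times> z3"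

fun sel4 :: "ix \<Rightarrow> 'a tri4 \<Rightarrow> 'a" where
  "sel4 (a, b, c, d) t = sel d (sel c (sel b (sel a t)))"

definition map_tri4 :: "('a \<Rightarrow> 'b) \<Rightarrow> 'a tri4 \<Rightarrow> 'b tri4" where
  "map_tri4 f = map_tri (map_tri (map_tri (map_tri f)))"

definition zip_tri4 :: "('a \<Rightarrow> 'b \<Rightarrow> 'c) \<Rightarrow> 'a tri4 \<Rightarrow> 'b tri4 \<Rightarrow> 'c tri4" where
  "zip_tri4 f = zip_tri (zip_tri (zip_tri (zip_tri f)))"

definition all_tri4 :: "('a \<Rightarrow> bool) \<Rightarrow> 'a tri4 \<Rightarrow> bool" where
  "all_tri4 P = all_tri (all_tri (all_tri (all_tri P)))"

definition list4 :: "'a tri4 \<Rightarrow> 'a list" where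
  "list4 t = concat (map tri_list (concat (map tri_list (concat (map tri_list (tri_list t))))))"

definition parity4 :: "bool tri4 \<Rightarrow> bool" where
  "parity4 t = parity3 (map_tri (\<lambda>t. parity3 (map_tri (\<lambda>t. parity3 (map_tri parity3 t)) t)) t)"

definition z3_tri :: "z3 tri" where
  "z3_tri = T Z0 Z1 Z2"

definition ix_tri4 :: "ix tri4" where
  "ix_tri4 = map_tri (\<lambda>a. map_tri (\<lambda>b. map_tri (\<lambda>c. map_tri (\<lambda>d. (a, b, c, d)) z3_tri) z3_tri) z3_tri) z3_tri"

fun less3 :: "z3 \<Rightarrow> z3 \<Rightarrow> bool" where
  "less3 x Z0 = False" | "less3 Z0 Z1 = True" | "less3 Z1 Z1 = False" | "less3 Z2 Z1 = False"
| "less3 Z0 Z2 = True" | "less3 Z1 Z2 = True" | "less3 Z2 Z2 = False"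

fun less_ix :: "ix \<Rightarrow> ix \<Rightarrow> bool" where
  "less_ix (a, b, c, d) (a', b', c', d') =
     (if a = a' then if b = b' then if c = c' then less3 d d' else less3 c c' else less3 b b'
      else less3 a a')"

section \<open>The group algebra over the field with two elements\<close>

text \<open>
  An element of the group algebra has 27 coefficients, indexed by \<open>(c, a, b)\<close>. The three
  coefficients that differ only in \<open>c\<close> are packed into one digit, which makes additions
  short.
\<close>

datatype oct = O0 | O1 | O2 | O3 | O4 | O5 | O6 | O7

fun digit :: "z3 \<Rightarrow> oct \<Rightarrow> bool" where
  "digit Z0 O0 = False" | "digit Z0 O1 = True" | "digit Z0 O2 = False" | "digit Z0 O3 = True"
  | "digit Z0 O4 = False" | "digit Z0 O5 = True" | "digit Z0 O6 = False" | "digit Z0 O7 = True"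
  | "digit Z1 O0 = False" | "digit Z1 O1 = False" | "digit Z1 O2 = True" | "digit Z1 O3 = True"
  | "digit Z1 O4 = False" | "digit Z1 O5 = False" | "digit Z1 O6 = True" | "digit Z1 O7 = True"
  | "digit Z2 O0 = False" | "digit Z2 O1 = False" | "digit Z2 O2 = False" | "digit Z2 O3 = False"
  | "digit Z2 O4 = True" | "digit Z2 O5 = True" | "digit Z2 O6 = True" | "digit Z2 O7 = True"

fun oct_xor :: "oct \<Rightarrow> oct \<Rightarrow> oct" where
  "oct_xor O0 y = y" | "oct_xor O1 O0 = O1" | "oct_xor O1 O1 = O0" | "oct_xor O1 O2 = O3"
  | "oct_xor O1 O3 = O2" | "oct_xor O1 O4 = O5" | "oct_xor O1 O5 = O4" | "oct_xor O1 O6 = O7"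
  | "oct_xor O1 O7 = O6" | "oct_xor O2 O0 = O2" | "oct_xor O2 O1 = O3" | "oct_xor O2 O2 = O0"
  | "oct_xor O2 O3 = O1" | "oct_xor O2 O4 = O6" | "oct_xor O2 O5 = O7" | "oct_xor O2 O6 = O4"
  | "oct_xor O2 O7 = O5" | "oct_xor O3 O0 = O3" | "oct_xor O3 O1 = O2" | "oct_xor O3 O2 = O1"
  | "oct_xor O3 O3 = O0" | "oct_xor O3 O4 = O7" | "oct_xor O3 O5 = O6" | "oct_xor O3 O6 = O5"
  | "oct_xor O3 O7 = O4" | "oct_xor O4 O0 = O4" | "oct_xor O4 O1 = O5" | "oct_xor O4 O2 = O6"
  | "oct_xor O4 O3 = O7" | "oct_xor O4 O4 = O0" | "oct_xor O4 O5 = O1" | "oct_xor O4 O6 = O2"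
  | "oct_xor O4 O7 = O3" | "oct_xor O5 O0 = O5" | "oct_xor O5 O1 = O4" | "oct_xor O5 O2 = O7"
  | "oct_xor O5 O3 = O6" | "oct_xor O5 O4 = O1" | "oct_xor O5 O5 = O0" | "oct_xor O5 O6 = O3"
  | "oct_xor O5 O7 = O2" | "oct_xor O6 O0 = O6" | "oct_xor O6 O1 = O7" | "oct_xor O6 O2 = O4"
  | "oct_xor O6 O3 = O5" | "oct_xor O6 O4 = O2" | "oct_xor O6 O5 = O3" | "oct_xor O6 O6 = O0"
  | "oct_xor O6 O7 = O1" | "oct_xor O7 O0 = O7" | "oct_xor O7 O1 = O6" | "oct_xor O7 O2 = O5"
  | "oct_xor O7 O3 = O4" | "oct_xor O7 O4 = O3" | "oct_xor O7 O5 = O2" | "oct_xor O7 O6 = O1"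
  | "oct_xor O7 O7 = O0"

fun oct_rot :: "z3 \<Rightarrow> oct \<Rightarrow> oct" where
  "oct_rot Z0 x = x" | "oct_rot Z1 O0 = O0" | "oct_rot Z1 O1 = O4" | "oct_rot Z1 O2 = O1"
  | "oct_rot Z1 O3 = O5" | "oct_rot Z1 O4 = O2" | "oct_rot Z1 O5 = O6" | "oct_rot Z1 O6 = O3"
  | "oct_rot Z1 O7 = O7" | "oct_rot Z2 O0 = O0" | "oct_rot Z2 O1 = O2" | "oct_rot Z2 O2 = O4"
  | "oct_rot Z2 O3 = O6" | "oct_rot Z2 O4 = O1" | "oct_rot Z2 O5 = O3" | "oct_rot Z2 O6 = O5"
  | "oct_rot Z2 O7 = O7"

text \<open>
  Inverse to reading off the three digits; the first argument is the digit with index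
  \<open>Z0\<close>.
\<close>

fun oct_of :: "bool \<Rightarrow> bool \<Rightarrow> bool \<Rightarrow> oct" where
  "oct_of False False False = O0" | "oct_of True False False = O1" | "oct_of False True False = O2"
  | "oct_of True True False = O3" | "oct_of False False True = O4" | "oct_of True False True = O5"
  | "oct_of False True True = O6" | "oct_of True True True = O7"

fun oct_parity :: "oct \<Rightarrow> bool" where
  "oct_parity O0 = False" | "oct_parity O1 = True" | "oct_parity O2 = True" | "oct_parity O3 = False"
  | "oct_parity O4 = True" | "oct_parity O5 = False" | "oct_parity O6 = False" | "oct_parity O7 = True"

text \<open>
  Splits off the three lowest binary digits. The pattern demands a remaining number, so the digits are
  followed by a leading 1 that carries no information.
\<close>

fun next_oct :: "num \<Rightarrow> oct \<times> num" where
  "next_oct (num.Bit0 (num.Bit0 (num.Bit0 n))) = (O0, n)" | "next_oct (num.Bit1 (num.Bit0 (num.Bit0 n))) = (O1, n)"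
  | "next_oct (num.Bit0 (num.Bit1 (num.Bit0 n))) = (O2, n)" | "next_oct (num.Bit1 (num.Bit1 (num.Bit0 n))) = (O3, n)"
  | "next_oct (num.Bit0 (num.Bit0 (num.Bit1 n))) = (O4, n)" | "next_oct (num.Bit1 (num.Bit0 (num.Bit1 n))) = (O5, n)"
  | "next_oct (num.Bit0 (num.Bit1 (num.Bit1 n))) = (O6, n)" | "next_oct (num.Bit1 (num.Bit1 (num.Bit1 n))) = (O7, n)"
  | "next_oct n = (O0, n)"

text \<open>
  The two outer levels are indexed by the torus coordinates \<open>a\<close> and \<open>b\<close>, see
  \<open>entry\<close>.
\<close>

type_synonym block = "oct tri tri"

fun entry :: "mono \<Rightarrow> block \<Rightarrow> bool" where
  "entry (c, a, b) v = digit c (sel b (sel a v))"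

text \<open>
  The effect of the shift on the torus coordinates: the entry \<open>(a, b)\<close> is taken from
  \<open>(b, - (a + b))\<close>, see \<open>sel_twist1\<close>.
\<close>

fun twist1 :: "'a tri tri \<Rightarrow> 'a tri tri" where
  "twist1 (T (T x00 x01 x02) (T x10 x11 x12) (T x20 x21 x22)) =
     T (T x00 x12 x21) (T x02 x11 x20) (T x01 x10 x22)"

fun twist :: "z3 \<Rightarrow> 'a tri tri \<Rightarrow> 'a tri tri" where
  "twist Z0 v = v" | "twist Z1 v = twist1 v" | "twist Z2 v = twist1 (twist1 v)"

text \<open>
  Left multiplication by the inverse of a group element, see \<open>entry_translate\<close>.
\<close>

fun translate :: "mono \<Rightarrow> block \<Rightarrow> block" where
  "translate (c, a, b) v = map_tri (map_tri (oct_rot c)) (twist c (rot a (map_tri (rot b) v)))"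

fun flip3 :: "'a tri \<Rightarrow> 'a tri" where
  "flip3 (T x y z) = T x z y"

definition flip9 :: "'a tri tri \<Rightarrow> 'a tri tri" where
  "flip9 v = flip3 (map_tri flip3 v)"

fun zip3_tri :: "('a \<Rightarrow> 'b \<Rightarrow> 'c \<Rightarrow> 'd) \<Rightarrow> 'a tri \<Rightarrow> 'b tri \<Rightarrow> 'c tri \<Rightarrow> 'd tri" where
  "zip3_tri f (T x y z) (T x' y' z') (T x'' y'' z'') = T (f x x' x'') (f y y' y'') (f z z' z'')"

text \<open>
  The antipode of the group algebra, \<open>entry_inverted\<close>. Inversion in the semidirect
  product twists the torus coordinates by the shift, so the coefficients with shifts
  \<open>Z0\<close>, \<open>Z1\<close>, \<open>Z2\<close> come from three different rearrangements.
\<close>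

definition inverted :: "block \<Rightarrow> block" where
  "inverted v = zip3_tri (zip3_tri (\<lambda>x y z. oct_of (digit Z0 x) (digit Z2 y) (digit Z1 z)))
     (flip9 v) (flip9 (twist1 (twist1 v))) (flip9 (twist1 v))"

text \<open>
  Zero blocks, among them all blocks at unused indices, are represented by \<open>None\<close>, which
  saves most of the work.
\<close>

fun block_xor :: "block option \<Rightarrow> block option \<Rightarrow> block option" where
  "block_xor None v = v" | "block_xor (Some u) None = Some u"
| "block_xor (Some u) (Some v) = Some (zip_tri (zip_tri oct_xor) u v)"

fun block_parity :: "block option \<Rightarrow> bool" where
  "block_parity None = False"
| "block_parity (Some v) = parity3 (map_tri (\<lambda>t. parity3 (map_tri oct_parity t)) v)"

fun next3 :: "(num \<Rightarrow> 'a \<times> num) \<Rightarrow> num \<Rightarrow> 'a tri \<times> num" where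
  "next3 f n = (case f n of (x, n) \<Rightarrow> (case f n of (y, n) \<Rightarrow> (case f n of (z, n) \<Rightarrow> (T x y z, n))))"

text \<open>
  A nonzero block is written as a number with 27 binary digits below a leading 1.
\<close>

definition block_of :: "int \<Rightarrow> block option" where
  "block_of i = (if i > 0 then Some (fst (next3 (next3 next_oct) (num_of_nat (nat i)))) else None)"

lemma block_of_code [code]:
  "block_of 0 = None"
  "block_of (Int.Pos n) = Some (fst (next3 (next3 next_oct) n))"
  by (simp_all add: block_of_def num_of_nat_numeral_eq)

definition column :: "int tri4 \<Rightarrow> block option tri4" where
  "column = map_tri4 block_of"

definition no_column :: "block option tri4" where
  "no_column = (let x = T None None None; y = T x x x; z = T y y y in T z z z)"

section \<open>The conditions on a certificate\<close>

text \<open>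
  Finds the index of a representative from its coordinates without comparing it with the others. Each
  node lists the values stored under the path to it.
\<close>

datatype 'b trie = Leaf | Node "'b list" "'b trie" "'b trie"

fun insert_trie :: "bool list \<Rightarrow> 'b \<Rightarrow> 'b trie \<Rightarrow> 'b trie" where
  "insert_trie [] x Leaf = Node [x] Leaf Leaf"
| "insert_trie [] x (Node xs l r) = Node (x # xs) l r"
| "insert_trie (True # bs) x Leaf = Node [] (insert_trie bs x Leaf) Leaf"
| "insert_trie (False # bs) x Leaf = Node [] Leaf (insert_trie bs x Leaf)"
| "insert_trie (True # bs) x (Node xs l r) = Node xs (insert_trie bs x l) r"
| "insert_trie (False # bs) x (Node xs l r) = Node xs l (insert_trie bs x r)"

fun lookup_trie :: "bool list \<Rightarrow> 'b trie \<Rightarrow> 'b list" where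
  "lookup_trie bs Leaf = []"
| "lookup_trie [] (Node xs l r) = xs"
| "lookup_trie (True # bs) (Node xs l r) = lookup_trie bs l"
| "lookup_trie (False # bs) (Node xs l r) = lookup_trie bs r"

fun key :: "('f \<Rightarrow> bool list) \<Rightarrow> 'f vec7 \<Rightarrow> bool list" where
  "key cd (Vec a b c d e f g) = cd a @ cd b @ cd c @ cd d @ cd e @ cd f @ cd g"

fun index_trie :: "('f::field \<Rightarrow> bool list) \<Rightarrow> ('f vec7 \<times> 'b) list \<Rightarrow> 'b trie" where
  "index_trie cd [] = Leaf"
| "index_trie cd ((P, k) # xs) =
     (if P = vnull then index_trie cd xs else insert_trie (key cd P) k (index_trie cd xs))"

text \<open>
  If \<open>u\<close> and \<open>v\<close> are independent, each 1-space of their span occurs exactly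
  once.
\<close>

fun plane_points :: "'f::field list \<Rightarrow> 'f vec7 \<times> 'f vec7 \<Rightarrow> 'f vec7 list" where
  "plane_points els (u, v) = map normal (u # map (\<lambda>t. vadd v (smul t u)) els)"

fun act_plane :: "'f::field \<Rightarrow> mono \<Rightarrow> 'f vec7 \<times> 'f vec7 \<Rightarrow> 'f vec7 \<times> 'f vec7" where
  "act_plane w x (u, v) = (act w x u, act w x v)"

text \<open>
  The pairs \<open>(k, x)\<close> such that \<open>x\<close> moves some vector of the plane
  \<open>l\<close> to a multiple of the representative with index \<open>k\<close>. They describe
  which vectors of the family lie in \<open>l\<close>, see \<open>mem_indices\<close>.
\<close>

definition indices where
  "indices els w cd tr l = concat (map (\<lambda>p. concat (map (\<lambda>x.
     map (\<lambda>k. (k, x)) (lookup_trie (key cd (normal (act w x p))) tr)) all_mono)) (plane_points els l))"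

text \<open>
  The entry at \<open>h\<close> is the parity of the number of vectors in a representative plane that
  are related to the translate by \<open>h\<close> of the representative plane whose relations are
  given by \<open>t\<close>; see \<open>odd_related_plane\<close>.
\<close>

fun interaction :: "block option tri4 \<Rightarrow> (ix \<times> mono) list \<Rightarrow> block option" where
  "interaction t [] = None"
| "interaction t ((k, x) # ns) = block_xor (map_option (translate x) (sel4 k t)) (interaction t ns)"

fun odd_length :: "'a list \<Rightarrow> bool" where
  "odd_length [] = False" | "odd_length (x # xs) = (\<not> odd_length xs)"

fun entry_opt :: "mono \<Rightarrow> block option \<Rightarrow> bool" where
  "entry_opt h None = False" | "entry_opt h (Some v) = entry h v"

text \<open>
  The second property of the relation, for the representative plane with index \<open>j\<close>. By
  invariance it then holds for the translates.
\<close>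

definition check_diagonal where
  "check_diagonal points j ns t y \<longleftrightarrow> distinct ns \<and>
     entry_opt (Z0, Z0, Z0) (sel4 j y) =
       (parity4 (zip_tri4 (\<lambda>P v. if P = vnull then False else block_parity v) points t) \<noteq> odd_length ns)"

definition meet where
  "meet els l l' \<longleftrightarrow> (let ps = plane_points els l in
     list_ex (\<lambda>p. p \<noteq> vnull \<and> List.member ps p) (plane_points els l'))"

fun no_entry :: "block option \<Rightarrow> bool" where
  "no_entry None = True" | "no_entry (Some v) = all_tri (all_tri (\<lambda>x. x = O0)) v"

text \<open>
  The first property of the relation, for \<open>l\<close> and all translates \<open>h l'\<close>:
  where the two parities differ, the planes must meet.
\<close>

definition check_pair where
  "check_pair els w l l' y y' \<longleftrightarrow> (let d = block_xor y (map_option inverted y') in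
     if no_entry d then True
     else list_all (\<lambda>h. if entry_opt h d then meet els l (act_plane w h l') else True) all_mono)"

text \<open>
  The condition is symmetric in the two planes, so one of the two orders of indices suffices.
\<close>

definition check_symmetry where
  "check_symmetry els w planes ys \<longleftrightarrow>
     all_tri4 (\<lambda>b. b) (zip_tri4 (\<lambda>(j, lj) yj. all_tri4 (\<lambda>b. b)
       (zip_tri4 (\<lambda>((i, li), yji) yi. if less_ix j i then True else check_pair els w li lj yji (sel4 j yi))
         (zip_tri4 Pair planes yj) ys)) planes ys)"

text \<open>
  Such a singular vector consists of two orthogonal nonzero triples, hence of an incident point and
  line of a projective plane.
\<close>

fun flag :: "'f::field vec7 \<Rightarrow> bool" where
  "flag (Vec a b c d e f g) \<longleftrightarrow> d = 0 \<and> \<not> (a = 0 \<and> b = 0 \<and> c = 0) \<and> \<not> (e = 0 \<and> f = 0 \<and> g = 0)"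

fun upper :: "'f::field vec7 \<Rightarrow> 'f vec7" where
  "upper (Vec a b c d e f g) = Vec a b c 0 0 0 0"

fun mid :: "'f vec7 \<Rightarrow> 'f" where
  "mid (Vec a b c d e f g) = d"

text \<open>
  \<open>ls\<close> is a list of planes through the flag vector \<open>P\<close>. The conditions say
  that it contains the plane through the two halves of \<open>P\<close>, and the planes through
  \<open>P\<close> and \<open>b + s U\<close>, where \<open>b\<close> is one vector of the list with
  nonzero middle coordinate that satisfies the equations with \<open>P\<close>, \<open>U\<close> is
  the first half of \<open>P\<close>, and \<open>s\<close> is any scalar. There are no other hexagon
  planes through \<open>P\<close>, see \<open>check_flag_complete\<close>.
\<close>

definition check_flag where
  "check_flag els P ls \<longleftrightarrow>
     list_ex (\<lambda>l. List.member (plane_points els l) (normal (upper P))) ls \<and>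
     list_ex (\<lambda>l. list_ex (\<lambda>b. if mid b = 0 then False else hexeqs P b \<and>
       list_all (\<lambda>s. list_ex (\<lambda>l. List.member (plane_points els l) (normal (vadd b (smul s (upper P))))) ls) els)
       (plane_points els l)) ls"

definition check_flags where
  "check_flags els w points planes ns \<longleftrightarrow>
     all_tri4 (\<lambda>b. b) (zip_tri4 (\<lambda>P k. if flag P then check_flag els P
       (concat (list4 (zip_tri4 (\<lambda>l n. map (\<lambda>(k', x). act_plane w x l) (filter (\<lambda>(k', x). k' = k) n)) planes ns)))
       else True) points ix_tri4)"

text \<open>
  The singular flag vectors whose first nonzero coordinate is 1.
\<close>

definition flags :: "'f::field list \<Rightarrow> 'f vec7 list" where
  "flags els = concat (map (\<lambda>(a, b, c). concat (map (\<lambda>(e, f, g).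
     if e = 0 \<and> f = 0 \<and> g = 0 then [] else if a * e + b * f + c * g = 0 then [Vec a b c 0 e f g] else [])
       (List.product els (List.product els els))))
     (map (\<lambda>(b, c). (1, b, c)) (List.product els els) @ map (\<lambda>c. (0, 1, c)) els @ [(0, 0, 1)]))"

fun reaches where
  "reaches w cd tr v [] = False"
| "reaches w cd tr v (x # xs) =
     (case lookup_trie (key cd (normal (act w x v))) tr of [] \<Rightarrow> reaches w cd tr v xs | _ # _ \<Rightarrow> True)"

text \<open>
  Each flag vector can be moved to a multiple of a representative.
\<close>

definition check_reach where
  "check_reach els w cd tr \<longleftrightarrow> list_all (\<lambda>v. reaches w cd tr v all_mono) (flags els)"

definition check_all where
  "check_all els w points planes table ns ys \<longleftrightarrow>
     all_tri4 (\<lambda>b. b) (zip_tri4 (\<lambda>(j, n) (t, y). check_diagonal points j n t y) (zip_tri4 Pair ix_tri4 ns) (zip_tri4 Pair table ys)) \<and>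
     check_symmetry els w (zip_tri4 Pair ix_tri4 planes) ys \<and> check_flags els w points planes ns"

text \<open>
  The predicates below only pass on intermediate results, so that each is computed once.
\<close>

definition with_interactions where
  "with_interactions els w points planes table ns \<longleftrightarrow>
     check_all els w points planes table ns (map_tri4 (\<lambda>t. map_tri4 (interaction t) ns) table)"

definition with_trie where
  "with_trie els w cd points planes table tr \<longleftrightarrow> check_reach els w cd tr \<and>
     with_interactions els w points planes table (map_tri4 (indices els w cd tr) planes)"

definition certificate where
  "certificate els w cd points planes table \<longleftrightarrow>
     all_tri4 (\<lambda>P. normal P = P \<and> qform P = 0) points \<and>
     parity4 (map_tri4 (\<lambda>P. P \<noteq> vnull) points) \<and>
     with_trie els w cd points planes table (index_trie cd (list4 (zip_tri4 Pair points ix_tri4)))"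

fun code2 :: "f2 \<Rightarrow> bool list" where
  "code2 B0 = [False]" | "code2 B1 = [True]"

fun code4 :: "f4 \<Rightarrow> bool list" where
  "code4 F0 = [False, False]" | "code4 F1 = [False, True]" | "code4 Fw = [True, False]" | "code4 Fv = [True, True]"

section \<open>The group law\<close>

lemma UNIV_z3: "(UNIV :: z3 set) = {Z0, Z1, Z2}"
  using z3.nchotomy by auto

instance z3 :: finite
  by standard (simp add: UNIV_z3)

instantiation z3 :: ab_group_add
begin
definition "zero_z3 = Z0"
definition "plus_z3 = add3"
definition "uminus_z3 = neg3"
definition "minus_z3 a b = add3 a (neg3 b)"
instance
proof
  fix a b c :: z3
  show "a + b + c = a + (b + c)"
    by (cases a; cases b; cases c; simp add: plus_z3_def)
  show "a + b = b + a"
    by (cases a; cases b; simp add: plus_z3_def)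
  show "0 + a = a"
    by (simp add: plus_z3_def zero_z3_def)
  show "- a + a = 0"
    by (cases a; simp add: plus_z3_def zero_z3_def uminus_z3_def)
  show "a - b = a + - b"
    by (simp add: plus_z3_def minus_z3_def uminus_z3_def)
qed
end

lemma add3_eq [simp]: "add3 a b = a + b"
  by (simp add: plus_z3_def)

lemma neg3_eq [simp]: "neg3 a = - a"
  by (simp add: uminus_z3_def)

lemma Z0_eq: "Z0 = 0"
  by (simp add: zero_z3_def)

lemmas z3_defs = zero_z3_def plus_z3_def uminus_z3_def

lemma z3_simps [simp]:
  "Z0 + a = a" "a + Z0 = a" "Z1 + Z1 = Z2" "Z1 + Z2 = Z0" "Z2 + Z1 = Z0" "Z2 + Z2 = Z1"
  "- Z0 = Z0" "- Z1 = Z2" "- Z2 = Z1" "- a + a = Z0" "a + - a = Z0"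
  by (cases a; simp add: z3_defs del: add3_eq neg3_eq)+

text \<open>
  The two components of the automorphism of the torus induced by the shift \<open>c\<close>.
\<close>

fun turn1 :: "z3 \<Rightarrow> z3 \<Rightarrow> z3 \<Rightarrow> z3" where
  "turn1 Z0 a b = a" | "turn1 Z1 a b = b" | "turn1 Z2 a b = - (a + b)"

fun turn2 :: "z3 \<Rightarrow> z3 \<Rightarrow> z3 \<Rightarrow> z3" where
  "turn2 Z0 a b = b" | "turn2 Z1 a b = - (a + b)" | "turn2 Z2 a b = a"

text \<open>
  The semidirect product of torus and shifts, acting by \<open>act_mmul\<close>.
\<close>

fun mmul :: "mono \<Rightarrow> mono \<Rightarrow> mono" where
  "mmul (c, a, b) (c', a', b') = (c + c', a + turn1 c a' b', b + turn2 c a' b')"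

fun minv :: "mono \<Rightarrow> mono" where
  "minv (c, a, b) = (- c, turn1 (- c) (- a) (- b), turn2 (- c) (- a) (- b))"

definition mone :: mono where
  "mone = (Z0, Z0, Z0)"

lemma turn_add:
  "turn1 c (a + a') (b + b') = turn1 c a b + turn1 c a' b'"
  "turn2 c (a + a') (b + b') = turn2 c a b + turn2 c a' b'"
  by (cases c; simp)+

lemma turn_turn:
  "turn1 c (turn1 c' a b) (turn2 c' a b) = turn1 (c + c') a b"
  "turn2 c (turn1 c' a b) (turn2 c' a b) = turn2 (c + c') a b"
  by (cases c; cases c'; simp)+

lemma turn_zero: "turn1 c Z0 Z0 = Z0" "turn2 c Z0 Z0 = Z0"
  by (cases c; simp)+

lemma mmul_assoc: "mmul (mmul x y) z = mmul x (mmul y z)"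
  by (cases x; cases y; cases z) (simp add: turn_add turn_turn add.assoc)

lemma mmul_mone [simp]: "mmul mone x = x" "mmul x mone = x"
  by (cases x; simp add: mone_def turn_zero)+

lemma mmul_minv [simp]: "mmul (minv x) x = mone" "mmul x (minv x) = mone"
  by (cases x rule: minv.cases, rename_tac c a b, case_tac c; case_tac a; case_tac b; simp add: mone_def)+

lemma mmul_cancel [simp]: "mmul x (mmul (minv x) y) = y" "mmul (minv x) (mmul x y) = y"
  unfolding mmul_assoc[symmetric] by simp_all

lemma minv_unique: "mmul x y = mone \<Longrightarrow> minv x = y"
  using mmul_cancel(2)[of x y] by simp

lemma minv_minv [simp]: "minv (minv x) = x"
  by (rule minv_unique) simp

lemma minv_mmul: "minv (mmul x y) = mmul (minv y) (minv x)"
  by (rule minv_unique) (simp add: mmul_assoc)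

lemma set_all_mono [simp]: "set all_mono = UNIV"
proof -
  have "a \<in> set all_z3" for a
    by (cases a) (simp_all add: all_z3_def)
  then show ?thesis
    by (auto simp: all_mono_def)
qed

section \<open>Meaning of the tree and group algebra operations\<close>

lemma sel_map_tri [simp]: "sel a (map_tri f t) = f (sel a t)"
  by (cases a; cases t) simp_all

lemma sel_zip_tri [simp]: "sel a (zip_tri f s t) = f (sel a s) (sel a t)"
  by (cases a; cases s; cases t) simp_all

lemma sel_zip3_tri [simp]: "sel a (zip3_tri f s t u) = f (sel a s) (sel a t) (sel a u)"
  by (cases a; cases s; cases t; cases u) simp_all

lemma all_z3_iff: "(\<forall>a. Q a) \<longleftrightarrow> Q Z0 \<and> Q Z1 \<and> Q Z2"
  by (metis z3.exhaust)

lemma all_tri_iff [simp]: "all_tri P t \<longleftrightarrow> (\<forall>a. P (sel a t))"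
  by (cases t) (simp add: all_z3_iff)

lemma sel_rot [simp]: "sel a (rot b t) = sel (b + a) t"
  by (cases a; cases b; cases t) simp_all

lemma sel_flip3 [simp]: "sel a (flip3 t) = sel (- a) t"
  by (cases a; cases t) simp_all

lemma sel_flip9 [simp]: "sel b (sel a (flip9 v)) = sel (- b) (sel (- a) v)"
  by (simp add: flip9_def)

lemma sel_twist1: "sel b (sel a (twist1 v)) = sel (turn2 Z1 a b) (sel (turn1 Z1 a b) v)"
proof -
  obtain p q r where "v = T p q r"
    by (cases v)
  then show ?thesis
    by (cases p; cases q; cases r; cases a; cases b) simp_all
qed

lemma sel_twist [simp]: "sel b (sel a (twist c v)) = sel (turn2 c a b) (sel (turn1 c a b) v)"
proof (cases c)
  case Z2
  then show ?thesis
    by (simp only: twist.simps sel_twist1 turn_turn z3_simps)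
qed (simp_all only: twist.simps sel_twist1 turn1.simps turn2.simps)

lemma digit_oct_xor [simp]: "digit c (oct_xor x y) \<longleftrightarrow> (digit c x \<noteq> digit c y)"
  by (cases c; cases x; cases y) simp_all

lemma digit_oct_rot [simp]: "digit c (oct_rot b x) = digit (b + c) x"
  by (cases c; cases b; cases x) simp_all

lemma digit_oct_of: "digit c (oct_of p q r) = sel c (T p q r)"
  by (cases c; cases p; cases q; cases r) simp_all

lemma entry_translate [simp]: "entry h (translate x v) = entry (mmul x h) v"
  by (cases h; cases x) simp

lemma entry_inverted [simp]: "entry h (inverted v) = entry (minv h) v"
proof -
  obtain c a b where "h = (c, a, b)"
    by (cases h)
  then show ?thesis
    by (cases c) (simp_all add: inverted_def digit_oct_of sel_twist1)
qed

lemma entry_opt_xor [simp]: "entry_opt h (block_xor u v) \<longleftrightarrow> (entry_opt h u \<noteq> entry_opt h v)"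
  by (cases u; cases v; cases h) simp_all

lemma entry_opt_translate [simp]:
  "entry_opt h (map_option (translate x) v) = entry_opt (mmul x h) v"
  by (cases v) simp_all

lemma entry_opt_inverted [simp]: "entry_opt h (map_option inverted v) = entry_opt (minv h) v"
  by (cases v) simp_all

lemma no_entryD: "no_entry v \<Longrightarrow> \<not> entry_opt h v"
proof (cases v)
  case (Some u)
  obtain c a b where h: "h = (c, a, b)"
    by (cases h)
  assume "no_entry v"
  then show ?thesis
    using Some h by (cases c) simp_all
qed simp

lemma odd_length [simp]: "odd_length xs \<longleftrightarrow> odd (length xs)"
  by (induction xs) auto

lemma entry_interaction:
  "entry_opt h (interaction t ns) \<longleftrightarrow>
     odd (length (filter (\<lambda>(k, x). entry_opt (mmul x h) (sel4 k t)) ns))"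
  by (induction ns) auto

lemma sel4_map_tri4 [simp]: "sel4 k (map_tri4 f t) = f (sel4 k t)"
  by (cases k) (simp add: map_tri4_def)

lemma sel4_zip_tri4 [simp]: "sel4 k (zip_tri4 f s t) = f (sel4 k s) (sel4 k t)"
  by (cases k) (simp add: zip_tri4_def)

lemma all_tri4_iff [simp]: "all_tri4 P t \<longleftrightarrow> (\<forall>k. P (sel4 k t))"
  by (auto simp: all_tri4_def)

lemma sel4_ix_tri4 [simp]: "sel4 k ix_tri4 = k"
proof -
  have "sel a z3_tri = a" for a
    by (cases a) (simp_all add: z3_tri_def)
  then show ?thesis
    by (cases k) (simp add: ix_tri4_def)
qed

lemma set_list4 [simp]: "set (list4 t) = range (\<lambda>k. sel4 k t)"
proof -
  have set_tri_list: "set (tri_list u) = range (\<lambda>a. sel a u)" for u :: "'b tri"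
    by (cases u) (simp add: UNIV_z3)
  have "x \<in> set (list4 t) \<longleftrightarrow> (\<exists>a b c d. x = sel d (sel c (sel b (sel a t))))" for x
    unfolding list4_def by (simp add: set_tri_list image_iff)
  moreover have "x \<in> range (\<lambda>k. sel4 k t) \<longleftrightarrow> (\<exists>a b c d. x = sel d (sel c (sel b (sel a t))))" for x
    by (simp add: split_paired_Ex image_iff)
  ultimately show ?thesis
    by blast
qed

lemma odd_sum_of_bool: "odd (\<Sum>a\<in>A. of_bool (odd (n a)) :: nat) \<longleftrightarrow> odd (\<Sum>a\<in>A. n a)" for n :: "_ \<Rightarrow> nat"
proof (induction A rule: infinite_finite_induct)
  case (insert x F)
  then show ?case
    by (cases "odd (n x)") simp_all
qed simp_all

lemma parity3_eq: "parity3 t \<longleftrightarrow> odd (\<Sum>a\<in>UNIV. of_bool (sel a t) :: nat)"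
  by (cases t) (simp add: UNIV_z3 del: sum_of_bool_eq)

lemma sum_UNIV_prod:
  "(\<Sum>x\<in>UNIV. f x) = (\<Sum>a\<in>UNIV. \<Sum>b\<in>UNIV. f (a, b))" for f :: "'a::finite \<times> 'b::finite \<Rightarrow> nat"
  unfolding sum.cartesian_product by simp

lemma parity3_map_tri:
  assumes "\<And>u. f u \<longleftrightarrow> odd (n u :: nat)"
  shows "parity3 (map_tri f t) \<longleftrightarrow> odd (\<Sum>a\<in>UNIV. n (sel a t))"
  unfolding parity3_eq sel_map_tri assms odd_sum_of_bool ..

lemma parity4_eq: "parity4 t \<longleftrightarrow> odd (card {k. sel4 k t})"
proof -
  have "parity4 t \<longleftrightarrow> odd (\<Sum>a\<in>UNIV. \<Sum>b\<in>UNIV. \<Sum>c\<in>UNIV. \<Sum>d\<in>UNIV.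
      of_bool (sel d (sel c (sel b (sel a t)))) :: nat)"
    unfolding parity4_def by (intro parity3_map_tri parity3_eq)
  also have "(\<Sum>a\<in>UNIV. \<Sum>b\<in>UNIV. \<Sum>c\<in>UNIV. \<Sum>d\<in>UNIV.
      of_bool (sel d (sel c (sel b (sel a t)))) :: nat) = (\<Sum>k\<in>UNIV. of_bool (sel4 k t))"
    unfolding sum_UNIV_prod sel4.simps ..
  finally show ?thesis
    by simp
qed

lemma oct_parity_eq: "oct_parity x \<longleftrightarrow> odd (\<Sum>c\<in>UNIV. of_bool (digit c x) :: nat)"
  by (cases x) (simp_all add: UNIV_z3)

lemma block_parity_eq: "block_parity v \<longleftrightarrow> odd (card {h. entry_opt h v})"
proof (cases v)
  case (Some u)
  have "block_parity v \<longleftrightarrow> odd (\<Sum>a\<in>UNIV. \<Sum>b\<in>UNIV. \<Sum>c\<in>UNIV. of_bool (digit c (sel b (sel a u))) :: nat)"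
    unfolding Some block_parity.simps by (intro parity3_map_tri oct_parity_eq)
  also have "(\<Sum>a\<in>UNIV. \<Sum>b\<in>UNIV. \<Sum>c\<in>UNIV. of_bool (digit c (sel b (sel a u))) :: nat) =
      (\<Sum>a\<in>UNIV. \<Sum>c\<in>UNIV. \<Sum>b\<in>UNIV. of_bool (digit c (sel b (sel a u))))"
    by (intro sum.cong refl sum.swap)
  also have "\<dots> = (\<Sum>c\<in>UNIV. \<Sum>a\<in>UNIV. \<Sum>b\<in>UNIV. of_bool (digit c (sel b (sel a u))))"
    by (rule sum.swap)
  also have "\<dots> = (\<Sum>h\<in>UNIV. of_bool (entry h u))"
    unfolding sum_UNIV_prod entry.simps ..
  finally show ?thesis
    by (simp add: Some)
qed simp

lemma less_ix_asym: "less_ix i j \<Longrightarrow> \<not> less_ix j i"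
proof -
  have asym: "less3 a b \<Longrightarrow> less3 b a \<Longrightarrow> False" for a b
    by (cases a; cases b; simp)
  show "less_ix i j \<Longrightarrow> \<not> less_ix j i"
    by (cases i; cases j) (auto split: if_splits dest: asym)
qed

section \<open>The monomial group acting on vectors\<close>

lemma tpow_add:
  assumes "w * w * w = 1"
  shows "tpow w (a + b) = tpow w a * tpow w b"
proof -
  have "w * (w * w) = 1" "w * w * (w * w) = w"
    using assms by (simp_all add: mult.assoc)
  then show ?thesis
    by (cases a; cases b; simp add: mult.assoc)
qed

lemma tpow_0 [simp]: "tpow w 0 = 1"
  by (simp flip: Z0_eq)

lemma tpow_nonzero [simp]:
  assumes "w * w * w = 1"
  shows "tpow w a \<noteq> 0"
  using assms by (cases a) auto

lemma shift_shift: "shift c (shift c' v) = shift (c + c') v"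
  by (cases v; cases c; cases c'; simp)

lemma shift_torus: "shift c (torus w a b v) = torus w (turn1 c a b) (turn2 c a b) (shift c v)"
  by (cases v; cases c; simp add: algebra_simps)

lemma torus_torus:
  assumes "w * w * w = 1"
  shows "torus w a b (torus w a' b' v) = torus w (a + a') (b + b') v"
proof -
  have "- (a + a' + (b + b')) = - (a + b) + - (a' + b')" "a + a' + (b + b') = (a + b) + (a' + b')"
    "- (a + a') = - a + - a'" "- (b + b') = - b + - b'"
    by (simp_all add: algebra_simps)
  then show ?thesis
    by (cases v) (simp only: torus.simps add3_eq neg3_eq tpow_add[OF assms] mult.assoc)
qed

lemma act_mmul: "w * w * w = 1 \<Longrightarrow> act w (mmul x y) v = act w x (act w y v)"
  by (cases x; cases y) (simp add: shift_torus torus_torus shift_shift)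

lemma act_mone [simp]: "act w mone v = v"
  by (cases v) (simp add: mone_def)

lemma act_minv [simp]:
  assumes "w * w * w = 1"
  shows "act w x (act w (minv x) v) = v" "act w (minv x) (act w x v) = v"
  using act_mmul[OF assms, symmetric] by simp_all

lemma act_vadd [simp]: "act w x (vadd u v) = vadd (act w x u) (act w x v)"
proof -
  obtain c a b where "x = (c, a, b)"
    by (cases x)
  then show ?thesis
    by (cases u; cases v; cases c; simp add: distrib_left)
qed

lemma act_smul [simp]: "act w x (smul t v) = smul t (act w x v)"
proof -
  obtain c a b where "x = (c, a, b)"
    by (cases x)
  then show ?thesis
    by (cases v; cases c; simp add: mult.left_commute)
qed

lemma smul_zero [simp]: "smul 0 v = vnull" "smul t vnull = vnull"
  by (cases v; simp add: vnull_def)+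

lemma smul_one [simp]: "smul 1 v = v"
  by (cases v) simp

lemma smul_smul [simp]: "smul s (smul t v) = smul (s * t) v"
  by (cases v) (simp add: mult.assoc)

lemma smul_eq_null [simp]: "smul t v = vnull \<longleftrightarrow> t = 0 \<or> v = vnull"
  by (cases v) (auto simp: vnull_def)

lemma smul_vadd: "smul s (vadd u v) = vadd (smul s u) (smul s v)"
  by (cases u; cases v) (simp add: distrib_left)

lemma vadd_smul: "smul (s + t) v = vadd (smul s v) (smul t v)"
  by (cases v) (simp add: distrib_right)

lemma vadd_assoc: "vadd (vadd u v) z = vadd u (vadd v z)"
  by (cases u; cases v; cases z) (simp add: add.assoc)

lemma vadd_commute: "vadd u v = vadd v u"
  by (cases u; cases v) (simp add: add.commute)

lemma vadd_null [simp]: "vadd vnull v = v" "vadd v vnull = v"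
  by (cases v; simp add: vnull_def)+

lemma act_null [simp]: "act w x vnull = vnull"
  using act_smul[of w x 0 vnull] by simp

lemma act_eq_null [simp]:
  assumes "w * w * w = 1"
  shows "act w x v = vnull \<longleftrightarrow> v = vnull"
  using act_minv(2)[OF assms, of x v] by auto

text \<open>
  Each \<open>p\<^sub>i\<^sub>j\<close> is multiplied by the product of the entries at
  \<open>i\<close> and \<open>j\<close>. These products agree on both sides of each equation, which is
  the content of \<open>weights\<close>.
\<close>

lemma torus_preserves:
  assumes "w * w * w = 1"
  shows "hexeqs u v \<Longrightarrow> hexeqs (torus w a b u) (torus w a b v)" and "qform (torus w a b u) = qform u"
proof -
  note add = tpow_add[OF assms, symmetric]
  have weights: "tpow w b * tpow w (- (a + b)) = tpow w (- a)" "tpow w (- b) * tpow w (- a) = tpow w (- (a + b))"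
    "tpow w (- (a + b)) * tpow w a = tpow w (- b)" "tpow w (a + b) * tpow w (- b) = tpow w a"
    "tpow w a * tpow w b = tpow w (a + b)" "tpow w (- a) * tpow w (a + b) = tpow w b"
    unfolding add by (simp_all add: algebra_simps)
  have inverses: "tpow w a * tpow w (- a) = 1" "tpow w b * tpow w (- b) = 1"
      "tpow w (- (a + b)) * tpow w (a + b) = 1"
    unfolding add by simp_all
  have minor: "p * r * (q * s) - q * r' * (p * s') = p * q * (r * s - r' * s')"
    "r * (q * s) - q * r' * s' = q * (r * s - r' * s')" for p q r s r' s' :: 'a
    by (simp_all add: algebra_simps)
  have product: "p * r * (q * s) = r * s" if "p * q = 1" for p q r s :: 'a
    using arg_cong[OF that, of "\<lambda>x. x * (r * s)"] by (simp add: mult.assoc mult.left_commute)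
  show "qform (torus w a b u) = qform u"
    by (cases u) (simp only: qform.simps torus.simps add3_eq neg3_eq inverses[THEN product])
  show "hexeqs u v \<Longrightarrow> hexeqs (torus w a b u) (torus w a b v)"
    by (cases u; cases v) (simp only: hexeqs.simps torus.simps add3_eq neg3_eq minor(1) weights, simp only: minor(2))
qed

lemma shift_preserves:
  "hexeqs u v \<Longrightarrow> hexeqs (shift c u) (shift c v)" "qform (shift c u) = qform u"
  by (cases u; cases v; cases c; simp add: algebra_simps)+

lemma act_hexeqs: "w * w * w = 1 \<Longrightarrow> hexeqs u v \<Longrightarrow> hexeqs (act w x u) (act w x v)"
  by (cases x) (simp add: torus_preserves shift_preserves)

lemma act_qform [simp]: "w * w * w = 1 \<Longrightarrow> qform (act w x u) = qform u"
  by (cases x) (simp add: torus_preserves shift_preserves)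

lemma act_flag: "w * w * w = 1 \<Longrightarrow> flag v \<Longrightarrow> flag (act w x v)"
proof -
  assume w: "w * w * w = 1" "flag v"
  obtain c a b where "x = (c, a, b)"
    by (cases x)
  then show ?thesis
    using w by (cases v; cases c) auto
qed

section \<open>Normalized vectors\<close>

lemma lead_smul: "lead (smul t v) = t * lead v"
  by (cases v) simp

lemma lead_eq_0 [simp]: "lead v = 0 \<longleftrightarrow> v = vnull"
  by (cases v) (simp add: vnull_def)

lemma normal_smul [simp]: "t \<noteq> 0 \<Longrightarrow> normal (smul t v) = normal v"
proof (cases "v = vnull")
  case False
  assume "t \<noteq> 0"
  with False have "inverse (t * lead v) * t = inverse (lead v)"
    by (simp add: field_simps)
  then show ?thesis
    by (simp only: normal_def lead_smul smul_smul)
qed simp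

lemma normal_multiple: obtains t where "t \<noteq> 0" "normal v = smul t v"
proof (cases "v = vnull")
  case True
  then show ?thesis
    using that[of 1] by (simp add: normal_def)
next
  case False
  then show ?thesis
    using that[of "inverse (lead v)"] by (simp add: normal_def)
qed

lemma normal_normal [simp]: "normal (normal v) = normal v"
  by (rule normal_multiple[of v]) simp

lemma normal_eq_null [simp]: "normal v = vnull \<longleftrightarrow> v = vnull"
  by (rule normal_multiple[of v]) simp

section \<open>Planes\<close>

fun plane :: "'f::field vec7 \<times> 'f vec7 \<Rightarrow> 'f vec7 set" where
  "plane (u, v) = {vadd (smul s u) (smul t v) |s t. True}"

declare plane.simps [simp del]

definition indep :: "'f::field vec7 \<Rightarrow> 'f vec7 \<Rightarrow> bool" where
  "indep u v \<longleftrightarrow> (\<forall>s t. vadd (smul s u) (smul t v) = vnull \<longrightarrow> s = 0 \<and> t = 0)"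

lemma indepD:
  assumes "indep u v" "vadd (smul s u) (smul t v) = vnull"
  shows "s = 0" "t = 0"
  using assms unfolding indep_def by blast+

lemma vadd_combine:
  "vadd (smul p (vadd (smul s u) (smul t v))) (smul q (vadd (smul s' u) (smul t' v))) =
     vadd (smul (p * s + q * s') u) (smul (p * t + q * t') v)"
  by (cases u; cases v) (simp add: algebra_simps)

lemma plane_generators [simp]: "u \<in> plane (u, v)" "v \<in> plane (u, v)"
proof -
  have "u = vadd (smul 1 u) (smul 0 v)" "v = vadd (smul 0 u) (smul 1 v)"
    by simp_all
  then show "u \<in> plane (u, v)" "v \<in> plane (u, v)"
    unfolding plane.simps by blast+
qed

lemma plane_combine:
  assumes "p \<in> plane l" "q \<in> plane l"
  shows "vadd (smul s p) (smul t q) \<in> plane l"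
proof -
  obtain u v where l: "l = (u, v)"
    by (cases l)
  with assms obtain a b a' b' where "p = vadd (smul a u) (smul b v)" "q = vadd (smul a' u) (smul b' v)"
    by (auto simp: plane.simps)
  then have "vadd (smul s p) (smul t q) = vadd (smul (s * a + t * a') u) (smul (s * b + t * b') v)"
    by (simp add: vadd_combine)
  then show ?thesis
    unfolding l plane.simps by blast
qed

lemma plane_smul: "p \<in> plane l \<Longrightarrow> smul t p \<in> plane l"
  using plane_combine[of p l p t 0] by simp

lemma plane_smul_iff [simp]: "t \<noteq> 0 \<Longrightarrow> smul t p \<in> plane l \<longleftrightarrow> p \<in> plane l"
  using plane_smul[of "smul t p" l "inverse t"] plane_smul[of p l t] by auto

lemma plane_normal [simp]: "normal p \<in> plane l \<longleftrightarrow> p \<in> plane l"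
  by (rule normal_multiple[of p]) simp

lemma plane_subset: "p \<in> plane l \<Longrightarrow> q \<in> plane l \<Longrightarrow> plane (p, q) \<subseteq> plane l"
  unfolding plane.simps using plane_combine by blast

text \<open>
  Exchange in dimension two: by Cramer's rule with the determinant \<open>D\<close>, the generators
  are combinations of \<open>p\<close> and \<open>q\<close>.
\<close>

lemma plane_exchange:
  assumes "p \<in> plane l" "q \<in> plane l" "indep p q"
  shows "plane (p, q) = plane l"
proof
  show "plane (p, q) \<subseteq> plane l"
    using assms by (intro plane_subset)
  obtain u v where l: "l = (u, v)"
    by (cases l)
  with assms obtain s t s' t' where st: "p = vadd (smul s u) (smul t v)" "q = vadd (smul s' u) (smul t' v)"
    by (auto simp: plane.simps)
  define D where "D = s * t' - s' * t"
  have "D \<noteq> 0"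
  proof
    assume "D = 0"
    then have "vadd (smul t' p) (smul (- t) q) = vnull" "vadd (smul s' p) (smul (- s) q) = vnull"
      unfolding st vadd_combine by (simp_all add: D_def mult.commute)
    from indepD[OF assms(3) this(1)] indepD[OF assms(3) this(2)]
    have "t = 0" "s = 0" "t' = 0" "s' = 0"
      by simp_all
    then have "vadd (smul 1 p) (smul 0 q) = vnull"
      unfolding st by simp
    then show False
      using indepD(1)[OF assms(3), of 1 0] by simp
  qed
  have "smul D u = vadd (smul t' p) (smul (- t) q)" "smul D v = vadd (smul (- s') p) (smul s q)"
    unfolding st vadd_combine by (simp_all add: D_def mult.commute)
  then have "smul D u \<in> plane (p, q)" "smul D v \<in> plane (p, q)"
    by (simp_all add: plane_combine)
  then show "plane l \<subseteq> plane (p, q)"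
    using \<open>D \<noteq> 0\<close> unfolding l by (intro plane_subset) simp_all
qed

lemma act_plane_image: "act w x ` plane l = plane (act_plane w x l)"
proof -
  obtain u v where l: "l = (u, v)"
    by (cases l)
  show ?thesis
    unfolding l act_plane.simps plane.simps act_vadd[symmetric] act_smul[symmetric] by blast
qed

lemma indep_extend:
  assumes "indep u v" "z \<in> plane (u, v)" "z \<noteq> vnull"
  obtains y where "y \<in> plane (u, v)" "indep z y"
proof -
  obtain s t where z: "z = vadd (smul s u) (smul t v)"
    using assms(2) by (auto simp: plane.simps)
  show ?thesis
  proof (cases "s = 0")
    case True
    then have "t \<noteq> 0"
      using assms(3) z by auto
    have "indep z u"
      unfolding indep_def
    proof (intro allI impI)
      fix p q assume "vadd (smul p z) (smul q u) = vnull"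
      then have "vadd (smul q u) (smul (p * t) v) = vnull"
        using True by (simp add: z vadd_commute)
      from indepD[OF assms(1) this] show "p = 0 \<and> q = 0"
        using \<open>t \<noteq> 0\<close> by simp
    qed
    then show ?thesis
      using that[of u] by simp
  next
    case False
    have "indep z v"
      unfolding indep_def
    proof (intro allI impI)
      fix p q assume "vadd (smul p z) (smul q v) = vnull"
      then have "vadd (smul (p * s) u) (smul (p * t + q) v) = vnull"
        by (simp add: z smul_vadd vadd_smul vadd_assoc)
      from indepD[OF assms(1) this] show "p = 0 \<and> q = 0"
        using False by simp
    qed
    then show ?thesis
      using that[of v] by simp
  qed
qed

text \<open>
  A change of basis multiplies all Grassmann coordinates by its determinant.
\<close>

lemma hexeqs_combine:
  assumes "hexeqs u v"
  shows "hexeqs (vadd (smul s u) (smul t v)) (vadd (smul s' u) (smul t' v))"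
proof -
  obtain x0 x1 x2 x3 x4 x5 x6 where u: "u = Vec x0 x1 x2 x3 x4 x5 x6"
    by (cases u)
  obtain y0 y1 y2 y3 y4 y5 y6 where v: "v = Vec y0 y1 y2 y3 y4 y5 y6"
    by (cases v)
  have minor: "(s * a + t * b) * (s' * c + t' * d) - (s * c + t * d) * (s' * a + t' * b) =
      (s * t' - t * s') * (a * d - c * b)" for a b c d
    by (simp add: algebra_simps)
  show ?thesis
    using assms by (simp only: u v smul.simps vadd.simps hexeqs.simps minor)
qed

lemma plane_hexeqs: "hexeqs u v \<Longrightarrow> p \<in> plane (u, v) \<Longrightarrow> q \<in> plane (u, v) \<Longrightarrow> hexeqs p q"
  by (auto simp: plane.simps intro: hexeqs_combine)

lemma plane_points_mem: "p \<in> set (plane_points els l) \<Longrightarrow> p \<in> plane l"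
proof -
  obtain u v where l: "l = (u, v)"
    by (cases l)
  have "vadd v (smul t u) \<in> plane l" for t
    using plane_combine[of v l u 1 t] plane_generators[of u v] unfolding l by simp
  then show "p \<in> set (plane_points els l) \<Longrightarrow> p \<in> plane l"
    using plane_generators(1)[of u v] unfolding l by auto
qed

lemma plane_points_complete:
  assumes "set els = UNIV" "p \<in> plane l" "p \<noteq> vnull"
  shows "normal p \<in> set (plane_points els l)"
proof -
  obtain u v where l: "l = (u, v)"
    by (cases l)
  with assms obtain s t where p: "p = vadd (smul s u) (smul t v)"
    by (auto simp: plane.simps)
  show ?thesis
  proof (cases "t = 0")
    case True
    then show ?thesis
      using assms(3) by (simp add: p l)
  next
    case False
    then have "p = smul t (vadd v (smul (s / t) u))"
      by (simp add: p smul_vadd vadd_commute)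
    then have "normal p = normal (vadd v (smul (s / t) u))"
      by (simp only: normal_smul[OF False])
    then show ?thesis
      using assms(1) by (auto simp: l)
  qed
qed

section \<open>Looking up points\<close>

lemma lookup_Node:
  "lookup_trie bs (Node xs l r) =
     (case bs of [] \<Rightarrow> xs | b # bs \<Rightarrow> lookup_trie bs (if b then l else r))"
proof (cases bs)
  case (Cons b bs')
  then show ?thesis
    by (cases b) simp_all
qed simp

lemma lookup_insert_trie:
  "set (lookup_trie bs (insert_trie bs' x t)) =
     (if bs = bs' then insert x (set (lookup_trie bs t)) else set (lookup_trie bs t))"
  by (induction bs' x t arbitrary: bs rule: insert_trie.induct)
    (auto simp: lookup_Node split: list.splits)

lemma key_inj:
  assumes "inj cd" "\<And>a. length (cd a) = n"
  shows "key cd u = key cd v \<longleftrightarrow> u = v"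
proof -
  have "cd a @ xs = cd b @ ys \<longleftrightarrow> a = b \<and> xs = ys" for a b xs ys
    using assms inj_eq[OF assms(1)] by simp
  moreover have "cd a = cd b \<longleftrightarrow> a = b" for a b
    using inj_eq[OF assms(1)] .
  ultimately show ?thesis
    by (cases u; cases v) simp
qed

lemma lookup_index_trie:
  assumes "inj cd" "\<And>a. length (cd a) = n"
  shows "set (lookup_trie (key cd v) (index_trie cd xs)) = {k. (v, k) \<in> set xs \<and> v \<noteq> vnull}"
proof (induction xs)
  case (Cons p xs)
  then show ?case
    by (cases p) (auto simp: lookup_insert_trie key_inj[OF assms])
qed simp

section \<open>Planes through flagged vectors\<close>

text \<open>
  A vanishing cross product with a nonzero triple forces proportionality.
\<close>

lemma cross_zero:
  fixes a b c :: "'f::field"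
  assumes "\<not> (a = 0 \<and> b = 0 \<and> c = 0)"
    and "a * b' = b * a'" "b * c' = c * b'" "c * a' = a * c'"
  obtains s where "a' = s * a" "b' = s * b" "c' = s * c"
proof -
  consider "a \<noteq> 0" | "b \<noteq> 0" | "c \<noteq> 0"
    using assms(1) by blast
  then show ?thesis
  proof cases
    case 1
    show ?thesis
      by (rule that[of "a' / a"]) (use 1 assms(2-) in \<open>simp_all add: field_simps\<close>)
  next
    case 2
    show ?thesis
      by (rule that[of "b' / b"]) (use 2 assms(2-) in \<open>simp_all add: field_simps\<close>)
  next
    case 3
    show ?thesis
      by (rule that[of "c' / c"]) (use 3 assms(2-) in \<open>simp_all add: field_simps\<close>)
  qed
qed

lemma mid_vadd [simp]: "mid (vadd u v) = mid u + mid v"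
  by (cases u; cases v) simp

lemma mid_smul [simp]: "mid (smul t v) = t * mid v"
  by (cases v) simp

lemma mid_upper [simp]: "mid (upper v) = 0"
  by (cases v) simp

lemma mid_flag: "flag v \<Longrightarrow> mid v = 0"
  by (cases v) simp

text \<open>
  If both middle coordinates vanish, three of the equations say that the cross product of the first
  halves is 0, and three that the cross product of the second halves is 0. So both halves of
  \<open>y\<close> are multiples of those of \<open>P\<close>.
\<close>

lemma hexeqs_flag_mid:
  assumes "flag P" "hexeqs P y" "mid y = 0"
  obtains s t where "y = vadd (smul s (upper P)) (smul t P)"
proof -
  obtain a b c d e f g where P: "P = Vec a b c d e f g"
    by (cases P)
  obtain a' b' c' d' e' f' g' where y: "y = Vec a' b' c' d' e' f' g'"
    by (cases y)
  have 0: "d = 0" "d' = 0" "\<not> (a = 0 \<and> b = 0 \<and> c = 0)" "\<not> (e = 0 \<and> f = 0 \<and> g = 0)"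
    using assms(1,3) by (simp_all add: P y)
  obtain s where s: "a' = s * a" "b' = s * b" "c' = s * c"
    by (rule cross_zero[OF 0(3), of b' a' c']) (use assms(2) 0(1,2) in \<open>auto simp: P y\<close>)
  obtain t where t: "e' = t * e" "f' = t * f" "g' = t * g"
    by (rule cross_zero[OF 0(4), of f' e' g']) (use assms(2) 0(1,2) in \<open>auto simp: P y\<close>)
  show ?thesis
    by (rule that[of "s - t" t]) (simp add: P y s t 0(1,2) algebra_simps)
qed

lemma hexeqs_right:
  assumes "hexeqs u v" "hexeqs u v'"
  shows "hexeqs u (vadd (smul s v) (smul t v'))"
proof -
  have minor: "p * (s * a + t * a') - q * (s * b + t * b') = s * (p * a - q * b) + t * (p * a' - q * b')"
    for p q a a' b b'
    by (simp add: algebra_simps)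
  show ?thesis
    using assms by (cases u; cases v; cases v') (simp only: smul.simps vadd.simps hexeqs.simps minor)
qed

text \<open>
  Some nonzero \<open>z\<close> in the plane has middle coordinate 0. If one half of \<open>z\<close>
  vanishes, the equations for \<open>z\<close> and another vector \<open>y\<close> make the middle
  coordinate of \<open>y\<close> vanish and the corresponding other half of \<open>y\<close>
  proportional to that of \<open>z\<close>. Then a combination of \<open>y\<close> and
  \<open>z\<close> keeps the nonzero half of \<open>z\<close> and has the remaining half of
  \<open>y\<close>, which is not 0 by independence.
\<close>

lemma exists_flag:
  assumes "hexeqs u v" "indep u v"
  obtains z where "z \<in> plane (u, v)" "flag z"
proof -
  obtain z where z: "z \<in> plane (u, v)" "mid z = 0" "z \<noteq> vnull"
  proof (cases "mid u = 0")
    case True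
    have "u \<noteq> vnull"
      using indepD(1)[OF assms(2), of 1 0] by auto
    then show ?thesis
      using that[of u] True by simp
  next
    case False
    have "vadd (smul (mid v) u) (smul (- mid u) v) \<in> plane (u, v)"
      by (intro plane_combine plane_generators)
    moreover have "vadd (smul (mid v) u) (smul (- mid u) v) \<noteq> vnull"
      using indepD(2)[OF assms(2)] False by (metis neg_equal_0_iff_equal)
    ultimately show ?thesis
      using that by simp
  qed
  obtain y where y: "y \<in> plane (u, v)" "indep z y"
    using indep_extend[OF assms(2) z(1,3)] .
  have eqs: "hexeqs z y"
    using plane_hexeqs[OF assms(1) z(1) y(1)] .
  have comb: "vadd (smul p z) (smul q y) \<in> plane (u, v)" for p q
    using z(1) y(1) by (rule plane_combine)
  obtain a b c e f g where zv: "z = Vec a b c 0 e f g"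
    using z(2) by (cases z) simp
  obtain a' b' c' d' e' f' g' where yv: "y = Vec a' b' c' d' e' f' g'"
    by (cases y)
  have indep: "vadd (smul s z) (smul 1 y) \<noteq> vnull" for s
    using indepD(2)[OF y(2), of s 1] by auto
  consider "flag z" | "e = 0 \<and> f = 0 \<and> g = 0" "\<not> (a = 0 \<and> b = 0 \<and> c = 0)"
    | "a = 0 \<and> b = 0 \<and> c = 0" "\<not> (e = 0 \<and> f = 0 \<and> g = 0)"
    using z(3) by (auto simp: zv vnull_def)
  then show ?thesis
  proof cases
    case 1
    then show ?thesis
      using z that by blast
  next
    case 2
    have d: "d' = 0"
      using eqs 2 by (auto simp: zv yv)
    obtain s where s: "a' = s * a" "b' = s * b" "c' = s * c"
      by (rule cross_zero[OF 2(2), of b' a' c']) (use eqs 2(1) in \<open>auto simp: zv yv\<close>)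
    have "vadd (smul (1 - s) z) (smul 1 y) = Vec a b c 0 e' f' g'"
      using 2 by (simp add: zv yv s d algebra_simps)
    moreover have "\<not> (e' = 0 \<and> f' = 0 \<and> g' = 0)"
      using indep[of "- s"] 2 by (auto simp: zv yv s d vnull_def)
    ultimately show ?thesis
      using comb[of "1 - s" 1] that 2 by (metis flag.simps)
  next
    case 3
    have d: "d' = 0"
      using eqs 3 by (auto simp: zv yv)
    obtain s where s: "e' = s * e" "f' = s * f" "g' = s * g"
      by (rule cross_zero[OF 3(2), of f' e' g']) (use eqs 3(1) in \<open>auto simp: zv yv\<close>)
    have "vadd (smul (1 - s) z) (smul 1 y) = Vec a' b' c' 0 e f g"
      using 3 by (simp add: zv yv s d algebra_simps)
    moreover have "\<not> (a' = 0 \<and> b' = 0 \<and> c' = 0)"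
      using indep[of "- s"] 3 by (auto simp: zv yv s d vnull_def)
    ultimately show ?thesis
      using comb[of "1 - s" 1] that 3 by (metis flag.simps)
  qed
qed

text \<open>
  If the middle coordinate of \<open>y\<close> is 0, then \<open>hexeqs_flag_mid\<close> puts the
  first half \<open>U\<close> of \<open>P\<close> into the plane. Otherwise scale \<open>y\<close> to
  the middle coordinate of \<open>b\<close>. The equations are linear in the second argument, so
  \<open>hexeqs_flag_mid\<close> applies to the difference from \<open>b\<close>, and the plane
  contains \<open>b + s U\<close> for some \<open>s\<close>. In both cases a vector independent of
  \<open>P\<close> is found, which determines the plane.
\<close>

lemma check_flag_complete:
  assumes els: "set els = UNIV" and check: "check_flag els P ls" and P: "flag P"
    and ls: "\<And>l. l \<in> set ls \<Longrightarrow> P \<in> plane l"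
    and y: "hexeqs P y" "indep P y"
  shows "\<exists>l\<in>set ls. plane (P, y) = plane l"
proof -
  have found: "\<exists>l\<in>set ls. plane (P, y) = plane l"
    if q: "q \<in> plane (P, y)" "indep P q" "\<exists>l\<in>set ls. normal q \<in> set (plane_points els l)" for q
  proof -
    obtain l where l: "l \<in> set ls" "q \<in> plane l"
      using q(3) plane_points_mem by fastforce
    then have "plane (P, q) = plane l" "plane (P, q) = plane (P, y)"
      using plane_exchange[OF ls[OF l(1)]] plane_exchange[OF _ q(1,2)] q(2) by simp_all
    then show ?thesis
      using l(1) by auto
  qed
  have P_nonzero: "P \<noteq> vnull"
    using indepD(1)[OF y(2), of 1 0] by auto
  have indep_mid: "indep P q" if "mid q \<noteq> 0" for q
    unfolding indep_def
  proof (intro allI impI)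
    fix s t assume eq: "vadd (smul s P) (smul t q) = vnull"
    have "mid (vadd (smul s P) (smul t q)) = t * mid q"
      by (simp add: mid_flag[OF P])
    then have "t = 0"
      using that by (simp add: eq vnull_def)
    then show "s = 0 \<and> t = 0"
      using eq P_nonzero by simp
  qed
  show ?thesis
  proof (cases "mid y = 0")
    case True
    obtain s t where st: "y = vadd (smul s (upper P)) (smul t P)"
      using hexeqs_flag_mid[OF P y(1) True] .
    have "s \<noteq> 0"
      using indepD(2)[OF y(2), of "- t" 1] by (auto simp: st simp flip: vadd_smul)
    have "smul s (upper P) = vadd (smul 1 y) (smul (- t) P)"
      by (cases P) (simp add: st)
    then have "smul s (upper P) \<in> plane (P, y)"
      by (simp only: plane_combine plane_generators)
    then have U: "upper P \<in> plane (P, y)"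
      using \<open>s \<noteq> 0\<close> by simp
    have "indep P (upper P)"
      unfolding indep_def using P by (cases P) (auto simp: vnull_def)
    then show ?thesis
      using found[OF U] check by (auto simp: check_flag_def list_ex_iff List.member_iff)
  next
    case False
    obtain b where b: "mid b \<noteq> 0" "hexeqs P b"
      "\<And>s. \<exists>l\<in>set ls. normal (vadd b (smul s (upper P))) \<in> set (plane_points els l)"
      using check els by (auto simp: check_flag_def list_ex_iff list_all_iff List.member_iff split: if_splits)
    define r where "r = mid b / mid y"
    have "hexeqs P (vadd (smul r y) (smul (- 1) b))"
      using y(1) b(2) by (rule hexeqs_right)
    moreover have "mid (vadd (smul r y) (smul (- 1) b)) = 0"
      using False by (simp add: r_def)
    ultimately obtain s t where st: "vadd (smul r y) (smul (- 1) b) = vadd (smul s (upper P)) (smul t P)"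
      using hexeqs_flag_mid[OF P] by metis
    have "vadd b (vadd (smul r y) (smul (- 1) b)) = smul r y"
      by (cases y; cases b) simp
    then have "vadd b (smul s (upper P)) = vadd (smul r y) (smul (- t) P)"
      unfolding st by (cases P; cases y; cases b) (auto simp: algebra_simps)
    then have q: "vadd b (smul s (upper P)) \<in> plane (P, y)"
      by (simp only: plane_combine plane_generators)
    show ?thesis
      by (rule found[OF q indep_mid b(3)]) (use b(1) in simp)
  qed
qed

lemma concat_mapI: "x \<in> set xs \<Longrightarrow> y \<in> set (f x) \<Longrightarrow> y \<in> set (concat (map f xs))"
  by auto

lemma flags_mem:
  assumes "set els = UNIV" "a = 1 \<or> a = 0 \<and> b = 1 \<or> a = 0 \<and> b = 0 \<and> c = 1"
    and "\<not> (e = 0 \<and> f = 0 \<and> g = 0)" "a * e + b * f + c * g = 0"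
  shows "Vec a b c 0 e f g \<in> set (flags els)"
proof -
  have up: "(a, b, c) \<in> set (map (\<lambda>(b, c). (1, b, c)) (List.product els els) @ map (\<lambda>c. (0, 1, c)) els @ [(0, 0, 1)])"
    using assms(1,2) by auto
  have low: "(e, f, g) \<in> set (List.product els (List.product els els))"
    using assms(1) by simp
  show ?thesis
    unfolding flags_def
    by (rule concat_mapI[OF up], unfold prod.case, rule concat_mapI[OF low]) (use assms(3,4) in simp)
qed

lemma flags_complete:
  assumes "set els = UNIV" "flag z" "qform z = 0"
  obtains t where "t \<noteq> 0" "smul t z \<in> set (flags els)"
proof -
  obtain a b c e f g where z: "z = Vec a b c 0 e f g"
    using assms(2) by (cases z) simp
  have nz: "\<not> (a = 0 \<and> b = 0 \<and> c = 0)" "\<not> (e = 0 \<and> f = 0 \<and> g = 0)"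
    using assms(2) by (simp_all add: z)
  define t where "t = inverse (if a \<noteq> 0 then a else if b \<noteq> 0 then b else c)"
  have t: "t \<noteq> 0"
    using nz(1) by (simp add: t_def)
  have lead: "t * a = 1 \<or> t * a = 0 \<and> t * b = 1 \<or> t * a = 0 \<and> t * b = 0 \<and> t * c = 1"
    using nz(1) by (simp add: t_def)
  have "t * a * (t * e) + t * b * (t * f) + t * c * (t * g) = t * t * qform z"
    by (simp add: z algebra_simps)
  then have "smul t z \<in> set (flags els)"
    using flags_mem[OF assms(1) lead, of "t * e" "t * f" "t * g"] assms(3) nz(2) t by (simp add: z)
  then show ?thesis
    using that t by blast
qed

lemma reachesD: "reaches w cd tr v xs \<Longrightarrow> \<exists>x\<in>set xs. \<exists>k. k \<in> set (lookup_trie (key cd (normal (act w x v))) tr)"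
proof (induction xs)
  case (Cons x xs)
  then show ?case
    by (cases "lookup_trie (key cd (normal (act w x v))) tr") auto
qed simp

section \<open>Soundness of the certificates\<close>

text \<open>
  Indices and group elements are opaque from here on: unfolding them into components would hide the
  group law.
\<close>

declare sel4.simps [simp del] mmul.simps [simp del] minv.simps [simp del] act.simps [simp del]
  split_paired_All [simp del] split_paired_Ex [simp del]

locale parity_certificate =
  fixes els :: "'f::field list" and w :: 'f and cd :: "'f \<Rightarrow> bool list" and n :: nat
    and points :: "'f vec7 tri4" and planes :: "('f vec7 \<times> 'f vec7) tri4"
    and table :: "block option tri4 tri4"
  assumes els: "set els = UNIV" and w: "w * w * w = 1"
    and cd: "inj cd" "\<And>a. length (cd a) = n"
    and certificate: "certificate els w cd points planes table"
begin

abbreviation "g_act \<equiv> act w"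
abbreviation "base k \<equiv> sel4 k points"
abbreviation "base_plane i \<equiv> sel4 i planes"

text \<open>
  The family of vectors is indexed by pairs of a representative and a group element, so that equal
  translates are counted separately. Unused indices have the representative 0.
\<close>

definition slots :: "(ix \<times> mono) set" where
  "slots = {(k, x). base k \<noteq> vnull}"

text \<open>
  With the inverse, multiplying \<open>x\<close> on the right by the inverse of \<open>g\<close> applies \<open>g\<close> to the vector. So the
  relation below is invariant: besides the two indices it depends only on the product \<open>x h\<close>.
\<close>

fun point_of :: "ix \<times> mono \<Rightarrow> 'f vec7" where
  "point_of (k, x) = g_act (minv x) (base k)"

fun plane_of :: "ix \<times> mono \<Rightarrow> 'f vec7 set" where
  "plane_of (i, g) = g_act g ` plane (base_plane i)"

fun related :: "ix \<times> mono \<Rightarrow> ix \<times> mono \<Rightarrow> bool" where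
  "related (k, x) (j, h) = entry_opt (mmul x h) (sel4 k (sel4 j table))"

abbreviation "tr \<equiv> index_trie cd (list4 (zip_tri4 Pair points ix_tri4))"
abbreviation "ns i \<equiv> indices els w cd tr (base_plane i)"
abbreviation "cross j i \<equiv> interaction (sel4 j table) (ns i)"

lemma base: "normal (base k) = base k" "qform (base k) = 0"
  and odd_base: "odd (card {k. base k \<noteq> vnull})"
  and reach: "check_reach els w cd tr"
  and diagonal: "check_diagonal points j (ns j) (sel4 j table) (map_tri4 (interaction (sel4 j table)) (map_tri4 (indices els w cd tr) planes))"
  and symmetry: "\<not> less_ix j i \<Longrightarrow> check_pair els w (base_plane i) (base_plane j) (cross j i) (cross i j)"
  and flags: "flag (base k) \<Longrightarrow> check_flag els (base k) (concat (list4 (zip_tri4 (\<lambda>l n. map (\<lambda>(k', x). act_plane w x l)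
      (filter (\<lambda>(k', x). k' = k) n)) planes (map_tri4 (indices els w cd tr) planes))))"
  using certificate
  by (simp_all add: certificate_def with_trie_def with_interactions_def check_all_def check_symmetry_def
      check_flags_def parity4_eq if_bool_eq_disj) blast+

lemma mem_lookup: "k \<in> set (lookup_trie (key cd v) tr) \<longleftrightarrow> base k = v \<and> v \<noteq> vnull"
  by (auto simp: lookup_index_trie[OF cd])

text \<open>
  Normalization identifies multiples, and every 1-space of the plane is listed.
\<close>

lemma mem_indices:
  "(k, x) \<in> set (ns i) \<longleftrightarrow> base k \<noteq> vnull \<and> g_act (minv x) (base k) \<in> plane (base_plane i)"
proof -
  have "(k, x) \<in> set (ns i) \<longleftrightarrow>
      base k \<noteq> vnull \<and> (\<exists>p\<in>set (plane_points els (base_plane i)). normal (g_act x p) = base k)"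
  proof -
    have "(k, x) \<in> set (ns i) \<longleftrightarrow>
        (\<exists>p\<in>set (plane_points els (base_plane i)). k \<in> set (lookup_trie (key cd (normal (g_act x p))) tr))"
      by (auto simp: indices_def)
    then show ?thesis
      unfolding mem_lookup by metis
  qed
  moreover have "g_act (minv x) (base k) \<in> plane (base_plane i)"
    if p: "p \<in> set (plane_points els (base_plane i))" "normal (g_act x p) = base k" for p
  proof -
    obtain t where "base k = smul t (g_act x p)"
      using normal_multiple p(2) by metis
    then show ?thesis
      using plane_points_mem[OF p(1)] by (simp add: w plane_smul)
  qed
  moreover have "\<exists>p\<in>set (plane_points els (base_plane i)). normal (g_act x p) = base k"
    if q: "g_act (minv x) (base k) \<in> plane (base_plane i)" "base k \<noteq> vnull"
  proof -
    let ?q = "g_act (minv x) (base k)"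
    have "normal ?q \<in> set (plane_points els (base_plane i))"
      using plane_points_complete[OF els q(1)] q(2) by (simp add: w)
    moreover obtain t where t: "t \<noteq> 0" "normal ?q = smul t ?q"
      by (rule normal_multiple)
    then have "normal (g_act x (normal ?q)) = base k"
      by (simp add: w base)
    ultimately show ?thesis
      by blast
  qed
  ultimately show ?thesis
    by blast
qed

lemma slot_of_index: "(k, y) \<in> set (ns i) \<Longrightarrow> (k, x) \<in> slots"
  by (simp add: mem_indices slots_def)

lemma point_on_plane_iff:
  assumes "(k, x) \<in> slots"
  shows "point_of (k, x) \<in> plane_of (i, g) \<longleftrightarrow> (k, mmul x g) \<in> set (ns i)"
proof -
  have "point_of (k, x) \<in> plane_of (i, g) \<longleftrightarrow> g_act (minv g) (g_act (minv x) (base k)) \<in> plane (base_plane i)"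
  proof
    assume "point_of (k, x) \<in> plane_of (i, g)"
    then show "g_act (minv g) (g_act (minv x) (base k)) \<in> plane (base_plane i)"
      by (auto simp: w)
  next
    assume "g_act (minv g) (g_act (minv x) (base k)) \<in> plane (base_plane i)"
    then have "g_act g (g_act (minv g) (g_act (minv x) (base k))) \<in> plane_of (i, g)"
      unfolding plane_of.simps by (rule imageI)
    then show "point_of (k, x) \<in> plane_of (i, g)"
      by (simp add: w)
  qed
  also have "\<dots> \<longleftrightarrow> (k, mmul x g) \<in> set (ns i)"
    using assms by (simp add: mem_indices slots_def minv_mmul act_mmul[OF w])
  finally show ?thesis .
qed

lemma odd_card_filter:
  assumes "distinct xs"
  shows "odd (length (filter Q xs)) \<longleftrightarrow> odd (card {x \<in> set xs. Q x})"
  using distinct_card[OF distinct_filter[OF assms]] by simp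

lemma distinct_indices: "distinct (ns i)"
  using diagonal by (simp add: check_diagonal_def)

lemma bij_translate: "bij_betw (\<lambda>(k, x). (k, mmul x g)) {(k, x). Q k (mmul x g)} {(k, x). Q k x}"
  by (rule bij_betw_byWitness[where f' = "\<lambda>(k, x). (k, mmul x (minv g))"])
    (auto simp: mmul_assoc)

lemma odd_related_plane:
  "odd (card {p \<in> {p \<in> slots. point_of p \<in> plane_of (i, g)}. related p (j, h)}) \<longleftrightarrow>
     entry_opt (mmul (minv g) h) (cross j i)"
proof -
  let ?Q = "\<lambda>k x. (k, x) \<in> set (ns i) \<and> entry_opt (mmul x (mmul (minv g) h)) (sel4 k (sel4 j table))"
  have "p \<in> {p \<in> {p \<in> slots. point_of p \<in> plane_of (i, g)}. related p (j, h)} \<longleftrightarrow>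
      p \<in> {(k, x). ?Q k (mmul x g)}" for p
    using point_on_plane_iff[of "fst p" "snd p" i g] slot_of_index[of "fst p" "mmul (snd p) g" i "snd p"]
    by (cases p) (auto simp: mmul_assoc simp del: point_of.simps plane_of.simps)
  then have "{p \<in> {p \<in> slots. point_of p \<in> plane_of (i, g)}. related p (j, h)} = {(k, x). ?Q k (mmul x g)}"
    by blast
  then have "card {p \<in> {p \<in> slots. point_of p \<in> plane_of (i, g)}. related p (j, h)} = card {(k, x). ?Q k x}"
    using bij_betw_same_card[OF bij_translate[of g ?Q]] by simp
  also have "{(k, x). ?Q k x} = {p \<in> set (ns i). case p of (k, x) \<Rightarrow> entry_opt (mmul x (mmul (minv g) h)) (sel4 k (sel4 j table))}"
    by auto
  finally show ?thesis
    by (simp add: entry_interaction odd_card_filter[OF distinct_indices])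
qed

lemma card_plane:
  "card {p \<in> slots. point_of p \<in> plane_of (i, g)} = length (ns i)"
proof -
  have "p \<in> {p \<in> slots. point_of p \<in> plane_of (i, g)} \<longleftrightarrow> p \<in> {(k, x). (k, mmul x g) \<in> set (ns i)}" for p
    using point_on_plane_iff[of "fst p" "snd p" i g] slot_of_index[of "fst p" "mmul (snd p) g" i "snd p"]
    by (cases p) (auto simp del: point_of.simps plane_of.simps)
  then have "{p \<in> slots. point_of p \<in> plane_of (i, g)} = {(k, x). (k, mmul x g) \<in> set (ns i)}"
    by blast
  then have "card {p \<in> slots. point_of p \<in> plane_of (i, g)} = card {(k, x). (k, x) \<in> set (ns i)}"
    using bij_betw_same_card[OF bij_translate[of g "\<lambda>k x. (k, x) \<in> set (ns i)"]] by simp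
  then show ?thesis
    using distinct_card[OF distinct_indices[of i]] by simp
qed

lemma odd_related:
  "odd (card {p \<in> slots. related p (j, h)}) \<longleftrightarrow>
     parity4 (zip_tri4 (\<lambda>P v. if P = vnull then False else block_parity v) points (sel4 j table))"
proof -
  let ?Q = "\<lambda>k x. base k \<noteq> vnull \<and> entry_opt x (sel4 k (sel4 j table))"
  have "{p \<in> slots. related p (j, h)} = {(k, x). ?Q k (mmul x h)}"
    by (auto simp: slots_def)
  then have "card {p \<in> slots. related p (j, h)} = card {(k, x). ?Q k x}"
    using bij_betw_same_card[OF bij_translate[of h ?Q]] by simp
  also have "{(k, x). ?Q k x} = Sigma UNIV (\<lambda>k. {x. ?Q k x})"
    by auto
  also have "card \<dots> = (\<Sum>k\<in>UNIV. card {x. ?Q k x})"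
    by (rule card_SigmaI) auto
  also have "odd \<dots> \<longleftrightarrow> odd (\<Sum>k\<in>UNIV. of_bool (odd (card {x. ?Q k x})) :: nat)"
    unfolding odd_sum_of_bool ..
  also have "\<dots> \<longleftrightarrow> parity4 (zip_tri4 (\<lambda>P v. if P = vnull then False else block_parity v) points (sel4 j table))"
  proof -
    have "odd (card {x. ?Q k x}) \<longleftrightarrow> (if base k = vnull then False else block_parity (sel4 k (sel4 j table)))" for k
      by (simp add: block_parity_eq)
    then show ?thesis
      by (simp only: parity4_eq sel4_zip_tri4) simp
  qed
  finally show ?thesis .
qed

lemma odd_slots: "odd (card slots)"
proof -
  have "card (UNIV :: mono set) = 27"
    by (simp add: UNIV_z3 flip: UNIV_Times_UNIV)
  moreover have "slots = {k. base k \<noteq> vnull} \<times> UNIV"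
    by (auto simp: slots_def)
  ultimately show ?thesis
    using odd_base by (simp add: card_cartesian_product)
qed

text \<open>
  Take a flag vector of the plane, move it to a representative \<open>P\<close>, recognize the plane
  through \<open>P\<close> in the list, and move back.
\<close>

lemma plane_complete:
  assumes "hexeqs u v" "indep u v" and null: "\<And>z. z \<in> plane (u, v) \<Longrightarrow> qform z = 0"
  shows "\<exists>\<alpha>. plane (u, v) = plane_of \<alpha>"
proof -
  obtain z where z: "z \<in> plane (u, v)" "flag z"
    using exists_flag[OF assms(1,2)] .
  obtain t where t: "t \<noteq> 0" "smul t z \<in> set (flags els)"
    using flags_complete[OF els z(2) null[OF z(1)]] .
  have "reaches w cd tr (smul t z) all_mono"
    using reach t(2) by (simp add: check_reach_def list_all_iff)
  from reachesD[OF this] t(1) obtain x k where k: "base k = normal (g_act x z)" "base k \<noteq> vnull"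
    by (auto simp: mem_lookup)
  obtain s where s: "s \<noteq> 0" "base k = smul s (g_act x z)"
    using k(1) normal_multiple by metis
  let ?l = "(g_act x u, g_act x v)"
  have image: "g_act x ` plane (u, v) = plane ?l"
    by (simp add: act_plane_image)
  have P: "base k \<in> plane ?l"
    unfolding s(2) using z(1) by (intro plane_smul) (simp flip: image)
  have "indep (g_act x u) (g_act x v)"
    using assms(2) unfolding indep_def by (simp add: w flip: act_smul act_vadd)
  then obtain y where y: "y \<in> plane ?l" "indep (base k) y"
    using P k(2) indep_extend by metis
  have "flag (base k)"
    using act_flag[OF w z(2), of x] s(1) unfolding s(2) by (cases "g_act x z") auto
  have eqs: "hexeqs (base k) y"
    using act_hexeqs[OF w assms(1)] P y(1) by (rule plane_hexeqs)
  let ?ls = "concat (list4 (zip_tri4 (\<lambda>l n. map (\<lambda>(k', x). act_plane w x l)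
      (filter (\<lambda>(k', x). k' = k) n)) planes (map_tri4 (indices els w cd tr) planes)))"
  have ls: "\<exists>i h. l = act_plane w h (base_plane i) \<and> (k, h) \<in> set (ns i)" if "l \<in> set ?ls" for l
    using that by auto
  have "base k \<in> plane l" if "l \<in> set ?ls" for l
  proof -
    obtain i h where l: "l = act_plane w h (base_plane i)" "(k, h) \<in> set (ns i)"
      using ls \<open>l \<in> set ?ls\<close> by blast
    then have "g_act h (g_act (minv h) (base k)) \<in> g_act h ` plane (base_plane i)"
      by (intro imageI) (simp add: mem_indices)
    then show ?thesis
      by (simp add: l act_plane_image w)
  qed
  from check_flag_complete[OF els flags[OF \<open>flag (base k)\<close>] \<open>flag (base k)\<close> this eqs y(2)]
  obtain l where "l \<in> set ?ls" "plane (base k, y) = plane l"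
    by blast
  with ls obtain i h where ih: "plane (base k, y) = plane (act_plane w h (base_plane i))"
    by blast
  have "plane ?l = g_act h ` plane (base_plane i)"
    using ih plane_exchange[OF P y] by (simp add: act_plane_image)
  then have "g_act (minv x) ` g_act x ` plane (u, v) = g_act (minv x) ` g_act h ` plane (base_plane i)"
    by (simp add: image)
  then have "plane (u, v) = plane_of (i, mmul (minv x) h)"
    by (simp add: image_image w act_mmul)
  then show ?thesis
    by blast
qed

lemma meet_imp:
  assumes "meet els l l'"
  shows "\<exists>p. p \<noteq> vnull \<and> p \<in> plane l \<and> p \<in> plane l'"
proof -
  obtain p where "p \<noteq> vnull" "p \<in> set (plane_points els l)" "p \<in> set (plane_points els l')"
    using assms by (auto simp: meet_def Let_def list_ex_iff)
  then show ?thesis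
    using plane_points_mem by blast
qed

text \<open>
  The blocks of \<open>(j, i)\<close> and \<open>(i, j)\<close> are inverse to each other at
  \<open>g\<^sup>-\<^sup>1 h\<close> by \<open>check_pair\<close>, unless the plane of
  \<open>i\<close> meets the translate by \<open>g\<^sup>-\<^sup>1 h\<close> of the plane of
  \<open>j\<close>, that is unless the given planes meet.
\<close>

lemma interaction_symmetric:
  assumes disjoint: "\<And>p. p \<in> plane_of (i, g) \<Longrightarrow> p \<in> plane_of (j, h) \<Longrightarrow> p = vnull"
    and le: "\<not> less_ix j i"
  shows "entry_opt (mmul (minv g) h) (cross j i) = entry_opt (mmul (minv h) g) (cross i j)"
proof (rule ccontr)
  let ?d = "block_xor (cross j i) (map_option inverted (cross i j))" and ?h = "mmul (minv g) h"
  assume "\<not> ?thesis"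
  then have d: "entry_opt ?h ?d"
    by (simp add: minv_mmul)
  then have "meet els (base_plane i) (act_plane w ?h (base_plane j))"
    using symmetry[OF le] no_entryD[of ?d ?h] by (simp add: check_pair_def Let_def list_all_iff split: if_splits)
  then obtain p where p: "p \<noteq> vnull" "p \<in> plane (base_plane i)" "p \<in> g_act ?h ` plane (base_plane j)"
    using meet_imp by (metis act_plane_image)
  then obtain q where q: "p = g_act ?h q" "q \<in> plane (base_plane j)"
    by blast
  have "g_act g p \<in> plane_of (i, g)"
    using p(2) by simp
  moreover have "g_act g p = g_act h q"
    by (simp add: q act_mmul w)
  then have "g_act g p \<in> plane_of (j, h)"
    using q(2) by simp
  ultimately have "g_act g p = vnull"
    by (rule disjoint)
  then show False
    using p(1) by (simp add: w)
qed

text \<open>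
  Distinct members of a partition have only 0 in common, so the parity argument applies once each
  member is written as a translate of a representative plane.
\<close>

theorem no_spread:
  fixes Y :: "'f vec7 set set"
  assumes planes: "\<And>W. W \<in> Y \<Longrightarrow> \<exists>u v. W = plane (u, v) \<and> indep u v \<and> hexeqs u v \<and> (\<forall>z\<in>W. qform z = 0)"
    and exact: "\<And>z. z \<noteq> vnull \<Longrightarrow> qform z = 0 \<Longrightarrow> \<exists>!W. W \<in> Y \<and> z \<in> W"
  shows False
proof -
  have "\<exists>\<alpha>. W = plane_of \<alpha>" if "W \<in> Y" for W
    using planes[OF that] plane_complete by blast
  then obtain rep where rep: "\<And>W. W \<in> Y \<Longrightarrow> W = plane_of (rep W)"
    by metis
  have "Y \<subseteq> range plane_of"
    using rep by blast
  then have finite: "finite Y"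
    by (rule finite_subset) simp
  have disjoint: "p = vnull" if "W \<in> Y" "U \<in> Y" "W \<noteq> U" "p \<in> plane_of (rep W)" "p \<in> plane_of (rep U)" for W U p
  proof (rule ccontr)
    assume "p \<noteq> vnull"
    moreover have "p \<in> W" "p \<in> U"
      using rep that by blast+
    moreover have "qform p = 0"
      using planes \<open>W \<in> Y\<close> \<open>p \<in> W\<close> by blast
    ultimately show False
      using exact that by blast
  qed
  let ?N = "\<lambda>W. {p \<in> slots. point_of p \<in> plane_of (rep W)}"
  show False
  proof (rule parity_obstruction[where P = slots and A = Y and N = ?N and R = "\<lambda>p W. related p (rep W)"])
    show "finite slots" "finite Y" "odd (card slots)"
      using finite odd_slots by simp_all
    show "\<And>v. v \<in> Y \<Longrightarrow> ?N v \<subseteq> slots"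
      by blast
    show "\<exists>!W. W \<in> Y \<and> p \<in> ?N W" if "p \<in> slots" for p
    proof -
      obtain k x where p: "p = (k, x)"
        by (cases p)
      have "point_of p \<noteq> vnull" "qform (point_of p) = 0"
        using that by (simp_all add: p slots_def w base)
      then have "\<exists>!W. W \<in> Y \<and> point_of p \<in> W"
        by (rule exact)
      then show ?thesis
        using rep that by (metis (no_types, lifting) mem_Collect_eq)
    qed
    show "even (card {p \<in> ?N W. related p (rep U)} + card {p \<in> ?N U. related p (rep W)})"
      if WU: "W \<in> Y" "U \<in> Y" "W \<noteq> U" for W U
    proof -
      obtain i g j h where r: "rep W = (i, g)" "rep U = (j, h)"
        by (metis surj_pair)
      have "entry_opt (mmul (minv g) h) (cross j i) = entry_opt (mmul (minv h) g) (cross i j)"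
      proof (cases "less_ix j i")
        case True
        then show ?thesis
          using interaction_symmetric[of j h i g] disjoint[OF WU(2,1)] WU(3) less_ix_asym r by metis
      next
        case False
        then show ?thesis
          using interaction_symmetric[of i g j h] disjoint[OF WU] r by metis
      qed
      then show ?thesis
        using odd_related_plane[of i g j h] odd_related_plane[of j h i g] unfolding r even_add by blast
    qed
    show "even (card {p \<in> ?N W. related p (rep W)} + card {p \<in> slots. related p (rep W)} + card (?N W))"
      if "W \<in> Y" for W
    proof -
      obtain i g where r: "rep W = (i, g)"
        by (cases "rep W")
      have "odd (card {p \<in> ?N W. related p (rep W)}) \<longleftrightarrow>
          (odd (card {p \<in> slots. related p (rep W)}) \<noteq> odd (card (?N W)))"
        unfolding r odd_related_plane odd_related card_plane
        using diagonal[of i] by (simp add: check_diagonal_def mone_def)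
      then show ?thesis
        by auto
    qed
  qed
qed

end

section \<open>Coordinates\<close>

lemma distinct_7:
  "distinct [0, 1, 2, 3, 4, 5, 6 :: 7]"
  by (simp add: Rep_bit1_inject[symmetric] bit1.Rep_numeral bit1.Rep_0 bit1.Rep_1)

lemmas neq_7 [simp] = distinct_7[unfolded distinct.simps list.set insert_iff empty_iff de_Morgan_disj, simplified]

lemma UNIV_7: "(UNIV :: 7 set) = {0, 1, 2, 3, 4, 5, 6}"
proof -
  have "card (set [0, 1, 2, 3, 4, 5, 6 :: 7]) = CARD(7)"
    using distinct_card[OF distinct_7] by simp
  then show ?thesis
    using card_subset_eq[OF finite_class.finite_UNIV subset_UNIV] by (metis list.set)
qed

lemma forall_7: "(\<forall>i :: 7. P i) \<longleftrightarrow> P 0 \<and> P 1 \<and> P 2 \<and> P 3 \<and> P 4 \<and> P 5 \<and> P 6"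
proof -
  have "(\<forall>i :: 7. P i) \<longleftrightarrow> (\<forall>i\<in>UNIV. P i)"
    by simp
  then show ?thesis
    unfolding UNIV_7 by simp
qed

fun coord :: "'f vec7 \<Rightarrow> 7 \<Rightarrow> 'f" where
  "coord (Vec a b c d e f g) i = (if i = 0 then a else if i = 1 then b else if i = 2 then c
     else if i = 3 then d else if i = 4 then e else if i = 5 then f else g)"

locale field_iso =
  fixes \<phi> :: "'f::field \<Rightarrow> 'a::field"
  assumes bij: "bij \<phi>" and add: "\<phi> (x + y) = \<phi> x + \<phi> y" and mult: "\<phi> (x * y) = \<phi> x * \<phi> y"
begin

definition dec :: "'f vec7 \<Rightarrow> 'a ^ 7" where
  "dec v = (\<chi> i. \<phi> (coord v i))"

lemma eq_iff [simp]: "\<phi> x = \<phi> y \<longleftrightarrow> x = y"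
  using bij by (simp add: bij_def inj_eq)

lemma zero [simp]: "\<phi> 0 = 0"
  using add[of 0 0] by (simp only: add_0_left add_cancel_right_right)

lemma diff: "\<phi> (x - y) = \<phi> x - \<phi> y"
  using add[of "x - y" y] by simp

lemma surj: obtains x where "y = \<phi> x"
  using bij by (metis bij_def surjD)

lemma dec_nth [simp]:
  "dec (Vec a b c d e f g) $ 0 = \<phi> a" "dec (Vec a b c d e f g) $ 1 = \<phi> b"
  "dec (Vec a b c d e f g) $ 2 = \<phi> c" "dec (Vec a b c d e f g) $ 3 = \<phi> d"
  "dec (Vec a b c d e f g) $ 4 = \<phi> e" "dec (Vec a b c d e f g) $ 5 = \<phi> f"
  "dec (Vec a b c d e f g) $ 6 = \<phi> g"
  by (simp_all add: dec_def)

lemma dec_inj [simp]: "dec u = dec v \<longleftrightarrow> u = v"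
  by (cases u; cases v) (auto simp: vec_eq_iff forall_7)

lemma dec_surj: obtains v where "x = dec v"
proof -
  have "x = dec (Vec (inv \<phi> (x $ 0)) (inv \<phi> (x $ 1)) (inv \<phi> (x $ 2)) (inv \<phi> (x $ 3))
      (inv \<phi> (x $ 4)) (inv \<phi> (x $ 5)) (inv \<phi> (x $ 6)))"
    using bij by (simp add: vec_eq_iff forall_7 bij_is_surj surj_f_inv_f)
  then show ?thesis
    by (rule that)
qed

lemma dec_vadd [simp]: "dec (vadd u v) = dec u + dec v"
  by (cases u; cases v) (simp add: vec_eq_iff forall_7 add)

lemma dec_smul [simp]: "dec (smul t v) = \<phi> t *s dec v"
  by (cases v) (simp add: vec_eq_iff forall_7 mult)

lemma dec_eq_0 [simp]: "dec v = 0 \<longleftrightarrow> v = vnull"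
proof -
  have "dec vnull = 0"
    by (simp add: vnull_def vec_eq_iff forall_7)
  then show ?thesis
    using dec_inj by metis
qed

lemma form_dec: "hexagon_form (dec v) = \<phi> (qform v)"
  by (cases v) (simp add: hexagon_form_def add mult diff power2_eq_square)

lemma equations_dec: "hexagon_equations (dec u) (dec v) \<longleftrightarrow> hexeqs u v"
  by (cases u; cases v) (simp add: hexagon_equations_def grassmann_def flip: mult diff)

end

lemma span_two: "z \<in> vec.span {x, y} \<longleftrightarrow> (\<exists>a b. z = a *s x + b *s y)" for x y :: "'a::field ^ 7"
  by (auto simp: vec.span_insert vec.span_singleton algebra_simps)

lemma basis2_trivial_combination:
  assumes "is_basis2 V x y" "a *s x + b *s y = 0"
  shows "a = 0 \<and> b = 0"
proof -
  have ind: "vec.independent {y}" "x \<notin> vec.span {y}"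
    using assms(1) by (auto simp: is_basis2_def vec.independent_insert)
  have "a = 0"
  proof (rule ccontr)
    assume "a \<noteq> 0"
    have "a *s x = (- b) *s y"
      using assms(2) by (simp add: eq_neg_iff_add_eq_0 vector_smult_lneg)
    then have "inverse a *s (a *s x) = inverse a *s ((- b) *s y)"
      by simp
    then have "x = (inverse a * (- b)) *s y"
      using \<open>a \<noteq> 0\<close> by (simp add: vector_smult_assoc)
    then have "x \<in> vec.span {y}"
      unfolding vec.span_singleton by (rule range_eqI)
    then show False
      using ind(2) by blast
  qed
  moreover have "y \<noteq> 0"
    using ind(1) vec.dependent_zero by blast
  ultimately show ?thesis
    using assms(2) by (simp add: vec.scale_eq_0_iff)
qed

lemma span_in_hexagon_lines:
  assumes "x \<noteq> 0" "hexagon_form x = 0"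
  shows "vec.span {x} \<in> hexagon_lines"
proof -
  have dim: "vec.dim (vec.span {x}) = 1"
    using assms(1) vec.dim_eq_card_independent[of "{x}"] by (simp add: vec.dim_span vec.independent_insert)
  have "hexagon_form (c *s x) = c * c * hexagon_form x" for c
    by (simp add: hexagon_form_def power2_eq_square algebra_simps)
  with assms(2) have "\<forall>z\<in>vec.span {x}. hexagon_form z = 0"
    by (auto simp: vec.span_singleton)
  with dim show ?thesis
    by (simp add: hexagon_lines_def vec.subspace_span)
qed

text \<open>
  Coordinates turn an ovoid into a partition of the singular vectors: a nonzero singular vector spans
  a line of the hexagon, which lies on exactly one member.
\<close>

lemma (in parity_certificate) no_ovoid:
  fixes \<phi> :: "'f \<Rightarrow> 'a::field"
  assumes "field_iso \<phi>"
  shows "\<not> distance_2_ovoid (dual_split_Cayley_hexagon :: (('a ^ 7) set, ('a ^ 7) set) geometry) X"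
proof
  interpret field_iso \<phi> by fact
  let ?G = "dual_split_Cayley_hexagon :: (('a ^ 7) set, ('a ^ 7) set) geometry"
  assume ovoid: "distance_2_ovoid ?G X"
  have sub: "X \<subseteq> hexagon_points"
    using ovoid by (simp add: distance_2_ovoid_def dual_split_Cayley_hexagon_def)
  show False
  proof (rule no_spread[of "(\<lambda>V. dec -` V) ` X"])
    fix W assume "W \<in> (\<lambda>V. dec -` V) ` X"
    then obtain V where V: "W = dec -` V" "V \<in> X"
      by blast
    then have "V \<in> hexagon_points"
      using sub by blast
    then obtain x y where xy: "is_basis2 V x y" "hexagon_equations x y" "\<forall>z\<in>V. hexagon_form z = 0"
      by (auto simp: hexagon_points_def)
    obtain u v where uv: "x = dec u" "y = dec v"
      by (metis dec_surj)
    have "z \<in> W \<longleftrightarrow> z \<in> plane (u, v)" for z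
    proof -
      have "z \<in> W \<longleftrightarrow> (\<exists>a b. dec z = a *s x + b *s y)"
        using xy(1) by (simp add: V(1) is_basis2_def flip: span_two)
      also have "\<dots> \<longleftrightarrow> (\<exists>s t. dec z = \<phi> s *s x + \<phi> t *s y)"
        by (metis surj)
      also have "\<dots> \<longleftrightarrow> z \<in> plane (u, v)"
        by (simp add: uv plane.simps flip: dec_smul dec_vadd)
      finally show ?thesis .
    qed
    then have "W = plane (u, v)"
      by blast
    moreover have "indep u v"
      unfolding indep_def
    proof (intro allI impI)
      fix s t assume "vadd (smul s u) (smul t v) = vnull"
      then have "dec (vadd (smul s u) (smul t v)) = 0"
        by (simp only: dec_eq_0)
      then have "\<phi> s *s x + \<phi> t *s y = 0"
        by (simp add: uv)
      from basis2_trivial_combination[OF xy(1) this] show "s = 0 \<and> t = 0"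
        using eq_iff[of s 0] eq_iff[of t 0] by simp
    qed
    moreover have "hexeqs u v"
      using xy(2) by (simp add: uv equations_dec)
    moreover have "\<forall>z\<in>W. qform z = 0"
    proof
      fix z assume "z \<in> W"
      then have "\<phi> (qform z) = \<phi> 0"
        using xy(3) by (simp add: V(1) flip: form_dec)
      then show "qform z = 0"
        by (simp only: eq_iff)
    qed
    ultimately show "\<exists>u v. W = plane (u, v) \<and> indep u v \<and> hexeqs u v \<and> (\<forall>z\<in>W. qform z = 0)"
      by blast
  next
    fix z :: "'f vec7" assume z: "z \<noteq> vnull" "qform z = 0"
    let ?l = "vec.span {dec z}"
    have l: "?l \<in> hexagon_lines"
      by (rule span_in_hexagon_lines) (use z in \<open>simp_all add: form_dec\<close>)
    have inc: "(V, ?l) \<in> inc ?G \<longleftrightarrow> dec z \<in> V" if "V \<in> X" for V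
    proof -
      have "V \<in> hexagon_points"
        using sub that by blast
      moreover from this have "?l \<subseteq> V \<longleftrightarrow> dec z \<in> V"
        using vec.span_minimal[of "{dec z}" V] vec.span_base[of "dec z" "{dec z}"] by (auto simp: hexagon_points_def)
      ultimately show ?thesis
        using l by (simp add: dual_split_Cayley_hexagon_def)
    qed
    have "\<exists>!V. V \<in> X \<and> (V, ?l) \<in> inc ?G"
      by (rule ovoid_meets_line_once[OF ovoid]) (use l in \<open>auto simp: dual_split_Cayley_hexagon_def\<close>)
    then obtain V where V: "V \<in> X" "dec z \<in> V" "\<And>U. U \<in> X \<Longrightarrow> dec z \<in> U \<Longrightarrow> U = V"
      using inc by metis
    show "\<exists>!W. W \<in> (\<lambda>V. dec -` V) ` X \<and> z \<in> W"
    proof (rule ex1I[of _ "dec -` V"])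
      show "dec -` V \<in> (\<lambda>V. dec -` V) ` X \<and> z \<in> dec -` V"
        using V(1,2) by simp
    next
      fix W assume "W \<in> (\<lambda>V. dec -` V) ` X \<and> z \<in> W"
      then obtain U where "W = dec -` U" "U \<in> X" "dec z \<in> U"
        by auto
      then show "W = dec -` V"
        using V(3) by blast
    qed
  qed
qed

section \<open>The fields with two and four elements\<close>

text \<open>
  Adding 1 permutes the field, hence does not change the sum of all elements.
\<close>

lemma of_nat_CARD: "of_nat CARD('a) = (0 :: 'a::{field, finite})"
proof -
  have "(\<Sum>x\<in>UNIV. x + 1) = (\<Sum>x\<in>UNIV. x :: 'a)"
    by (rule sum.reindex_bij_witness[of _ "\<lambda>x. x - 1" "\<lambda>x. x + 1"]) simp_all
  then show ?thesis
    by (simp add: sum.distrib)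
qed

fun to2 :: "f2 \<Rightarrow> 'a::field" where
  "to2 B0 = 0" | "to2 B1 = 1"

fun to4 :: "'a::field \<Rightarrow> f4 \<Rightarrow> 'a" where
  "to4 w F0 = 0" | "to4 w F1 = 1" | "to4 w Fw = w" | "to4 w Fv = w + 1"

lemma field_iso_2:
  assumes "CARD('a::{field, finite}) = 2"
  shows "field_iso (to2 :: f2 \<Rightarrow> 'a)"
proof
  have two: "1 + 1 = (0 :: 'a)"
    using of_nat_CARD[where 'a = 'a] by (simp add: assms)
  have "{0, 1 :: 'a} = UNIV"
    using assms by (intro card_subset_eq) auto
  then have "y \<in> range to2" for y :: 'a
    by (metis UNIV_I insertE range_eqI singletonD to2.simps)
  moreover have "inj (to2 :: f2 \<Rightarrow> 'a)"
  proof (rule injI)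
    fix x y assume "to2 x = (to2 y :: 'a)"
    then show "x = y"
      by (cases x; cases y) simp_all
  qed
  ultimately show "bij (to2 :: f2 \<Rightarrow> 'a)"
    by (auto simp: bij_def)
  show "to2 (x + y) = (to2 x + to2 y :: 'a)" for x y
    using two by (cases x; cases y) (simp_all add: plus_f2_def)
  show "to2 (x * y) = (to2 x * to2 y :: 'a)" for x y
    by (cases x; cases y) (simp_all add: times_f2_def)
qed

text \<open>
  The characteristic is 2 since 4 is 0. For an element \<open>w\<close> other than 0 and 1, the four
  elements are 0, 1, \<open>w\<close> and \<open>w + 1\<close>, and \<open>w\<^sup>2\<close> can only
  be the last one.
\<close>

lemma field_iso_4:
  assumes "CARD('a::{field, finite}) = 4"
  shows "\<exists>w. field_iso (to4 w :: f4 \<Rightarrow> 'a)"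
proof -
  have "(1 + 1) * (1 + 1) = (of_nat CARD('a) :: 'a)"
    by (simp add: assms)
  then have two: "1 + 1 = (0 :: 'a)"
    by (simp only: of_nat_CARD mult_eq_0_iff) simp
  have double: "x + x = 0" for x :: 'a
    using arg_cong[OF two, of "\<lambda>t. t * x"] by (simp add: distrib_right)
  have double': "x + (x + y) = y" for x y :: 'a
    using double[of x] by (simp flip: add.assoc)
  have "{0, 1 :: 'a} \<noteq> UNIV"
  proof
    assume "{0, 1 :: 'a} = UNIV"
    then have "CARD('a) = card {0, 1 :: 'a}"
      by simp
    then show False
      using assms by simp
  qed
  then obtain w :: 'a where w: "w \<noteq> 0" "w \<noteq> 1"
    by blast
  have w1: "w + 1 \<noteq> 0"
    using w(2) double[of 1] by (metis add_right_cancel)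
  have UNIV: "{0, 1, w, w + 1} = UNIV"
    using assms w w1 by (intro card_subset_eq) auto
  have "w * w \<noteq> 1"
  proof
    assume "w * w = 1"
    then have "(w + 1) * (w + 1) = 0"
      using double[of 1] double[of w] double' by (simp add: algebra_simps)
    then show False
      using w1 by simp
  qed
  moreover have "w * w \<in> {0, 1, w, w + 1}"
    unfolding UNIV ..
  ultimately have sq: "w * w = w + 1"
    using w by auto
  have "field_iso (to4 w)"
  proof
    have "y \<in> range (to4 w)" for y
    proof -
      have "y \<in> {0, 1, w, w + 1}"
        unfolding UNIV ..
      then show ?thesis
        by (metis insertE range_eqI singletonD to4.simps)
    qed
    moreover have "inj (to4 w)"
    proof (rule injI)
      fix x y assume "to4 w x = to4 w y"
      then show "x = y"
        using w w1 by (cases x; cases y) auto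
    qed
    ultimately show "bij (to4 w)"
      by (auto simp: bij_def)
    show "to4 w (x + y) = to4 w x + to4 w y" for x y
      using double[of 1] double[of w] double'[of 1] double'[of w]
      by (cases x; cases y) (simp_all add: plus_f4_def ac_simps)
    show "to4 w (x * y) = to4 w x * to4 w y" for x y
      using double[of 1] double[of w] double'[of 1] double'[of w] sq
      by (cases x; cases y) (simp_all add: times_f4_def algebra_simps)
  qed
  then show ?thesis ..
qed

section \<open>The certificate for two elements\<close>

text \<open>
  The tables list representatives of the vectors, generators of representatives of the planes, and for
  each plane the column of its blocks, indexed by the vectors. Unused places hold zero vectors and
  empty columns.
\<close>

definition points2 :: "f2 vec7 tri tri tri tri" where "points2 = T (T (T (T (Vec B0 B0 B0 B0 B0 B0 B1) (Vec B0
  B0 B0 B0 B0 B1 B1) (Vec B0 B0 B0 B0 B1 B1 B1)) (T (Vec B0 B0 B1 B0 B0 B0 B0) (Vec B0 B0 B1 B1 B0 B0 B1) (Vec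
  B0 B0 B1 B0 B0 B1 B0)) (T (Vec B0 B0 B1 B1 B0 B1 B1) (Vec B0 B0 B1 B0 B1 B0 B0) (Vec B0 B0 B1 B1 B1 B0 B1)))
  (T (T (Vec B0 B0 B1 B0 B1 B1 B0) (Vec B0 B0 B1 B1 B1 B1 B1) (Vec B0 B1 B1 B0 B0 B0 B0)) (T (Vec B0 B1 B1 B1
  B0 B0 B1) (Vec B0 B1 B1 B1 B0 B1 B0) (Vec B0 B1 B1 B0 B0 B1 B1)) (T (Vec B0 B1 B1 B0 B1 B0 B0) (Vec B0 B1 B1
  B1 B1 B0 B1) (Vec B0 B1 B1 B1 B1 B1 B0))) (T (T (Vec B0 B1 B1 B0 B1 B1 B1) (Vec B1 B1 B1 B0 B0 B0 B0) (Vec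
  B1 B1 B1 B1 B0 B0 B1)) (T (Vec B1 B1 B1 B0 B0 B1 B1) (Vec B1 B1 B1 B1 B1 B1 B1) vnull) (T vnull vnull
  vnull))) (T (T (T vnull vnull vnull) (T vnull vnull vnull) (T vnull vnull vnull)) (T (T vnull vnull vnull)
  (T vnull vnull vnull) (T vnull vnull vnull)) (T (T vnull vnull vnull) (T vnull vnull vnull) (T vnull vnull
  vnull))) (T (T (T vnull vnull vnull) (T vnull vnull vnull) (T vnull vnull vnull)) (T (T vnull vnull vnull)
  (T vnull vnull vnull) (T vnull vnull vnull)) (T (T vnull vnull vnull) (T vnull vnull vnull) (T vnull vnull
  vnull)))"
definition planes2 :: "(f2 vec7 \<times> f2 vec7) tri tri tri tri" where "planes2 = T (T (T (T (Vec B0 B0 B0 B0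
  B0 B0 B1, Vec B0 B1 B0 B0 B0 B0 B0) (Vec B0 B0 B0 B0 B0 B0 B1, Vec B1 B0 B0 B0 B0 B0 B0) (Vec B0 B0 B0 B0 B0
  B0 B1, Vec B1 B1 B0 B0 B0 B0 B0)) (T (Vec B0 B0 B0 B0 B0 B1 B1, Vec B0 B1 B1 B0 B0 B0 B0) (Vec B0 B0 B0 B0
  B0 B1 B1, Vec B1 B0 B0 B0 B0 B0 B0) (Vec B0 B0 B0 B0 B0 B1 B1, Vec B1 B1 B1 B0 B0 B0 B0)) (T (Vec B0 B0 B0
  B0 B1 B1 B1, Vec B0 B1 B1 B0 B0 B0 B0) (Vec B0 B0 B1 B1 B0 B0 B1, Vec B0 B1 B0 B0 B1 B0 B0) (Vec B0 B0 B1 B1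
  B0 B0 B1, Vec B1 B0 B0 B0 B0 B1 B0))) (T (T (Vec B0 B0 B1 B1 B0 B0 B1, Vec B1 B1 B0 B0 B1 B1 B0) (Vec B0 B0
  B1 B0 B0 B1 B0, Vec B1 B0 B0 B1 B1 B1 B0) (Vec B0 B0 B1 B1 B0 B1 B1, Vec B0 B1 B0 B1 B1 B1 B1)) (T (Vec B0
  B0 B1 B1 B0 B1 B1, Vec B1 B0 B0 B0 B0 B1 B0) (Vec B0 B0 B1 B1 B0 B1 B1, Vec B1 B1 B0 B1 B1 B0 B1) (Vec B0 B0
  B1 B1 B1 B0 B1, Vec B1 B0 B0 B1 B1 B1 B1)) (T (Vec B0 B0 B1 B1 B1 B0 B1, Vec B1 B1 B0 B1 B0 B1 B1) (Vec B0
  B0 B1 B0 B1 B1 B0, Vec B1 B1 B0 B1 B0 B1 B0) (Vec B0 B0 B1 B0 B1 B1 B0, Vec B1 B1 B0 B1 B1 B0 B0))) (T (T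
  (Vec B0 B0 B1 B1 B1 B1 B1, Vec B1 B1 B0 B0 B1 B1 B0) (Vec B0 B1 B1 B1 B0 B0 B1, Vec B1 B0 B1 B1 B1 B1 B0)
  (Vec B0 B1 B1 B1 B0 B1 B0, Vec B1 B0 B1 B0 B1 B1 B1)) (T (vnull, vnull) (vnull, vnull) (vnull, vnull)) (T
  (vnull, vnull) (vnull, vnull) (vnull, vnull)))) (T (T (T (vnull, vnull) (vnull, vnull) (vnull, vnull)) (T
  (vnull, vnull) (vnull, vnull) (vnull, vnull)) (T (vnull, vnull) (vnull, vnull) (vnull, vnull))) (T (T
  (vnull, vnull) (vnull, vnull) (vnull, vnull)) (T (vnull, vnull) (vnull, vnull) (vnull, vnull)) (T (vnull,
  vnull) (vnull, vnull) (vnull, vnull))) (T (T (vnull, vnull) (vnull, vnull) (vnull, vnull)) (T (vnull, vnull)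
  (vnull, vnull) (vnull, vnull)) (T (vnull, vnull) (vnull, vnull) (vnull, vnull)))) (T (T (T (vnull, vnull)
  (vnull, vnull) (vnull, vnull)) (T (vnull, vnull) (vnull, vnull) (vnull, vnull)) (T (vnull, vnull) (vnull,
  vnull) (vnull, vnull))) (T (T (vnull, vnull) (vnull, vnull) (vnull, vnull)) (T (vnull, vnull) (vnull, vnull)
  (vnull, vnull)) (T (vnull, vnull) (vnull, vnull) (vnull, vnull))) (T (T (vnull, vnull) (vnull, vnull)
  (vnull, vnull)) (T (vnull, vnull) (vnull, vnull) (vnull, vnull)) (T (vnull, vnull) (vnull, vnull) (vnull,
  vnull))))"
definition "col2_0 = column (T (T (T (T 210913572 0 0) (T 0 0 191739611) (T 153391689 172565650 191739611)) (T
  (T 172565650 0 153391689) (T 230087533 0 0) (T 0 230087533 0)) (T (T 230087533 0 0) (T 0 0 0) (T 0 0 0))) (T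
  (T (T 0 0 0) (T 0 0 0) (T 0 0 0)) (T (T 0 0 0) (T 0 0 0) (T 0 0 0)) (T (T 0 0 0) (T 0 0 0) (T 0 0 0))) (T (T
  (T 0 0 0) (T 0 0 0) (T 0 0 0)) (T (T 0 0 0) (T 0 0 0) (T 0 0 0)) (T (T 0 0 0) (T 0 0 0) (T 0 0 0))))"
definition "col2_1 = column (T (T (T (T 172565650 153391689 0) (T 230087533 0 210913572) (T 153391689
  172565650 249261494)) (T (T 191739611 0 172565650) (T 268435455 0 0) (T 0 268435455 153391689)) (T (T 0 0 0)
  (T 0 0 0) (T 0 0 0))) (T (T (T 0 0 0) (T 0 0 0) (T 0 0 0)) (T (T 0 0 0) (T 0 0 0) (T 0 0 0)) (T (T 0 0 0) (T
  0 0 0) (T 0 0 0))) (T (T (T 0 0 0) (T 0 0 0) (T 0 0 0)) (T (T 0 0 0) (T 0 0 0) (T 0 0 0)) (T (T 0 0 0) (T 0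
  0 0) (T 0 0 0))))"
definition "col2_2 = column (T (T (T (T 0 210913572 0) (T 153391689 210913572 249261494) (T 153391689
  249261494 0)) (T (T 0 0 0) (T 0 0 210913572) (T 0 153391689 0)) (T (T 0 0 0) (T 210913572 0 0) (T 0 0 0)))
  (T (T (T 0 0 0) (T 0 0 0) (T 0 0 0)) (T (T 0 0 0) (T 0 0 0) (T 0 0 0)) (T (T 0 0 0) (T 0 0 0) (T 0 0 0))) (T
  (T (T 0 0 0) (T 0 0 0) (T 0 0 0)) (T (T 0 0 0) (T 0 0 0) (T 0 0 0)) (T (T 0 0 0) (T 0 0 0) (T 0 0 0))))"
definition "col2_3 = column (T (T (T (T 191739611 0 0) (T 0 172565650 230087533) (T 0 153391689 153391689)) (T
  (T 249261494 0 210913572) (T 153391689 0 210913572) (T 0 249261494 0)) (T (T 230087533 0 191739611) (T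
  153391689 0 0) (T 0 0 0))) (T (T (T 0 0 0) (T 0 0 0) (T 0 0 0)) (T (T 0 0 0) (T 0 0 0) (T 0 0 0)) (T (T 0 0
  0) (T 0 0 0) (T 0 0 0))) (T (T (T 0 0 0) (T 0 0 0) (T 0 0 0)) (T (T 0 0 0) (T 0 0 0) (T 0 0 0)) (T (T 0 0 0)
  (T 0 0 0) (T 0 0 0))))"
definition "col2_4 = column (T (T (T (T 191739611 0 0) (T 153391689 0 249261494) (T 0 0 210913572)) (T (T
  153391689 0 230087533) (T 153391689 0 0) (T 0 0 0)) (T (T 210913572 0 0) (T 0 0 0) (T 0 0 0))) (T (T (T 0 0
  0) (T 0 0 0) (T 0 0 0)) (T (T 0 0 0) (T 0 0 0) (T 0 0 0)) (T (T 0 0 0) (T 0 0 0) (T 0 0 0))) (T (T (T 0 0 0)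
  (T 0 0 0) (T 0 0 0)) (T (T 0 0 0) (T 0 0 0) (T 0 0 0)) (T (T 0 0 0) (T 0 0 0) (T 0 0 0))))"
definition "col2_5 = column (T (T (T (T 0 0 0) (T 0 0 172565650) (T 0 0 0)) (T (T 0 0 0) (T 0 0 0) (T 0 0 0))
  (T (T 0 0 0) (T 0 0 0) (T 0 0 0))) (T (T (T 0 0 0) (T 0 0 0) (T 0 0 0)) (T (T 0 0 0) (T 0 0 0) (T 0 0 0)) (T
  (T 0 0 0) (T 0 0 0) (T 0 0 0))) (T (T (T 0 0 0) (T 0 0 0) (T 0 0 0)) (T (T 0 0 0) (T 0 0 0) (T 0 0 0)) (T (T
  0 0 0) (T 0 0 0) (T 0 0 0))))"
definition "col2_6 = column (T (T (T (T 0 153391689 0) (T 0 153391689 153391689) (T 0 153391689 0)) (T (T 0 0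
  0) (T 153391689 0 153391689) (T 0 0 0)) (T (T 0 0 0) (T 153391689 0 0) (T 0 0 0))) (T (T (T 0 0 0) (T 0 0 0)
  (T 0 0 0)) (T (T 0 0 0) (T 0 0 0) (T 0 0 0)) (T (T 0 0 0) (T 0 0 0) (T 0 0 0))) (T (T (T 0 0 0) (T 0 0 0) (T
  0 0 0)) (T (T 0 0 0) (T 0 0 0) (T 0 0 0)) (T (T 0 0 0) (T 0 0 0) (T 0 0 0))))"
definition "col2_7 = column (T (T (T (T 191739611 0 0) (T 191739611 0 0) (T 0 0 210913572)) (T (T 230087533 0
  230087533) (T 210913572 0 172565650) (T 0 0 0)) (T (T 0 0 210913572) (T 172565650 0 0) (T 0 0 0))) (T (T (T
  0 0 0) (T 0 0 0) (T 0 0 0)) (T (T 0 0 0) (T 0 0 0) (T 0 0 0)) (T (T 0 0 0) (T 0 0 0) (T 0 0 0))) (T (T (T 0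
  0 0) (T 0 0 0) (T 0 0 0)) (T (T 0 0 0) (T 0 0 0) (T 0 0 0)) (T (T 0 0 0) (T 0 0 0) (T 0 0 0))))"
definition "col2_8 = column (T (T (T (T 0 0 0) (T 210913572 249261494 172565650) (T 0 0 210913572)) (T (T
  210913572 0 268435455) (T 0 0 153391689) (T 0 172565650 0)) (T (T 210913572 0 172565650) (T 0 0 0) (T 0 0
  0))) (T (T (T 0 0 0) (T 0 0 0) (T 0 0 0)) (T (T 0 0 0) (T 0 0 0) (T 0 0 0)) (T (T 0 0 0) (T 0 0 0) (T 0 0
  0))) (T (T (T 0 0 0) (T 0 0 0) (T 0 0 0)) (T (T 0 0 0) (T 0 0 0) (T 0 0 0)) (T (T 0 0 0) (T 0 0 0) (T 0 0
  0))))"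
definition "col2_9 = column (T (T (T (T 0 0 0) (T 0 172565650 0) (T 0 0 0)) (T (T 0 0 230087533) (T 0 0 0) (T
  0 0 0)) (T (T 0 0 0) (T 0 0 0) (T 0 0 0))) (T (T (T 0 0 0) (T 0 0 0) (T 0 0 0)) (T (T 0 0 0) (T 0 0 0) (T 0
  0 0)) (T (T 0 0 0) (T 0 0 0) (T 0 0 0))) (T (T (T 0 0 0) (T 0 0 0) (T 0 0 0)) (T (T 0 0 0) (T 0 0 0) (T 0 0
  0)) (T (T 0 0 0) (T 0 0 0) (T 0 0 0))))"
definition "col2_10 = column (T (T (T (T 0 0 0) (T 0 0 0) (T 0 0 0)) (T (T 0 0 191739611) (T 0 0 0) (T 0 0 0))
  (T (T 0 0 0) (T 210913572 0 0) (T 0 0 0))) (T (T (T 0 0 0) (T 0 0 0) (T 0 0 0)) (T (T 0 0 0) (T 0 0 0) (T 0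
  0 0)) (T (T 0 0 0) (T 0 0 0) (T 0 0 0))) (T (T (T 0 0 0) (T 0 0 0) (T 0 0 0)) (T (T 0 0 0) (T 0 0 0) (T 0 0
  0)) (T (T 0 0 0) (T 0 0 0) (T 0 0 0))))"
definition "col2_11 = column (T (T (T (T 153391689 0 0) (T 0 0 0) (T 0 0 0)) (T (T 0 0 0) (T 0 0 0) (T 0 0 0))
  (T (T 0 0 0) (T 0 0 0) (T 0 0 0))) (T (T (T 0 0 0) (T 0 0 0) (T 0 0 0)) (T (T 0 0 0) (T 0 0 0) (T 0 0 0)) (T
  (T 0 0 0) (T 0 0 0) (T 0 0 0))) (T (T (T 0 0 0) (T 0 0 0) (T 0 0 0)) (T (T 0 0 0) (T 0 0 0) (T 0 0 0)) (T (T
  0 0 0) (T 0 0 0) (T 0 0 0))))"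
definition "col2_12 = column (T (T (T (T 0 0 0) (T 0 0 0) (T 0 0 0)) (T (T 0 0 172565650) (T 0 0 0) (T 0 0 0))
  (T (T 0 0 0) (T 0 0 0) (T 0 0 0))) (T (T (T 0 0 0) (T 0 0 0) (T 0 0 0)) (T (T 0 0 0) (T 0 0 0) (T 0 0 0)) (T
  (T 0 0 0) (T 0 0 0) (T 0 0 0))) (T (T (T 0 0 0) (T 0 0 0) (T 0 0 0)) (T (T 0 0 0) (T 0 0 0) (T 0 0 0)) (T (T
  0 0 0) (T 0 0 0) (T 0 0 0))))"
definition "col2_13 = column (T (T (T (T 153391689 0 0) (T 0 0 153391689) (T 0 0 0)) (T (T 0 0 210913572) (T 0
  0 0) (T 0 0 0)) (T (T 0 0 0) (T 0 0 0) (T 0 0 0))) (T (T (T 0 0 0) (T 0 0 0) (T 0 0 0)) (T (T 0 0 0) (T 0 0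
  0) (T 0 0 0)) (T (T 0 0 0) (T 0 0 0) (T 0 0 0))) (T (T (T 0 0 0) (T 0 0 0) (T 0 0 0)) (T (T 0 0 0) (T 0 0 0)
  (T 0 0 0)) (T (T 0 0 0) (T 0 0 0) (T 0 0 0))))"
definition "col2_14 = column (T (T (T (T 210913572 0 0) (T 210913572 172565650 0) (T 0 0 0)) (T (T 0 0 0) (T 0
  0 153391689) (T 0 0 0)) (T (T 0 0 172565650) (T 0 0 0) (T 0 0 0))) (T (T (T 0 0 0) (T 0 0 0) (T 0 0 0)) (T
  (T 0 0 0) (T 0 0 0) (T 0 0 0)) (T (T 0 0 0) (T 0 0 0) (T 0 0 0))) (T (T (T 0 0 0) (T 0 0 0) (T 0 0 0)) (T (T
  0 0 0) (T 0 0 0) (T 0 0 0)) (T (T 0 0 0) (T 0 0 0) (T 0 0 0))))"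
definition "col2_15 = column (T (T (T (T 0 0 0) (T 0 0 172565650) (T 0 0 0)) (T (T 210913572 0 249261494) (T
  249261494 0 0) (T 0 0 0)) (T (T 172565650 0 0) (T 0 0 0) (T 0 0 0))) (T (T (T 0 0 0) (T 0 0 0) (T 0 0 0)) (T
  (T 0 0 0) (T 0 0 0) (T 0 0 0)) (T (T 0 0 0) (T 0 0 0) (T 0 0 0))) (T (T (T 0 0 0) (T 0 0 0) (T 0 0 0)) (T (T
  0 0 0) (T 0 0 0) (T 0 0 0)) (T (T 0 0 0) (T 0 0 0) (T 0 0 0))))"
definition "col2_16 = column (T (T (T (T 153391689 0 0) (T 0 191739611 249261494) (T 0 0 153391689)) (T (T
  172565650 0 210913572) (T 0 0 230087533) (T 0 0 0)) (T (T 0 0 153391689) (T 0 0 0) (T 0 0 0))) (T (T (T 0 0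
  0) (T 0 0 0) (T 0 0 0)) (T (T 0 0 0) (T 0 0 0) (T 0 0 0)) (T (T 0 0 0) (T 0 0 0) (T 0 0 0))) (T (T (T 0 0 0)
  (T 0 0 0) (T 0 0 0)) (T (T 0 0 0) (T 0 0 0) (T 0 0 0)) (T (T 0 0 0) (T 0 0 0) (T 0 0 0))))"
definition "col2_17 = column (T (T (T (T 0 0 0) (T 172565650 0 153391689) (T 0 0 172565650)) (T (T 0 0 0) (T 0
  0 0) (T 0 0 0)) (T (T 0 0 0) (T 0 0 0) (T 0 0 0))) (T (T (T 0 0 0) (T 0 0 0) (T 0 0 0)) (T (T 0 0 0) (T 0 0
  0) (T 0 0 0)) (T (T 0 0 0) (T 0 0 0) (T 0 0 0))) (T (T (T 0 0 0) (T 0 0 0) (T 0 0 0)) (T (T 0 0 0) (T 0 0 0)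
  (T 0 0 0)) (T (T 0 0 0) (T 0 0 0) (T 0 0 0))))"
definition "col2_18 = column (T (T (T (T 0 0 0) (T 0 0 0) (T 0 0 0)) (T (T 0 0 210913572) (T 0 0 0) (T 0 0 0))
  (T (T 0 0 0) (T 0 0 0) (T 0 0 0))) (T (T (T 0 0 0) (T 0 0 0) (T 0 0 0)) (T (T 0 0 0) (T 0 0 0) (T 0 0 0)) (T
  (T 0 0 0) (T 0 0 0) (T 0 0 0))) (T (T (T 0 0 0) (T 0 0 0) (T 0 0 0)) (T (T 0 0 0) (T 0 0 0) (T 0 0 0)) (T (T
  0 0 0) (T 0 0 0) (T 0 0 0))))"
definition "col2_19 = column (T (T (T (T 0 0 0) (T 0 0 0) (T 0 0 0)) (T (T 0 0 153391689) (T 0 0 0) (T 0 0 0))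
  (T (T 0 0 0) (T 0 0 0) (T 0 0 0))) (T (T (T 0 0 0) (T 0 0 0) (T 0 0 0)) (T (T 0 0 0) (T 0 0 0) (T 0 0 0)) (T
  (T 0 0 0) (T 0 0 0) (T 0 0 0))) (T (T (T 0 0 0) (T 0 0 0) (T 0 0 0)) (T (T 0 0 0) (T 0 0 0) (T 0 0 0)) (T (T
  0 0 0) (T 0 0 0) (T 0 0 0))))"
definition "col2_20 = column (T (T (T (T 210913572 210913572 0) (T 0 0 0) (T 0 153391689 0)) (T (T 0 0
  172565650) (T 0 0 0) (T 0 0 0)) (T (T 0 0 0) (T 210913572 0 0) (T 0 0 0))) (T (T (T 0 0 0) (T 0 0 0) (T 0 0
  0)) (T (T 0 0 0) (T 0 0 0) (T 0 0 0)) (T (T 0 0 0) (T 0 0 0) (T 0 0 0))) (T (T (T 0 0 0) (T 0 0 0) (T 0 0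
  0)) (T (T 0 0 0) (T 0 0 0) (T 0 0 0)) (T (T 0 0 0) (T 0 0 0) (T 0 0 0))))"
definition "table2 = T (T (T (T col2_0 col2_1 col2_2) (T col2_3 col2_4 col2_5) (T col2_6 col2_7 col2_8)) (T (T
  col2_9 col2_10 col2_11) (T col2_12 col2_13 col2_14) (T col2_15 col2_16 col2_17)) (T (T col2_18 col2_19
  col2_20) (T no_column no_column no_column) (T no_column no_column no_column))) (T (T (T no_column no_column
  no_column) (T no_column no_column no_column) (T no_column no_column no_column)) (T (T no_column no_column
  no_column) (T no_column no_column no_column) (T no_column no_column no_column)) (T (T no_column no_column
  no_column) (T no_column no_column no_column) (T no_column no_column no_column))) (T (T (T no_column
  no_column no_column) (T no_column no_column no_column) (T no_column no_column no_column)) (T (T no_column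
  no_column no_column) (T no_column no_column no_column) (T no_column no_column no_column)) (T (T no_column
  no_column no_column) (T no_column no_column no_column) (T no_column no_column no_column)))"

section \<open>The certificate for four elements\<close>

definition points4 :: "f4 vec7 tri tri tri tri" where "points4 = T (T (T (T (Vec F0 F0 F0 F0 F0 F0 F1) (Vec F0
  F0 F0 F0 F0 F1 F1) (Vec F0 F0 F0 F0 F1 F1 F1)) (T (Vec F0 F0 F0 F0 F1 F1 Fw) (Vec F0 F0 F0 F0 F1 F1 Fv) (Vec
  F0 F0 F1 F0 F0 F0 F0)) (T (Vec F0 F0 F1 F1 F0 F0 F1) (Vec F0 F0 F1 F0 F0 F1 F0) (Vec F0 F0 F1 F1 F0 F1 F1)))
  (T (T (Vec F0 F0 F1 F0 F1 F0 F0) (Vec F0 F0 F1 F1 F1 F0 F1) (Vec F0 F0 F1 F0 F1 F1 F0)) (T (Vec F0 F0 F1 F1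
  F1 F1 F1) (Vec F0 F0 F1 Fv F1 F1 Fw) (Vec F0 F0 F1 Fw F1 F1 Fv)) (T (Vec F0 F1 F1 F0 F0 F0 F0) (Vec F0 F1 F1
  F1 F0 F0 F1) (Vec F0 F1 F1 F1 F0 F1 F0))) (T (T (Vec F0 F1 F1 F0 F0 F1 F1) (Vec F0 F1 F1 Fw F0 F1 Fw) (Vec
  F0 F1 F1 Fv F0 F1 Fv)) (T (Vec F0 F1 F1 F0 F1 F0 F0) (Vec F0 F1 F1 F1 F1 F0 F1) (Vec F0 F1 F1 Fv F1 F0 Fw))
  (T (Vec F0 F1 F1 Fw F1 F0 Fv) (Vec F0 F1 F1 F1 F1 F1 F0) (Vec F0 F1 F1 F0 F1 F1 F1)))) (T (T (T (Vec F0 F1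
  F1 Fw F1 F1 Fw) (Vec F0 F1 F1 Fv F1 F1 Fv) (Vec F0 F1 F1 Fv F1 Fw F0)) (T (Vec F0 F1 F1 Fw F1 Fw F1) (Vec F0
  F1 F1 F0 F1 Fw Fw) (Vec F0 F1 F1 F1 F1 Fw Fv)) (T (Vec F0 F1 F1 Fw F1 Fv F0) (Vec F0 F1 F1 Fv F1 Fv F1) (Vec
  F0 F1 F1 F1 F1 Fv Fw))) (T (T (Vec F0 F1 F1 F0 F1 Fv Fv) (Vec F1 F1 F1 F0 F0 F0 F0) (Vec F1 F1 F1 F1 F0 F0
  F1)) (T (Vec F1 F1 F1 F0 F0 F1 F1) (Vec F1 F1 F1 Fw F0 F1 Fw) (Vec F1 F1 F1 Fv F0 F1 Fv)) (T (Vec F1 F1 F1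
  F1 F1 F1 F1) (Vec F1 F1 F1 Fv F1 F1 Fw) (Vec F1 F1 F1 Fw F1 F1 Fv))) (T (T (Vec F1 F1 F1 F0 F1 Fw Fv) (Vec
  F1 F1 F1 F0 F1 Fv Fw) (Vec F1 F1 Fw F0 F0 F0 F0)) (T (Vec F1 F1 Fw Fv F0 F0 F1) (Vec F1 F1 Fw Fw F0 F1 F1)
  (Vec F1 F1 Fw Fv F0 F1 Fw)) (T (Vec F1 F1 Fw F0 F0 F1 Fv) (Vec F1 F1 Fw Fv F1 F1 F1) (Vec F1 F1 Fw Fw F1 F1
  Fw)))) (T (T (T (Vec F1 F1 Fw F1 F1 F1 Fv) (Vec F1 F1 Fw F0 F1 Fw Fw) (Vec F1 F1 Fw F0 F1 Fv F1)) (T (Vec F1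
  F1 Fv F0 F0 F0 F0) (Vec F1 F1 Fv Fw F0 F0 F1) (Vec F1 F1 Fv Fv F0 F1 F1)) (T (Vec F1 F1 Fv F0 F0 F1 Fw) (Vec
  F1 F1 Fv Fw F0 F1 Fv) (Vec F1 F1 Fv Fw F1 F1 F1))) (T (T (Vec F1 F1 Fv F1 F1 F1 Fw) (Vec F1 F1 Fv Fv F1 F1
  Fv) (Vec F1 F1 Fv F0 F1 Fw F1)) (T (Vec F1 F1 Fv F0 F1 Fv Fv) vnull vnull) (T vnull vnull vnull)) (T (T
  vnull vnull vnull) (T vnull vnull vnull) (T vnull vnull vnull)))"
definition planes4 :: "(f4 vec7 \<times> f4 vec7) tri tri tri tri" where "planes4 = T (T (T (T (Vec F0 F0 F0 F0
  F0 F0 F1, Vec F0 F1 F0 F0 F0 F0 F0) (Vec F0 F0 F0 F0 F0 F0 F1, Vec F1 F0 F0 F0 F0 F0 F0) (Vec F0 F0 F0 F0 F0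
  F0 F1, Vec F1 F1 F0 F0 F0 F0 F0)) (T (Vec F0 F0 F0 F0 F0 F1 F1, Vec F0 F1 F1 F0 F0 F0 F0) (Vec F0 F0 F0 F0
  F0 F1 F1, Vec F1 F0 F0 F0 F0 F0 F0) (Vec F0 F0 F0 F0 F0 F1 F1, Vec F1 F1 F1 F0 F0 F0 F0)) (T (Vec F0 F0 F0
  F0 F0 F1 F1, Vec F1 Fw Fw F0 F0 F0 F0) (Vec F0 F0 F0 F0 F0 F1 F1, Vec F1 Fv Fv F0 F0 F0 F0) (Vec F0 F0 F0 F0
  F1 F1 F1, Vec F0 F1 F1 F0 F0 F0 F0))) (T (T (Vec F0 F0 F0 F0 F1 F1 F1, Vec F1 Fw Fv F0 F0 F0 F0) (Vec F0 F0
  F0 F0 F1 F1 F1, Vec F1 Fv Fw F0 F0 F0 F0) (Vec F0 F0 F0 F0 F1 F1 Fw, Vec F0 F1 Fv F0 F0 F0 F0)) (T (Vec F0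
  F0 F0 F0 F1 F1 Fw, Vec F1 Fw Fw F0 F0 F0 F0) (Vec F0 F0 F0 F0 F1 F1 Fw, Vec F1 Fv F1 F0 F0 F0 F0) (Vec F0 F0
  F0 F0 F1 F1 Fv, Vec F0 F1 Fw F0 F0 F0 F0)) (T (Vec F0 F0 F0 F0 F1 F1 Fv, Vec F1 Fw F1 F0 F0 F0 F0) (Vec F0
  F0 F0 F0 F1 F1 Fv, Vec F1 Fv Fv F0 F0 F0 F0) (Vec F0 F0 F1 F1 F0 F0 F1, Vec F0 F1 F0 F0 F1 F0 F0))) (T (T
  (Vec F0 F0 F1 F1 F0 F0 F1, Vec F1 F0 F0 F0 F0 F1 F0) (Vec F0 F0 F1 F1 F0 F0 F1, Vec F1 F1 F0 F0 F1 F1 F0)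
  (Vec F0 F0 F1 F0 F0 F1 F0, Vec F1 F0 F0 F1 F1 F1 F0)) (T (Vec F0 F0 F1 F1 F0 F1 F1, Vec F0 F1 F0 F1 F1 F1
  F1) (Vec F0 F0 F1 F1 F0 F1 F1, Vec F1 F0 F0 F0 F0 F1 F0) (Vec F0 F0 F1 F1 F0 F1 F1, Vec F1 F1 F0 F1 F1 F0
  F1)) (T (Vec F0 F0 F1 F1 F0 F1 F1, Vec F1 Fw F0 Fw Fw Fv Fw) (Vec F0 F0 F1 F1 F0 F1 F1, Vec F1 Fv F0 Fv Fv
  Fw Fv) (Vec F0 F0 F1 F1 F1 F0 F1, Vec F1 F0 F0 F1 F1 F1 F1)))) (T (T (T (Vec F0 F0 F1 F1 F1 F0 F1, Vec F1 F1
  F0 F1 F0 F1 F1) (Vec F0 F0 F1 F1 F1 F0 F1, Vec F1 Fw F0 F1 Fv F1 F1) (Vec F0 F0 F1 F1 F1 F0 F1, Vec F1 Fv F0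
  F1 Fw F1 F1)) (T (Vec F0 F0 F1 F0 F1 F1 F0, Vec F1 F1 F0 F1 F0 F1 F0) (Vec F0 F0 F1 F0 F1 F1 F0, Vec F1 F1
  F0 F1 F1 F0 F0) (Vec F0 F0 F1 F0 F1 F1 F0, Vec F1 F1 F0 F1 Fw Fv F0)) (T (Vec F0 F0 F1 F0 F1 F1 F0, Vec F1
  F1 F0 F1 Fv Fw F0) (Vec F0 F0 F1 F1 F1 F1 F1, Vec F1 F1 F0 F0 F1 F1 F0) (Vec F0 F0 F1 F1 F1 F1 F1, Vec F1 Fw
  F0 Fv F1 Fw Fv))) (T (T (Vec F0 F0 F1 F1 F1 F1 F1, Vec F1 Fv F0 Fw F1 Fv Fw) (Vec F0 F0 F1 Fv F1 F1 Fw, Vec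
  F0 F1 F0 Fw F1 Fv F1) (Vec F0 F0 F1 Fv F1 F1 Fw, Vec F1 F0 F0 Fw Fv F1 F1)) (T (Vec F0 F0 F1 Fv F1 F1 Fw,
  Vec F1 F1 F0 F0 Fw Fw F0) (Vec F0 F0 F1 Fv F1 F1 Fw, Vec F1 Fw F0 F1 F1 F0 Fv) (Vec F0 F0 F1 Fv F1 F1 Fw,
  Vec F1 Fv F0 Fv F0 Fv Fw)) (T (Vec F0 F0 F1 Fw F1 F1 Fv, Vec F1 F1 F0 F0 Fv Fv F0) (Vec F0 F0 F1 Fw F1 F1
  Fv, Vec F1 Fw F0 Fw F0 Fw Fv) (Vec F0 F0 F1 Fw F1 F1 Fv, Vec F1 Fv F0 F1 F1 F0 Fw))) (T (T (Vec F0 F1 F1 F1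
  F0 F0 F1, Vec F1 F0 F1 F1 F1 F1 F0) (Vec F0 F1 F1 F1 F0 F0 F1, Vec F1 F0 Fw Fw Fw F1 Fv) (Vec F0 F1 F1 F1 F0
  F0 F1, Vec F1 F0 Fv Fv Fv F1 Fw)) (T (Vec F0 F1 F1 F1 F0 F1 F0, Vec F1 F0 F1 F0 F1 F1 F1) (Vec F0 F1 F1 F1
  F0 F1 F0, Vec F1 F0 Fw F0 Fw F1 F1) (Vec F0 F1 F1 F1 F0 F1 F0, Vec F1 F0 Fv F0 Fv F1 F1)) (T (Vec F0 F1 F1
  Fw F0 F1 Fw, Vec F1 F0 F1 F1 Fv F0 Fw) (Vec F0 F1 F1 Fw F0 F1 Fw, Vec F1 F0 Fw Fw F1 Fw F1) (Vec F0 F1 F1 Fw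
  F0 F1 Fw, Vec F1 F0 Fv Fv Fw F1 F0)))) (T (T (T (Vec F0 F1 F1 Fv F0 F1 Fv, Vec F1 F0 F1 F1 Fw F0 Fv) (Vec F0
  F1 F1 Fv F0 F1 Fv, Vec F1 F0 Fw Fw Fv F1 F0) (Vec F0 F1 F1 Fv F0 F1 Fv, Vec F1 F0 Fv Fv F1 Fv F1)) (T (Vec
  F0 F1 F1 Fv F1 F0 Fw, Vec F1 F0 F1 F1 F0 Fw F1) (Vec F0 F1 F1 Fv F1 F0 Fw, Vec F1 F0 Fw Fv Fw Fw F0) (Vec F0
  F1 F1 Fv F1 F0 Fw, Vec F1 F0 Fv F0 F1 Fw Fw)) (T (Vec F0 F1 F1 Fw F1 F0 Fv, Vec F1 F0 F1 F1 F0 Fv F1) (Vec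
  F0 F1 F1 Fw F1 F0 Fv, Vec F1 F0 Fw F0 F1 Fv Fv) (Vec F0 F1 F1 Fw F1 F0 Fv, Vec F1 F0 Fv Fw Fv Fv F0))) (T (T
  (Vec F0 F1 F1 F0 F1 F1 F1, Vec F1 F0 F1 F1 Fw Fv Fv) (Vec F0 F1 F1 F0 F1 F1 F1, Vec F1 F0 F1 F1 Fv Fw Fw)
  (Vec F0 F1 F1 Fw F1 F1 Fw, Vec F1 F0 Fv F0 Fw Fv Fv)) (T (Vec F0 F1 F1 Fv F1 F1 Fv, Vec F1 F0 Fw F0 Fv Fw
  Fw) (Vec F0 F1 F1 Fv F1 Fw F0, Vec F1 F0 Fw Fw F0 Fv Fw) (Vec F0 F1 F1 Fw F1 Fv F0, Vec F1 F0 Fv Fv F0 Fw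
  Fv)) (T (vnull, vnull) (vnull, vnull) (vnull, vnull))) (T (T (vnull, vnull) (vnull, vnull) (vnull, vnull))
  (T (vnull, vnull) (vnull, vnull) (vnull, vnull)) (T (vnull, vnull) (vnull, vnull) (vnull, vnull))))"
definition "col4_0 = column (T (T (T (T 0 0 0) (T 0 0 0) (T 0 0 230087533)) (T (T 191739611 230087533 0) (T
  230087533 0 268435455) (T 0 249261494 230087533)) (T (T 210913572 0 230087533) (T 172565650 0 191739611) (T
  0 191739611 0))) (T (T (T 249261494 172565650 191739611) (T 230087533 0 0) (T 249261494 153391689
  230087533)) (T (T 0 0 210913572) (T 210913572 0 191739611) (T 0 191739611 0)) (T (T 0 0 0) (T 0 268435455
  153391689) (T 210913572 0 210913572))) (T (T (T 0 0 0) (T 0 230087533 0) (T 210913572 0 153391689)) (T (T 0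
  230087533 0) (T 0 0 0) (T 0 0 0)) (T (T 0 0 0) (T 0 0 0) (T 0 0 0))))"
definition "col4_1 = column (T (T (T (T 0 0 0) (T 0 0 0) (T 0 0 153391689)) (T (T 0 268435455 210913572) (T
  249261494 210913572 268435455) (T 0 172565650 153391689)) (T (T 172565650 0 230087533) (T 0 0 230087533) (T
  0 0 0))) (T (T (T 249261494 172565650 230087533) (T 0 0 191739611) (T 249261494 153391689 191739611)) (T (T
  0 0 172565650) (T 172565650 0 0) (T 0 153391689 0)) (T (T 0 0 0) (T 249261494 210913572 153391689) (T
  172565650 0 191739611))) (T (T (T 0 0 0) (T 0 172565650 0) (T 172565650 0 249261494)) (T (T 0 268435455 0)
  (T 0 0 0) (T 0 0 0)) (T (T 0 0 0) (T 0 0 0) (T 0 0 0))))"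
definition "col4_2 = column (T (T (T (T 0 0 0) (T 0 0 0) (T 0 0 248966574)) (T (T 153391689 172860570
  191739611) (T 237003334 221401701 138413184) (T 0 181546402 167780354)) (T (T 139887784 136315456 219598893)
  (T 185741347 184233970 225892077) (T 153391689 159061745 142608640))) (T (T (T 195345227 245394246
  242378470) (T 224417477 136315456 169254954) (T 158176985 0 232480181)) (T (T 194132259 0 245066038) (T
  221991541 0 188757123) (T 0 247163766 0)) (T (T 0 0 0) (T 188723835 237888094 175843058) (T 241788630 0
  159356665))) (T (T (T 0 0 0) (T 0 240870582 0) (T 157882065 237298254 138379896)) (T (T 0 185151507 0) (T 0
  0 0) (T 0 0 0)) (T (T 0 0 0) (T 0 0 0) (T 0 0 0))))"
definition "col4_3 = column (T (T (T (T 0 0 0) (T 0 0 0) (T 0 153391689 230677373)) (T (T 153391689 153096769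
  218124293) (T 204325468 171352682 134512648) (T 0 235200526 171975810)) (T (T 249261494 151293961 141690592)
  (T 145296208 190854851 178858834) (T 153391689 260962591 244771118))) (T (T (T 136315456 245066038
  251981839) (T 220222021 162667361 247458686) (T 196229987 0 157258937)) (T (T 184561667 0 162077521) (T
  194427179 0 153391689) (T 0 151588881 0)) (T (T 251686919 251686919 0) (T 172565650 259749623 159979793) (T
  157258937 0 221696621))) (T (T (T 0 156374177 156374177) (T 0 235790366 0) (T 259749623 249589702
  231300501)) (T (T 0 138708104 159979793) (T 159979793 0 0) (T 0 0 0)) (T (T 0 0 0) (T 0 0 0) (T 0 0 0))))"
definition "col4_4 = column (T (T (T (T 0 0 0) (T 0 0 0) (T 0 153391689 251654142)) (T (T 0 173745330
  146180968) (T 164765089 249261494 194132259) (T 0 144706368 262470479)) (T (T 234905606 153096769 246573926)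
  (T 230087533 228579645 142608640) (T 150999041 136610376 0))) (T (T (T 233988069 198917555 189641883) (T
  260077831 0 152473641) (T 203735628 0 181251482)) (T (T 0 0 215109028) (T 150999041 0 219598893) (T 0
  260044543 0)) (T (T 251686919 251686919 0) (T 226515205 249884622 212126540) (T 155784337 0 245066038))) (T
  (T (T 0 156374177 156374177) (T 0 166567897 0) (T 155784337 239395982 240870582)) (T (T 0 194722099
  159979793) (T 159979793 0 0) (T 0 0 0)) (T (T 0 0 0) (T 0 0 0) (T 0 0 0))))"
definition "col4_5 = column (T (T (T (T 0 0 0) (T 0 0 0) (T 0 153391689 169878082)) (T (T 153391689 191149771
  0) (T 156374177 258275023 188133995) (T 0 187544155 160274713)) (T (T 208226004 151293961 203112500) (T
  225597157 221106781 257651895) (T 136315456 237888094 263060319))) (T (T (T 209110764 205833356 206128276)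
  (T 221401701 252276759 198917555) (T 184233970 0 156374177)) (T (T 173155490 0 228612933) (T 145591128 0
  140510912) (T 0 135102488 0)) (T (T 0 0 0) (T 145591128 233398229 208815844) (T 223794349 0 217206756))) (T
  (T (T 0 156374177 156374177) (T 0 207307956 0) (T 225892077 149196744 236675126)) (T (T 0 212126540
  159979793) (T 159979793 0 0) (T 0 0 0)) (T (T 0 0 0) (T 0 0 0) (T 0 0 0))))"
definition "col4_6 = column (T (T (T (T 0 0 0) (T 0 0 0) (T 0 153391689 188428915)) (T (T 153391689 220811861
  155489417) (T 220811861 228284725 0) (T 0 148901824 252866599)) (T (T 217796596 150999041 268140535) (T
  243886358 174073538 154571369) (T 136315456 148573616 173450410))) (T (T (T 231595421 139003024 265158047)
  (T 193247499 241788630 214814108) (T 175253218 0 158766825)) (T (T 173450410 0 208815844) (T 208520924 0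
  201015283) (T 0 213929348 0)) (T (T 251686919 251686919 0) (T 147099016 228579645 142903560) (T 230382453 0
  180333434))) (T (T (T 0 156374177 156374177) (T 0 203735628 0) (T 265158047 202817580 135102488)) (T (T 0
  220222021 159979793) (T 159979793 0 0) (T 0 0 0)) (T (T 0 0 0) (T 0 0 0) (T 0 0 0))))"
definition "col4_7 = column (T (T (T (T 0 0 0) (T 0 0 0) (T 0 153391689 139297944)) (T (T 153391689 142575352
  153686609) (T 156669097 171057762 184561667) (T 0 150999041 142903560)) (T (T 243591438 0 145886048) (T
  181251482 148278696 139297944) (T 134512648 249261494 134807568))) (T (T (T 257356975 256767135 259749623)
  (T 178563914 168075274 210028812) (T 181841322 0 158176985)) (T (T 176171266 0 209405684) (T 177056026 0
  180956562) (T 0 160864553 0)) (T (T 251686919 251686919 0) (T 159684873 171647602 200130523) (T 257980103 0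
  202817580))) (T (T (T 0 156374177 156374177) (T 0 264239999 0) (T 200130523 253784647 244181278)) (T (T 0
  146475888 159979793) (T 159979793 0 0) (T 0 0 0)) (T (T 0 0 0) (T 0 0 0) (T 0 0 0))))"
definition "col4_8 = column (T (T (T (T 0 0 0) (T 0 0 0) (T 0 0 145296208)) (T (T 0 160864553 0) (T 136610376
  245689166 203440708) (T 0 171352682 253161519)) (T (T 258569943 150999041 152473641) (T 151293961 164175249
  194722099) (T 201342980 170173002 184528890))) (T (T (T 143788320 216911836 178268994) (T 229792613
  142280432 0) (T 154571369 0 206423196)) (T (T 226515205 0 248966574) (T 263060319 0 197442955) (T 0
  219893813 0)) (T (T 0 0 0) (T 178235706 224384189 242378470) (T 201342980 0 165354929))) (T (T (T 0 0 0) (T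
  0 234872829 0) (T 210618652 195640147 266960855)) (T (T 0 252571679 0) (T 0 0 0) (T 0 0 0)) (T (T 0 0 0) (T
  0 0 0) (T 0 0 0))))"
definition "col4_9 = column (T (T (T (T 0 0 0) (T 0 0 0) (T 0 0 148901824)) (T (T 0 268435455 148901824) (T
  266371015 268435455 136282168) (T 0 148901824 268435455)) (T (T 148901824 0 0) (T 0 253751359 266371015) (T
  0 0 0))) (T (T (T 266371015 148901824 266371015) (T 0 0 253751359) (T 150966264 251686919 150966264)) (T (T
  0 0 251686919) (T 148901824 0 266371015) (T 0 268435455 0)) (T (T 0 0 0) (T 253751359 136282168 136282168)
  (T 251686919 0 266371015))) (T (T (T 0 0 0) (T 0 251686919 0) (T 136282168 266371015 0)) (T (T 0 251686919
  0) (T 0 0 0) (T 0 0 0)) (T (T 0 0 0) (T 0 0 0) (T 0 0 0))))"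
definition "col4_10 = column (T (T (T (T 0 0 0) (T 0 0 0) (T 0 0 251686919)) (T (T 0 148901824 136282168) (T
  150966264 148901824 268435455) (T 0 268435455 268435455)) (T (T 136282168 0 0) (T 0 0 266371015) (T 0 0 0)))
  (T (T (T 253751359 136282168 0) (T 0 0 150966264) (T 253751359 251686919 266371015)) (T (T 0 0 148901824) (T
  136282168 0 150966264) (T 0 268435455 0)) (T (T 0 0 0) (T 253751359 136282168 148901824) (T 148901824 0 0)))
  (T (T (T 0 0 0) (T 0 136282168 0) (T 251686919 266371015 266371015)) (T (T 0 136282168 0) (T 0 0 0) (T 0 0
  0)) (T (T 0 0 0) (T 0 0 0) (T 0 0 0))))"
definition "col4_11 = column (T (T (T (T 0 0 0) (T 0 0 0) (T 0 0 210913572)) (T (T 0 265158047 0) (T 176466186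
  194132259 155161209) (T 0 157587145 135397408)) (T (T 135397408 0 230710661) (T 155161209 169878082
  265452967) (T 159979793 238183014 139297944))) (T (T (T 238772854 205538436 245360958) (T 171057762
  213929348 177056026) (T 250769382 0 140182704)) (T (T 0 0 177645866) (T 177350946 0 136610376) (T 0
  186036267 0)) (T (T 0 0 0) (T 156964017 178563914 187249235) (T 176171266 0 146475888))) (T (T (T 0 0 0) (T
  0 170762842 0) (T 208815844 207602876 182431162)) (T (T 0 153981529 0) (T 0 0 0) (T 0 0 0)) (T (T 0 0 0) (T
  0 0 0) (T 0 0 0))))"
definition "col4_12 = column (T (T (T (T 0 0 0) (T 0 0 0) (T 0 0 205833356)) (T (T 0 171057762 205833356) (T
  242673390 159979793 171057762) (T 0 171057762 171057762)) (T (T 171057762 0 196819827) (T 0 0 0) (T 0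
  196819827 0))) (T (T (T 242673390 159979793 0) (T 196819827 0 231595421) (T 242673390 159979793 196819827))
  (T (T 0 0 171057762) (T 171057762 0 242673390) (T 0 171057762 0)) (T (T 0 0 0) (T 196819827 171057762
  171057762) (T 159979793 0 0))) (T (T (T 0 0 0) (T 0 205833356 0) (T 205833356 231595421 242673390)) (T (T 0
  205833356 0) (T 0 0 0) (T 0 0 0)) (T (T 0 0 0) (T 0 0 0) (T 0 0 0))))"
definition "col4_13 = column (T (T (T (T 0 0 0) (T 0 0 0) (T 0 0 171057762)) (T (T 0 171057762 159979793) (T
  242673390 268435455 205833356) (T 0 171057762 159979793)) (T (T 205833356 0 242673390) (T 0 196819827 0) (T
  0 196819827 0))) (T (T (T 242673390 171057762 0) (T 196819827 0 242673390) (T 196819827 159979793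
  231595421)) (T (T 0 0 268435455) (T 205833356 0 196819827) (T 0 268435455 0)) (T (T 0 0 0) (T 196819827
  205833356 268435455) (T 171057762 0 196819827))) (T (T (T 0 0 0) (T 0 171057762 0) (T 159979793 196819827
  231595421)) (T (T 0 171057762 0) (T 0 0 0) (T 0 0 0)) (T (T 0 0 0) (T 0 0 0) (T 0 0 0))))"
definition "col4_14 = column (T (T (T (T 0 0 0) (T 0 0 0) (T 0 0 220188733)) (T (T 0 223204509 0) (T 177350946
  217206756 227694885) (T 0 145001288 165060009)) (T (T 187249235 0 139297944) (T 201342980 198032795
  203735628) (T 0 175843058 221991541))) (T (T (T 226186997 244771118 160274713) (T 153391689 214519188
  249261494) (T 178563914 0 265452967)) (T (T 169549874 0 142903560) (T 150081504 0 245689166) (T 0 208520924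
  0)) (T (T 0 0 0) (T 161159473 208226004 218124293) (T 203440708 0 202817580))) (T (T (T 0 0 0) (T 0
  253784647 0) (T 213601140 251359222 186331187)) (T (T 0 198622635 0) (T 0 0 0) (T 0 0 0)) (T (T 0 0 0) (T 0
  0 0) (T 0 0 0))))"
definition "col4_15 = column (T (T (T (T 0 0 0) (T 0 0 0) (T 0 0 176466186)) (T (T 0 156374177 156374177) (T
  198622635 176466186 156374177) (T 0 204030548 268435455)) (T (T 204030548 0 0) (T 0 198622635 246279006) (T
  0 198622635 0))) (T (T (T 246279006 176466186 246279006) (T 246279006 0 198622635) (T 0 156374177 0)) (T (T
  0 0 176466186) (T 204030548 0 246279006) (T 0 176466186 0)) (T (T 0 0 0) (T 0 156374177 156374177) (T
  156374177 0 246279006))) (T (T (T 0 0 0) (T 0 176466186 0) (T 176466186 246279006 198622635)) (T (T 0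
  268435455 0) (T 0 0 0) (T 0 0 0)) (T (T 0 0 0) (T 0 0 0) (T 0 0 0))))"
definition "col4_16 = column (T (T (T (T 0 0 0) (T 0 0 0) (T 0 0 204030548)) (T (T 0 156374177 204030548) (T 0
  204030548 156374177) (T 0 156374177 176466186)) (T (T 176466186 0 0) (T 0 246279006 0) (T 0 0 0))) (T (T (T
  246279006 176466186 246279006) (T 0 0 0) (T 0 156374177 198622635)) (T (T 0 0 204030548) (T 176466186 0
  198622635) (T 0 204030548 0)) (T (T 0 0 0) (T 0 204030548 204030548) (T 204030548 0 198622635))) (T (T (T 0
  0 0) (T 0 156374177 0) (T 156374177 198622635 0)) (T (T 0 268435455 0) (T 0 0 0) (T 0 0 0)) (T (T 0 0 0) (T
  0 0 0) (T 0 0 0))))"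
definition "col4_17 = column (T (T (T (T 0 0 0) (T 0 0 0) (T 0 0 189343678)) (T (T 0 232685438 134218020) (T
  174319761 134743334 153391689) (T 0 158002715 172831954)) (T (T 244909186 136613953 170759655) (T 266305534
  172715154 156139390) (T 151261768 265630424 151520778))) (T (T (T 248852688 244909478 213309505) (T
  134218020 214966288 211179876) (T 228333130 136347649 246513793)) (T (T 136347941 0 268435455) (T 228216330
  0 262103022) (T 0 172040628 0)) (T (T 0 0 0) (T 251507923 231893528 215641398) (T 136347649 0 185031660)))
  (T (T (T 0 0 0) (T 0 230196747 0) (T 136497153 140550453 155614076)) (T (T 0 263707337 0) (T 0 0 0) (T 0 0
  0)) (T (T 0 0 0) (T 0 0 0) (T 0 0 0))))"
definition "col4_18 = column (T (T (T (T 0 0 0) (T 0 0 0) (T 0 0 267760345)) (T (T 0 155464572 0) (T 263966347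
  263966347 134743042) (T 0 168512934 217096501)) (T (T 172715446 0 217621523) (T 234140541 230087533
  170759655) (T 134484032 248852688 134633828))) (T (T (T 174586065 172981458 174436853) (T 151262060
  231744024 151145260) (T 191889407 0 232010328)) (T (T 136872963 0 136497153) (T 228333130 0 188818364) (T 0
  172831954 0)) (T (T 0 0 0) (T 170759363 151261768 211555394) (T 136873255 0 155347772))) (T (T (T 0 0 0) (T
  0 151936586 0) (T 251657427 187161581 261687214)) (T (T 0 213419303 0) (T 0 0 0) (T 0 0 0)) (T (T 0 0 0) (T
  0 0 0) (T 0 0 0))))"
definition "col4_19 = column (T (T (T (T 0 0 0) (T 0 0 0) (T 0 0 188850828)) (T (T 0 151520271 0) (T 263308264
  171030985 134484995) (T 0 142334969 157352584)) (T (T 254550633 0 241991081) (T 167301958 177494133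
  151288514) (T 151293953 138463393 240539146))) (T (T (T 241222145 136623304 185114693) (T 138452993
  244706530 212876688) (T 134234318 0 186724503)) (T (T 134251522 0 216024107) (T 188809410 0 239159756) (T 0
  181820146 0)) (T (T 0 0 0) (T 245258263 183416148 254284708) (T 134251521 0 172619484))) (T (T (T 0 0 0) (T
  0 167866525 0) (T 185628801 252007070 225273436)) (T (T 0 226275462 0) (T 0 0 0) (T 0 0 0)) (T (T 0 0 0) (T
  0 0 0) (T 0 0 0))))"
definition "col4_20 = column (T (T (T (T 0 0 0) (T 0 0 0) (T 0 0 180546445)) (T (T 0 150735445 134217801) (T
  162465569 194681080 137134081) (T 0 145734868 256613346)) (T (T 179075615 136318976 219606566) (T 151469758
  179207873 145737053) (T 134484041 227027458 137148012))) (T (T (T 145526919 184421309 141784566) (T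
  135797838 136467912 247030329) (T 230014473 0 266706917)) (T (T 134217738 0 265889138) (T 223547900 0
  238145216) (T 0 210793459 0)) (T (T 0 0 0) (T 248932893 241941947 229785930) (T 134217798 0 168561218))) (T
  (T (T 0 0 0) (T 0 142148693 0) (T 138921334 209064321 201698314)) (T (T 0 210303387 0) (T 0 0 0) (T 0 0 0))
  (T (T 0 0 0) (T 0 0 0) (T 0 0 0))))"
definition "col4_21 = column (T (T (T (T 0 0 0) (T 0 0 0) (T 0 0 170712256)) (T (T 0 191174797 0) (T 157309427
  138471325 153354241) (T 0 174787474 153103414)) (T (T 185184733 134254593 187080755) (T 211145796 185287432
  151714297) (T 153358337 156147587 141543962))) (T (T (T 155306071 140540578 151820997) (T 134252620
  137020805 137039330) (T 170445544 0 141343311)) (T (T 138414083 0 156081802) (T 153672867 0 167954134) (T 0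
  153404275 0)) (T (T 0 0 0) (T 153354127 141264766 172070873) (T 134219790 0 141062275))) (T (T (T 0 0 0) (T
  0 185438288 0) (T 184809414 191707238 191225355)) (T (T 0 157590016 0) (T 0 0 0) (T 0 0 0)) (T (T 0 0 0) (T
  0 0 0) (T 0 0 0))))"
definition "col4_22 = column (T (T (T (T 0 0 0) (T 0 0 0) (T 0 0 234151240)) (T (T 0 240624582 0) (T 183298853
  193695899 134774796) (T 0 167921035 202663921)) (T (T 226035833 134251008 145527913) (T 248130301 249756759
  221006075) (T 134221833 210815329 231340911))) (T (T (T 163071784 134618962 192668742) (T 134743078
  193109391 164285281) (T 184513325 0 236194406)) (T (T 134743111 0 223565135) (T 204044593 0 161823217) (T 0
  258043949 0)) (T (T 0 0 0) (T 264998555 162007680 148977042) (T 134743111 0 218915330))) (T (T (T 0 0 0) (T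
  0 182694214 0) (T 201186822 238645387 145060279)) (T (T 0 149226825 0) (T 0 0 0) (T 0 0 0)) (T (T 0 0 0) (T
  0 0 0) (T 0 0 0))))"
definition "col4_23 = column (T (T (T (T 0 0 0) (T 0 0 0) (T 0 0 151360008)) (T (T 0 141406721 0) (T 199034224
  193572515 134512640) (T 0 231800790 138719243)) (T (T 185524348 151027712 231922684) (T 250929293 138676963
  145168919) (T 150994953 219963408 163827263))) (T (T (T 172443883 151031945 134250633) (T 134250499
  200922996 243064616) (T 155488256 134217729 136344196)) (T (T 0 0 155136378) (T 140612162 0 204436945) (T 0
  215679608 0)) (T (T 0 0 0) (T 214667710 135549578 192546179) (T 134217731 0 138682507))) (T (T (T 0 0 0) (T
  0 153895053 0) (T 193479821 155517578 155730624)) (T (T 0 220497696 0) (T 0 0 0) (T 0 0 0)) (T (T 0 0 0) (T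
  0 0 0) (T 0 0 0))))"
definition "col4_24 = column (T (T (T (T 0 0 0) (T 0 0 0) (T 0 0 139047554)) (T (T 0 136947905 0) (T 208934988
  201659273 153096768) (T 0 153891018 153092225)) (T (T 140552842 134221888 206060424) (T 141159756 214930955
  155888266) (T 136319040 136129218 155980035))) (T (T (T 151819009 134811777 138481664) (T 134221824
  153462856 151763465) (T 136852032 0 139198594)) (T (T 0 0 155531849) (T 134523464 0 225188352) (T 0
  222566405 0)) (T (T 0 0 0) (T 155327176 207984847 219122574) (T 138412097 0 136314880))) (T (T (T 0 0 0) (T
  0 151003786 0) (T 230463714 157327872 140583499)) (T (T 0 137140810 0) (T 0 0 0) (T 0 0 0)) (T (T 0 0 0) (T
  0 0 0) (T 0 0 0))))"
definition "col4_25 = column (T (T (T (T 0 0 0) (T 0 0 0) (T 0 0 169882242)) (T (T 0 191107651 0) (T 177454427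
  161433450 136348168) (T 0 179016582 136380936)) (T (T 256335945 136348232 211292760) (T 180814922 161848311
  247419472) (T 136610376 134458660 260410967))) (T (T (T 201181383 134258698 134324800) (T 134250570
  229013252 243786027) (T 153944272 0 174494778)) (T (T 134217802 0 168230888) (T 171979889 0 220288405) (T 0
  265977663 0)) (T (T 0 0 0) (T 252104140 231702660 196613701) (T 134217794 0 134742088))) (T (T (T 0 0 0) (T
  0 154862736 0) (T 197281165 175453249 136549528)) (T (T 0 187833969 0) (T 0 0 0) (T 0 0 0)) (T (T 0 0 0) (T
  0 0 0) (T 0 0 0))))"
definition "col4_26 = column (T (T (T (T 0 0 0) (T 0 0 0) (T 0 0 138699807)) (T (T 0 141227012 0) (T 141058388
  137237791 137101828) (T 0 156108638 139128842)) (T (T 153256500 134217736 136450561) (T 151901381 176177077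
  140672630) (T 134218242 136756500 155642960))) (T (T (T 151795050 157991429 153257500) (T 134221827
  158260782 155205204) (T 136865354 0 157992460)) (T (T 134218242 0 157290560) (T 157290509 0 138954842) (T 0
  136480857 0)) (T (T 0 0 0) (T 151970676 157430529 140699154) (T 134479876 0 153391617))) (T (T (T 0 0 0) (T
  0 155858507 0) (T 138969116 134271573 140919383)) (T (T 0 151286786 0) (T 0 0 0) (T 0 0 0)) (T (T 0 0 0) (T
  0 0 0) (T 0 0 0))))"
definition "col4_27 = column (T (T (T (T 0 0 0) (T 0 0 0) (T 0 0 138683393)) (T (T 0 170734740 0) (T 147622535
  157759162 134479882) (T 0 188908668 134492296)) (T (T 208490697 134479880 136721961) (T 248510107 155689280
  204169315) (T 134221832 207701364 218415130))) (T (T (T 222900801 172232844 134481028) (T 134483971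
  155698790 146137370) (T 138417286 134217729 137101314)) (T (T 134218753 0 135844358) (T 172532817 0
  188847228) (T 0 195022264 0)) (T (T 0 0 0) (T 173650376 154020182 173840411) (T 134480896 0 134479874))) (T
  (T (T 0 0 0) (T 0 141321876 0) (T 199515295 174678538 174601862)) (T (T 0 218682443 0) (T 0 0 0) (T 0 0 0))
  (T (T 0 0 0) (T 0 0 0) (T 0 0 0))))"
definition "col4_28 = column (T (T (T (T 0 0 0) (T 0 0 0) (T 0 0 140510208)) (T (T 0 176697882 0) (T 193758692
  155814421 136316417) (T 0 249628111 138416144)) (T (T 197965465 136315393 184138384) (T 140360433 261926685
  240565377) (T 136314881 247145344 182452245))) (T (T (T 170427930 134747777 136315537) (T 136844288
  172776517 260768803) (T 140510737 0 177022099)) (T (T 134218752 0 193260359) (T 155783891 0 135232992) (T 0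
  210124958 0)) (T (T 0 0 0) (T 139632967 261279814 178395909) (T 134218241 0 136839697))) (T (T (T 0 0 0) (T
  0 168103746 0) (T 206338414 136590539 158147090)) (T (T 0 186953931 0) (T 0 0 0) (T 0 0 0)) (T (T 0 0 0) (T
  0 0 0) (T 0 0 0))))"
definition "col4_29 = column (T (T (T (T 0 0 0) (T 0 0 0) (T 0 0 134808067)) (T (T 0 172496528 0) (T 201663876
  138614401 136577546) (T 0 203502998 169943562)) (T (T 174653968 136577024 137308826) (T 190681163 155700717
  138615307) (T 134480384 242693641 139665552))) (T (T (T 136393218 137175570 168099866) (T 136315392
  167838235 241373067) (T 136454147 0 140711058)) (T (T 0 0 174065297) (T 170726417 0 235930649) (T 0
  204356227 0)) (T (T 0 0 0) (T 174462746 235473565 142154242) (T 135004162 0 136847896))) (T (T (T 0 0 0) (T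
  0 134291456 0) (T 171117582 140837003 174928008)) (T (T 0 135270546 0) (T 0 0 0) (T 0 0 0)) (T (T 0 0 0) (T
  0 0 0) (T 0 0 0))))"
definition "col4_30 = column (T (T (T (T 0 0 0) (T 0 0 0) (T 0 0 153477329)) (T (T 0 135472875 0) (T 206995505
  156648961 134480459) (T 0 206632586 236062417)) (T (T 176084126 134480392 155312882) (T 149819483 155468848
  197458695) (T 134479872 134802654 202915920))) (T (T (T 257053438 202310159 139854529) (T 134238213
  171279474 256127642) (T 222785630 0 201991306)) (T (T 134479879 0 219623473) (T 158282768 0 138991165) (T 0
  238548015 0)) (T (T 0 0 0) (T 205408795 252192102 256632049) (T 134283269 0 222454345))) (T (T (T 0 0 0) (T
  0 251991208 0) (T 204921316 224596112 207709805)) (T (T 0 237713126 0) (T 0 0 0) (T 0 0 0)) (T (T 0 0 0) (T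
  0 0 0) (T 0 0 0))))"
definition "col4_31 = column (T (T (T (T 0 0 0) (T 0 0 0) (T 0 0 224502472)) (T (T 0 203981970 0) (T 267664539
  238593060 134217736) (T 0 238523565 170512984)) (T (T 153883136 134218240 208978536) (T 149597175 169995199
  195132596) (T 134218241 235278828 155210452))) (T (T (T 189081155 151265925 138437319) (T 134545538
  168636637 187212481) (T 235672194 0 224708314)) (T (T 134283265 0 168800794) (T 256663702 0 157589655) (T 0
  251991209 0)) (T (T 0 0 0) (T 195418216 217641200 191605530) (T 134283267 0 140513295))) (T (T (T 0 0 0) (T
  0 254091846 0) (T 208018274 186717276 218452572)) (T (T 0 251709002 0) (T 0 0 0) (T 0 0 0)) (T (T 0 0 0) (T
  0 0 0) (T 0 0 0))))"
definition "col4_32 = column (T (T (T (T 0 0 0) (T 0 0 0) (T 0 0 239960065)) (T (T 0 134276168 201326592) (T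
  152044121 142377492 134480393) (T 0 256757788 141145752)) (T (T 241467932 134479881 159195240) (T 250041279
  212050954 236758705) (T 134479873 153351296 154104916))) (T (T (T 251749970 134291529 134480456) (T
  201327104 192757969 171171924) (T 156050131 0 224759822)) (T (T 201327104 0 168113889) (T 170747547 0
  225838652) (T 0 241587338 0)) (T (T 0 0 0) (T 208311578 156971696 254068379) (T 134218241 0 140607564))) (T
  (T (T 0 0 0) (T 0 201449988 0) (T 202086322 151838722 189104273)) (T (T 0 208466654 0) (T 0 0 0) (T 0 0 0))
  (T (T 0 0 0) (T 0 0 0) (T 0 0 0))))"
definition "col4_33 = column (T (T (T (T 0 0 0) (T 0 0 0) (T 0 0 218718786)) (T (T 0 239353857 0) (T 156160611
  187875993 134479872) (T 0 168452314 140812298)) (T (T 218431703 134218240 189469732) (T 164086165 156413408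
  134484725) (T 134218240 244879793 256177223))) (T (T (T 208254037 137216001 138711683) (T 134218371
  176125458 170439781) (T 220259529 0 257978520)) (T (T 0 0 256368727) (T 191406172 0 241053731) (T 0
  158238308 0)) (T (T 0 0 0) (T 227773377 237728954 225075943) (T 134218240 0 136892416))) (T (T (T 0 0 0) (T
  0 237295245 0) (T 175157556 134489681 185427661)) (T (T 0 203724430 0) (T 0 0 0) (T 0 0 0)) (T (T 0 0 0) (T
  0 0 0) (T 0 0 0))))"
definition "col4_34 = column (T (T (T (T 0 0 0) (T 0 0 0) (T 0 0 138440712)) (T (T 0 138690697 0) (T 235111998
  138728583 134479873) (T 0 205836303 134230152)) (T (T 155197451 0 222323726) (T 160869859 164722392
  190185601) (T 0 164691860 155467908))) (T (T (T 134484108 134492167 138694656) (T 134217731 235197455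
  167788552) (T 138424327 0 138698756)) (T (T 134217731 0 205832206) (T 134221834 0 251658250) (T 0 134238209
  0)) (T (T 0 0 0) (T 219299874 138866733 156251148) (T 134217729 0 134483980))) (T (T (T 0 0 0) (T 0
  134234116 0) (T 158012043 138436748 134500480)) (T (T 0 138440835 0) (T 0 0 0) (T 0 0 0)) (T (T 0 0 0) (T 0
  0 0) (T 0 0 0))))"
definition "col4_35 = column (T (T (T (T 0 0 0) (T 0 0 0) (T 0 0 134742145)) (T (T 0 138477569 0) (T 143225602
  145233808 134218241) (T 0 165678929 136909313)) (T (T 145232640 134217729 161570193) (T 173513549 162459930
  155733205) (T 134217729 215267421 134744592))) (T (T (T 157811649 136839168 136319489) (T 134218240
  166203841 141115392) (T 136843776 0 134217857)) (T (T 0 0 134749968) (T 157878848 0 141038912) (T 0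
  149440976 0)) (T (T 0 0 0) (T 222905472 159383936 155193601) (T 134217729 0 138940928))) (T (T (T 0 0 0) (T
  0 138483840 0) (T 231437383 134746240 134811648)) (T (T 0 153682881 0) (T 0 0 0) (T 0 0 0)) (T (T 0 0 0) (T
  0 0 0) (T 0 0 0))))"
definition "col4_36 = column (T (T (T (T 0 0 0) (T 0 0 0) (T 0 0 136847368)) (T (T 0 135070217 0) (T 145825546
  138323979 134479872) (T 0 136390747 134225930)) (T (T 168173610 0 136095819) (T 259927593 170886430
  170470225) (T 134479872 205632233 170623041))) (T (T (T 169910290 134553610 134479874) (T 134480384
  137502835 170232338) (T 136643082 0 134545923)) (T (T 0 0 135168586) (T 135077890 0 138248240) (T 0
  178454827 0)) (T (T 0 0 0) (T 179052587 169018144 144771602) (T 0 0 136642562))) (T (T (T 0 0 0) (T 0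
  136839712 0) (T 171832056 134480427 137175075)) (T (T 0 136544315 0) (T 0 0 0) (T 0 0 0)) (T (T 0 0 0) (T 0
  0 0) (T 0 0 0))))"
definition "col4_37 = column (T (T (T (T 0 0 0) (T 0 0 0) (T 0 0 134238220)) (T (T 0 134228015 134217729) (T
  137693609 136662692 134479873) (T 0 134484652 134562311)) (T (T 134428678 134217729 136453515) (T 134497699
  191139387 134569636) (T 134218245 135625115 134577028))) (T (T (T 136716458 134306315 134486658) (T
  134285317 136332450 134292240) (T 136342159 0 134547585)) (T (T 134283780 0 134290181) (T 136739113 0
  134358318) (T 0 134421815 0)) (T (T 0 0 0) (T 134495128 134510480 136789380) (T 134283269 0 136642735))) (T
  (T (T 0 0 0) (T 0 134228137 0) (T 136776983 134228099 136607878)) (T (T 0 134631585 0) (T 0 0 0) (T 0 0 0))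
  (T (T 0 0 0) (T 0 0 0) (T 0 0 0))))"
definition "col4_38 = column (T (T (T (T 0 0 0) (T 0 0 0) (T 0 0 134349848)) (T (T 0 139068441 0) (T 139077173
  134403116 134219272) (T 0 134782059 138417427)) (T (T 139127563 134218754 138939262) (T 138569811 169210654
  138998786) (T 134218755 139101024 134390578))) (T (T (T 138563896 139088650 134378002) (T 134742530
  134230564 139078977) (T 138429971 0 138957085)) (T (T 134219267 0 139127358) (T 134767120 0 134758759) (T 0
  134780183 0)) (T (T 0 0 0) (T 138583347 134915328 134384234) (T 134217731 0 134361616))) (T (T (T 0 0 0) (T
  0 138962189 0) (T 138599221 138954008 139068420)) (T (T 0 134232876 0) (T 0 0 0) (T 0 0 0)) (T (T 0 0 0) (T
  0 0 0) (T 0 0 0))))"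
definition "col4_39 = column (T (T (T (T 0 0 0) (T 0 0 0) (T 0 0 138412169)) (T (T 0 138428416 0) (T 171633888
  203428880 0) (T 0 168724155 134480012)) (T (T 138432641 0 236606978) (T 205765140 167843160 206046448) (T
  134479873 242308574 134483979))) (T (T (T 138690703 138416138 138678281) (T 134217857 138416256 235562232)
  (T 138690567 0 138424463)) (T (T 134217730 0 256946243) (T 138424451 0 174244091) (T 0 188150802 0)) (T (T 0
  0 0) (T 221986900 219030681 173769344) (T 134217730 0 138412171))) (T (T (T 0 0 0) (T 0 134496391 0) (T
  161682363 134479874 138686468)) (T (T 0 134483982 0) (T 0 0 0) (T 0 0 0)) (T (T 0 0 0) (T 0 0 0) (T 0 0
  0))))"
definition "col4_40 = column (T (T (T (T 0 0 0) (T 0 0 0) (T 0 0 139006592)) (T (T 0 141099136 0) (T 147079845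
  148972160 134218241) (T 0 141038209 138482304)) (T (T 143136769 134218240 148912650) (T 137542857 154590681
  140605444) (T 134218240 149428737 139004033))) (T (T (T 141101568 134287360 136315521) (T 134283777
  146870784 138483723) (T 141099520 0 138942465)) (T (T 134283265 0 139012096) (T 138942977 0 137110146) (T 0
  136317442 0)) (T (T 0 0 0) (T 139792548 140515467 147411072) (T 134283776 0 140574849))) (T (T (T 0 0 0) (T
  0 140581505 0) (T 166047951 140513920 136382464)) (T (T 0 136382976 0) (T 0 0 0) (T 0 0 0)) (T (T 0 0 0) (T
  0 0 0) (T 0 0 0))))"
definition "col4_41 = column (T (T (T (T 0 0 0) (T 0 0 0) (T 0 0 136913448)) (T (T 0 134291488 0) (T 149633318
  135078434 134480392) (T 0 139068033 135143944)) (T (T 137175080 0 137507330) (T 210822628 189911605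
  143854086) (T 0 149893920 134873098))) (T (T (T 134488608 137109506 136773634) (T 134218240 136519682
  135602720) (T 134685218 0 137101320)) (T (T 134283264 0 139472905) (T 134218274 0 139461128) (T 0 136643075
  0)) (T (T 0 0 0) (T 205724037 148178984 137691267) (T 134283264 0 134283264))) (T (T (T 0 0 0) (T 0
  137044520 0) (T 222945867 134553632 134414882)) (T (T 0 136904744 0) (T 0 0 0) (T 0 0 0)) (T (T 0 0 0) (T 0
  0 0) (T 0 0 0))))"
definition "col4_42 = column (T (T (T (T 0 0 0) (T 0 0 0) (T 0 0 134508557)) (T (T 0 136839176 0) (T 240456336
  190890725 134218240) (T 0 242746499 139276809)) (T (T 209190956 0 141263872) (T 235997910 186866329
  198885545) (T 134479873 214783620 158973992))) (T (T (T 135012992 138429066 134234113) (T 138412545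
  174244484 209675313) (T 134758912 0 136646665)) (T (T 0 0 139846842) (T 136860299 0 186999848) (T 0
  237851315 0)) (T (T 0 0 0) (T 136961856 135102529 173657933) (T 0 0 140857347))) (T (T (T 0 0 0) (T 0
  136409103 0) (T 205242335 141361165 139215489)) (T (T 0 134824461 0) (T 0 0 0) (T 0 0 0)) (T (T 0 0 0) (T 0
  0 0) (T 0 0 0))))"
definition "col4_43 = column (T (T (T (T 0 0 0) (T 0 0 0) (T 0 0 139006736)) (T (T 0 187269464 0) (T 243961290
  189107986 0) (T 0 142986267 137200921)) (T (T 190848515 134218241 198023499) (T 259312797 257189394
  217312805) (T 134217729 171446144 181245073))) (T (T (T 180720922 157352649 155292225) (T 134218248
  165677403 254324694) (T 171975106 0 170238424)) (T (T 134218240 0 147622659) (T 137112984 0 140556562) (T 0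
  189948238 0)) (T (T 0 0 0) (T 224690963 228904950 185705909) (T 0 0 153391617))) (T (T (T 0 0 0) (T 0
  168561155 0) (T 157917040 136878992 134584072)) (T (T 0 187020096 0) (T 0 0 0) (T 0 0 0)) (T (T 0 0 0) (T 0
  0 0) (T 0 0 0))))"
definition "col4_44 = column (T (T (T (T 0 0 0) (T 0 0 0) (T 0 0 172765328)) (T (T 0 184881218 0) (T 241493251
  170629617 134480384) (T 0 176428735 157328539)) (T (T 159254895 134218240 168400400) (T 199872869 238425221
  238281986) (T 0 172524578 172940929))) (T (T (T 161749299 151625794 134549512) (T 134480384 150551947
  197235035) (T 138708152 0 251776421)) (T (T 0 0 214449013) (T 247335090 0 144378691) (T 0 217217819 0)) (T
  (T 0 0 0) (T 150355767 145523898 135499429) (T 0 0 151097867))) (T (T (T 0 0 0) (T 0 145283992 0) (T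
  192362990 137175081 204382428)) (T (T 0 234548285 0) (T 0 0 0) (T 0 0 0)) (T (T 0 0 0) (T 0 0 0) (T 0 0
  0))))"
definition "col4_45 = column (T (T (T (T 0 0 0) (T 0 0 0) (T 0 0 134217729)) (T (T 0 134221828 0) (T 253001903
  134230019 150994944) (T 0 184598534 150999041)) (T (T 151003141 0 235200515) (T 240164868 219395641
  134500385) (T 0 257221673 134221825))) (T (T (T 134217729 150999042 0) (T 150994945 167776263 168054785) (T
  134217733 0 134230022)) (T (T 134217729 0 134217730) (T 151007238 0 184553473) (T 0 234893327 0)) (T (T 0 0
  0) (T 219336718 234922115 236360740) (T 0 0 150994946))) (T (T (T 0 0 0) (T 0 151003142 0) (T 219301031
  150999047 134217733)) (T (T 0 134217729 0) (T 0 0 0) (T 0 0 0)) (T (T 0 0 0) (T 0 0 0) (T 0 0 0))))"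
definition "col4_46 = column (T (T (T (T 0 0 0) (T 0 0 0) (T 0 0 150999041)) (T (T 0 134221824 0) (T 196090868
  134774809 0) (T 0 159449232 150999041)) (T (T 159908097 0 202151965) (T 176879577 205972922 203194514) (T 0
  227641344 151519497))) (T (T (T 134217745 150999041 134217729) (T 134217729 151289856 153391105) (T
  150999040 0 134217985)) (T (T 0 0 159484161) (T 151523344 0 135106568) (T 0 137769641 0)) (T (T 0 0 0) (T
  149243724 165597561 134521240) (T 0 0 134221824))) (T (T (T 0 0 0) (T 0 143130625 0) (T 166526486 150994945
  150995201)) (T (T 0 159912192 0) (T 0 0 0) (T 0 0 0)) (T (T 0 0 0) (T 0 0 0) (T 0 0 0))))"
definition "col4_47 = column (T (T (T (T 0 0 0) (T 0 0 0) (T 0 0 0)) (T (T 0 0 0) (T 174421837 134512640 0) (T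
  0 142644488 0)) (T (T 138412064 0 134515113) (T 218426507 172985492 205531088) (T 0 137828151 134218760)))
  (T (T (T 138413088 0 0) (T 0 135300128 148149512) (T 0 0 134348800)) (T (T 0 0 134348800) (T 134218752 0
  139494440) (T 0 163872768 0)) (T (T 0 0 0) (T 209994475 266091579 176461893) (T 0 0 0))) (T (T (T 0 0 0) (T
  0 134348800 0) (T 243845590 0 138544128)) (T (T 0 134218752 0) (T 0 0 0) (T 0 0 0)) (T (T 0 0 0) (T 0 0 0)
  (T 0 0 0))))"
definition "col4_48 = column (T (T (T (T 0 0 0) (T 0 0 0) (T 0 0 134221825)) (T (T 0 150999043 0) (T 260935688
  167792642 0) (T 0 151015426 150999040)) (T (T 167784451 0 201613314) (T 177929358 190926682 185432075) (T 0
  170983426 167788548))) (T (T (T 134217730 0 134221825) (T 0 151003139 251670529) (T 150999042 0 150999046))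
  (T (T 0 0 218107907) (T 0 0 251678725) (T 0 134258691 0)) (T (T 0 0 0) (T 252182552 185364754 176777474) (T
  134217729 0 134221825))) (T (T (T 0 0 0) (T 0 134234113 0) (T 234248512 150999040 134234112)) (T (T 0
  150994948 0) (T 0 0 0) (T 0 0 0)) (T (T 0 0 0) (T 0 0 0) (T 0 0 0))))"
definition "col4_49 = column (T (T (T (T 0 0 0) (T 0 0 0) (T 0 0 150999041)) (T (T 0 0 0) (T 143181877
  234787290 0) (T 0 249333945 150994944)) (T (T 238132456 0 236246307) (T 254021675 267197922 248117172) (T 0
  252511233 166434997))) (T (T (T 226450245 134217729 134217729) (T 0 142408463 233228123) (T 150994945 0
  150999057)) (T (T 0 0 162134495) (T 218104068 0 140681836) (T 0 149865065 0)) (T (T 0 0 0) (T 155122084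
  136521702 262773066) (T 134217729 0 0))) (T (T (T 0 0 0) (T 0 227020804 0) (T 141325267 143130624
  159907840)) (T (T 0 205783052 0) (T 0 0 0) (T 0 0 0)) (T (T 0 0 0) (T 0 0 0) (T 0 0 0))))"
definition "col4_50 = column (T (T (T (T 0 0 0) (T 0 0 0) (T 0 0 150994944)) (T (T 0 150999041 0) (T 247525760
  134218753 0) (T 0 184816776 0)) (T (T 134222849 0 184549377) (T 210539006 172314354 188705203) (T 0
  236670064 155194368))) (T (T (T 150995969 0 0) (T 0 155193345 134222849) (T 134217729 0 150994945)) (T (T 0
  0 150999040) (T 150994944 0 188743809) (T 0 152174723 0)) (T (T 0 0 0) (T 202219866 162529408 134614051) (T
  0 0 0))) (T (T (T 0 0 0) (T 0 151000064 0) (T 267673999 134222848 134221824)) (T (T 0 134218753 0) (T 0 0 0)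
  (T 0 0 0)) (T (T 0 0 0) (T 0 0 0) (T 0 0 0))))"
definition "col4_51 = column (T (T (T (T 0 0 0) (T 0 0 0) (T 0 0 139495504)) (T (T 0 171623705 167788545) (T
  263157679 207591546 142606976) (T 0 154838300 212899730)) (T (T 266698727 0 247814883) (T 197487333
  166670316 169886977) (T 0 0 258964847))) (T (T (T 228603782 147131104 227160718) (T 0 249223899 205165850)
  (T 248470251 167788545 158707060)) (T (T 0 0 140478584) (T 261059247 0 265353943) (T 0 240081003 0)) (T (T 0
  0 0) (T 262829967 197159621 208608618) (T 142606976 0 174411105))) (T (T (T 0 0 0) (T 0 166342604 0) (T
  167423964 181357289 209689978)) (T (T 0 227914422 0) (T 0 0 0) (T 0 0 0)) (T (T 0 0 0) (T 0 0 0) (T 0 0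
  0))))"
definition "col4_52 = column (T (T (T (T 0 0 0) (T 0 0 0) (T 0 0 134221825)) (T (T 0 134287361 134217729) (T
  134745348 143132944 0) (T 0 151525376 0)) (T (T 151525633 0 223084805) (T 186747912 181907716 205539457) (T
  0 136319104 159451392))) (T (T (T 159449088 134221825 134217729) (T 0 142678288 159910272) (T 134221825 0
  151060481)) (T (T 134217729 0 159979537) (T 142675969 0 143200256) (T 0 205586433 0)) (T (T 0 0 0) (T
  218666372 222415133 146870540) (T 134217729 0 134221825))) (T (T (T 0 0 0) (T 0 142610433 0) (T 209539819
  134285312 134219777)) (T (T 0 134289408 0) (T 0 0 0) (T 0 0 0)) (T (T 0 0 0) (T 0 0 0) (T 0 0 0))))"
definition "col4_53 = column (T (T (T (T 0 0 0) (T 0 0 0) (T 0 0 134221825)) (T (T 0 0 134217729) (T 160071953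
  150994977 0) (T 0 150994977 150999041)) (T (T 152047649 0 168951810) (T 176206851 169869618 159684906) (T 0
  152049697 135266305))) (T (T (T 152178689 150994945 134221824) (T 0 152043521 134348802) (T 150999040 0
  150999041)) (T (T 0 0 184553505) (T 135266304 0 185602080) (T 0 168857633 0)) (T (T 0 0 0) (T 151683083
  177537315 152174626) (T 0 0 134217729))) (T (T (T 0 0 0) (T 0 150994944 0) (T 168397082 134221824
  151126016)) (T (T 0 134221825 0) (T 0 0 0) (T 0 0 0)) (T (T 0 0 0) (T 0 0 0) (T 0 0 0))))"
definition "col4_54 = column (T (T (T (T 0 0 0) (T 0 0 0) (T 0 0 218128387)) (T (T 0 201334785 0) (T 177116276
  251686919 0) (T 0 0 0)) (T (T 218128387 0 184569862) (T 146802496 159958114 155763490) (T 0 198825838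
  151011330))) (T (T (T 167776260 0 201334785) (T 0 167776260 222716691) (T 218128387 0 201334785)) (T (T 0 0
  167776260) (T 251686919 0 218128387) (T 0 164153186 0)) (T (T 0 0 0) (T 260076615 146771192 166088658) (T 0
  0 167776260))) (T (T (T 0 0 0) (T 0 201334785 0) (T 216412113 167776260 151011330)) (T (T 0 251686919 0) (T
  0 0 0) (T 0 0 0)) (T (T 0 0 0) (T 0 0 0) (T 0 0 0))))"
definition "col4_55 = column (T (T (T (T 0 0 0) (T 0 0 0) (T 0 0 142610433)) (T (T 0 143130625 0) (T 231283736
  142708744 0) (T 0 159973376 0)) (T (T 143202577 0 160208904) (T 218208536 205590213 151280917) (T 0
  213910549 151521553))) (T (T (T 134217729 134742017 134746112) (T 0 143397128 143170713) (T 159911937 0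
  143130625)) (T (T 0 0 134746120) (T 159387921 0 143429633) (T 0 159489048 0)) (T (T 0 0 0) (T 230740352
  139023385 205851657) (T 0 0 134221825))) (T (T (T 0 0 0) (T 0 143130624 0) (T 159697296 134221840
  134221825)) (T (T 0 159973632 0) (T 0 0 0) (T 0 0 0)) (T (T 0 0 0) (T 0 0 0) (T 0 0 0))))"
definition "col4_56 = column (T (T (T (T 0 0 0) (T 0 0 0) (T 0 0 0)) (T (T 0 0 0) (T 192969992 134218752 0) (T
  0 138675202 0)) (T (T 138412032 0 134221952) (T 148993042 178928769 151318926) (T 0 140539695 134218880)))
  (T (T (T 138413056 0 0) (T 0 134480896 138719234) (T 0 0 134217856)) (T (T 0 0 138674306) (T 138412032 0
  134479872) (T 0 172261378 0)) (T (T 0 0 0) (T 159683975 155466760 184582146) (T 0 0 0))) (T (T (T 0 0 0) (T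
  0 138412032 0) (T 149955936 0 138412160)) (T (T 0 134217856 0) (T 0 0 0) (T 0 0 0)) (T (T 0 0 0) (T 0 0 0)
  (T 0 0 0))))"
definition "col4_57 = column (T (T (T (T 0 0 0) (T 0 0 0) (T 0 0 134217729)) (T (T 0 134217729 0) (T 236203686
  151015430 0) (T 0 234909700 134217729)) (T (T 218120197 0 134246407) (T 169097076 173099653 168063012) (T 0
  235161734 134234115))) (T (T (T 234881029 0 0) (T 0 167780356 185602070) (T 134217729 0 134234113)) (T (T 0
  0 134238213) (T 251678722 0 201355270) (T 0 135270404 0)) (T (T 0 0 0) (T 151241594 252715014 234881041) (T
  0 0 134217729))) (T (T (T 0 0 0) (T 0 184553474 0) (T 256813508 167776257 234885122)) (T (T 0 134234112 0)
  (T 0 0 0) (T 0 0 0)) (T (T 0 0 0) (T 0 0 0) (T 0 0 0))))"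
definition "col4_58 = column (T (T (T (T 0 0 0) (T 0 0 0) (T 0 0 134283521)) (T (T 0 134283521 0) (T 240123885
  159449361 0) (T 0 134813953 0)) (T (T 134283521 0 139057409) (T 238951042 196216350 231528592) (T 0
  193674097 134283521))) (T (T (T 134748160 0 0) (T 0 134283521 206362752) (T 134283521 0 0)) (T (T 0 0 0) (T
  134748160 0 134283521) (T 0 231528592 0)) (T (T 0 0 0) (T 243202786 139057409 134813953) (T 0 0 0))) (T (T
  (T 0 0 0) (T 0 0 0) (T 175292930 134813953 134748160)) (T (T 0 134748160 0) (T 0 0 0) (T 0 0 0)) (T (T 0 0
  0) (T 0 0 0) (T 0 0 0))))"
definition "col4_59 = column (T (T (T (T 0 0 0) (T 0 0 0) (T 0 0 0)) (T (T 0 0 0) (T 146784272 135397504 0) (T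
  0 138420608 0)) (T (T 138413056 0 173146112) (T 246419580 226322128 138688810) (T 0 237252325 138412032)))
  (T (T (T 135266336 0 0) (T 0 138412032 146835488) (T 0 0 135266304)) (T (T 0 0 139592704) (T 0 0 135266464)
  (T 0 173048096 0)) (T (T 0 0 0) (T 134490378 172269952 138816544) (T 0 0 0))) (T (T (T 0 0 0) (T 0 135266304
  0) (T 149408274 0 135266304)) (T (T 0 134218752 0) (T 0 0 0) (T 0 0 0)) (T (T 0 0 0) (T 0 0 0) (T 0 0 0))))"
definition "col4_60 = column (T (T (T (T 0 0 0) (T 0 0 0) (T 0 0 0)) (T (T 0 134217729 0) (T 218652029
  218681347 0) (T 0 199950398 0)) (T (T 184582157 0 197359913) (T 164505758 154903980 264082956) (T 0
  144807041 235180038))) (T (T (T 151003136 0 0) (T 0 201424919 180264997) (T 134217729 0 134225924)) (T (T 0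
  0 168419352) (T 218632194 0 169978413) (T 0 197159225 0)) (T (T 0 0 0) (T 202348832 242317036 151982062) (T
  0 0 0))) (T (T (T 0 0 0) (T 0 235417621 0) (T 239128140 201326592 167772161)) (T (T 0 168308738 0) (T 0 0 0)
  (T 0 0 0)) (T (T 0 0 0) (T 0 0 0) (T 0 0 0))))"
definition "col4_61 = column (T (T (T (T 0 0 0) (T 0 0 0) (T 0 0 0)) (T (T 0 150999057 0) (T 147935701
  264226871 0) (T 0 141021199 0)) (T (T 144531408 0 253334243) (T 262743653 192233650 144485781) (T 0
  202113297 184769543))) (T (T (T 147943024 134217729 0) (T 0 190676624 152429256) (T 0 0 142612497)) (T (T 0
  0 135259004) (T 182310159 0 154125089) (T 0 190007656 0)) (T (T 0 0 0) (T 240023028 265022766 166936754) (T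
  0 0 0))) (T (T (T 0 0 0) (T 0 205520936 0) (T 180719062 142610432 134283520)) (T (T 0 240469524 0) (T 0 0 0)
  (T 0 0 0)) (T (T 0 0 0) (T 0 0 0) (T 0 0 0))))"
definition "col4_62 = column (T (T (T (T 0 0 0) (T 0 0 0) (T 0 0 263581466)) (T (T 0 259065129 0) (T 189980603
  237568332 138412065) (T 0 156898533 216494769)) (T (T 180812731 0 147782391) (T 237720540 230009858
  134877380) (T 0 204048454 241897965))) (T (T (T 216901735 152196752 230499396) (T 225510433 255057818
  246279006) (T 180761001 0 176601482)) (T (T 207718435 0 198976877) (T 172508029 0 138564273) (T 0 221892182
  0)) (T (T 0 0 0) (T 181166973 268400637 216901735) (T 138446883 0 165456999))) (T (T (T 0 0 0) (T 0
  176990542 0) (T 237214090 194309914 208242791)) (T (T 0 0 0) (T 0 0 0) (T 0 0 0)) (T (T 0 0 0) (T 0 0 0) (T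
  0 0 0))))"
definition "col4_63 = column (T (T (T (T 0 0 0) (T 0 0 0) (T 0 0 0)) (T (T 0 201326593 0) (T 188990049
  151531521 0) (T 0 140790962 0)) (T (T 234881025 0 141667253) (T 248261794 249919350 184985460) (T 0
  136907536 151023620))) (T (T (T 167772165 0 0) (T 0 251674626 165335388) (T 201326592 0 201334784)) (T (T 0
  0 134250536) (T 201334784 0 139480230) (T 0 165260483 0)) (T (T 0 0 0) (T 136548362 197803636 172044880) (T
  0 0 0))) (T (T (T 0 0 0) (T 0 234881025 0) (T 135233928 201326593 167772160)) (T (T 0 167780357 0) (T 0 0 0)
  (T 0 0 0)) (T (T 0 0 0) (T 0 0 0) (T 0 0 0))))"
definition "col4_64 = column (T (T (T (T 0 0 0) (T 0 0 0) (T 0 0 0)) (T (T 0 0 0) (T 181341146 201355271 0) (T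
  0 263472782 0)) (T (T 201347072 0 226009018) (T 150601592 208820423 190583993) (T 0 231666305 234885126)))
  (T (T (T 134234112 0 0) (T 0 201342982 208699527) (T 167772160 0 201342976)) (T (T 0 0 219189273) (T
  201330688 0 201548843) (T 0 168820569 0)) (T (T 0 0 0) (T 157431817 185584654 258307278) (T 0 0 0))) (T (T
  (T 0 0 0) (T 0 201347074 0) (T 241816403 167772160 167792642)) (T (T 0 134221826 0) (T 0 0 0) (T 0 0 0)) (T
  (T 0 0 0) (T 0 0 0) (T 0 0 0))))"
definition "col4_65 = column (T (T (T (T 0 0 0) (T 0 0 0) (T 0 0 0)) (T (T 0 138412064 0) (T 137176912
  135397386 0) (T 0 152438792 0)) (T (T 138416257 0 134353929) (T 235858208 136423081 160730531) (T 0
  134847502 134348801))) (T (T (T 138413088 0 0) (T 0 134225024 152047616) (T 0 0 0)) (T (T 0 0 134479882) (T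
  138412160 0 135430176) (T 0 155362474 0)) (T (T 0 0 0) (T 185637280 155630761 138852384) (T 0 0 0))) (T (T
  (T 0 0 0) (T 0 134217856 0) (T 177373361 0 138543264)) (T (T 0 138413088 0) (T 0 0 0) (T 0 0 0)) (T (T 0 0
  0) (T 0 0 0) (T 0 0 0))))"
definition "col4_66 = column (T (T (T (T 0 0 0) (T 0 0 0) (T 0 0 134217729)) (T (T 0 134221824 0) (T 178771622
  211970072 0) (T 0 169240598 134217729)) (T (T 202595680 0 191505867) (T 172716469 217287010 188664644) (T 0
  201854336 264410188))) (T (T (T 167863594 0 0) (T 0 142505303 161298879) (T 0 0 134220033)) (T (T 0 0
  223363184) (T 136854366 0 142018957) (T 0 144582846 0)) (T (T 0 0 0) (T 230993461 221222743 211111778) (T 0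
  0 0))) (T (T (T 0 0 0) (T 0 134217731 0) (T 264323915 134217984 142610432)) (T (T 0 137372744 0) (T 0 0 0)
  (T 0 0 0)) (T (T 0 0 0) (T 0 0 0) (T 0 0 0))))"
definition "col4_67 = column (T (T (T (T 0 0 0) (T 0 0 0) (T 0 0 188359522)) (T (T 0 267247037 0) (T 147134485
  242656870 0) (T 0 245488825 175399596)) (T (T 202567387 0 262788520) (T 187173169 187189689 218680729) (T 0
  134219793 268287797))) (T (T (T 227253587 182800556 0) (T 0 241484972 262905203) (T 242673390 0 245601378))
  (T (T 0 0 143882971) (T 175385141 0 258786732) (T 0 210892424 0)) (T (T 0 0 0) (T 169871409 254330280
  179403449) (T 0 0 215480014))) (T (T (T 0 0 0) (T 0 143735313 0) (T 160125386 160108866 155992460)) (T (T 0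
  188361587 0) (T 0 0 0) (T 0 0 0)) (T (T 0 0 0) (T 0 0 0) (T 0 0 0))))"
definition "col4_68 = column (T (T (T (T 0 0 0) (T 0 0 0) (T 0 0 0)) (T (T 0 167436683 0) (T 179062794
  201321359 0) (T 0 247327711 0)) (T (T 167395467 0 246242942) (T 171794085 167441835 256294256) (T 0
  168077568 230823034))) (T (T (T 169197477 0 0) (T 0 258885712 268389087) (T 0 0 235191664)) (T (T 0 0
  234504411) (T 201326672 0 159006849) (T 0 179109162 0)) (T (T 0 0 0) (T 136901920 179104010 145285386) (T 0
  0 0))) (T (T (T 0 0 0) (T 0 155325472 0) (T 197527562 257342961 135271585)) (T (T 0 210769147 0) (T 0 0 0)
  (T 0 0 0)) (T (T 0 0 0) (T 0 0 0) (T 0 0 0))))"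
definition "table4 = T (T (T (T col4_0 col4_1 col4_2) (T col4_3 col4_4 col4_5) (T col4_6 col4_7 col4_8)) (T (T
  col4_9 col4_10 col4_11) (T col4_12 col4_13 col4_14) (T col4_15 col4_16 col4_17)) (T (T col4_18 col4_19
  col4_20) (T col4_21 col4_22 col4_23) (T col4_24 col4_25 col4_26))) (T (T (T col4_27 col4_28 col4_29) (T
  col4_30 col4_31 col4_32) (T col4_33 col4_34 col4_35)) (T (T col4_36 col4_37 col4_38) (T col4_39 col4_40
  col4_41) (T col4_42 col4_43 col4_44)) (T (T col4_45 col4_46 col4_47) (T col4_48 col4_49 col4_50) (T col4_51
  col4_52 col4_53))) (T (T (T col4_54 col4_55 col4_56) (T col4_57 col4_58 col4_59) (T col4_60 col4_61
  col4_62)) (T (T col4_63 col4_64 col4_65) (T col4_66 col4_67 col4_68) (T no_column no_column no_column)) (T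
  (T no_column no_column no_column) (T no_column no_column no_column) (T no_column no_column no_column)))"

section \<open>Nonexistence of distance-2 ovoids\<close>

lemma certificate2: "certificate [B0, B1] B1 code2 points2 planes2 table2"
  by code_simp

lemma certificate4: "certificate [F0, F1, Fw, Fv] Fw code4 points4 planes4 table4"
  by code_simp

lemma parity_certificate_2: "parity_certificate [B0, B1] B1 code2 1 points2 planes2 table2"
proof
  show "set [B0, B1] = UNIV"
    using f2.nchotomy by auto
  show "B1 * B1 * B1 = 1"
    by (simp add: times_f2_def one_f2_def)
  show "inj code2"
  proof (rule injI)
    fix a b assume "code2 a = code2 b"
    then show "a = b"
      by (cases a; cases b) simp_all
  qed
  show "length (code2 a) = 1" for a
    by (cases a) simp_all
  show "certificate [B0, B1] B1 code2 points2 planes2 table2"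
    by (rule certificate2)
qed

lemma parity_certificate_4: "parity_certificate [F0, F1, Fw, Fv] Fw code4 2 points4 planes4 table4"
proof
  show "set [F0, F1, Fw, Fv] = UNIV"
    using f4.nchotomy by auto
  show "Fw * Fw * Fw = 1"
    by (simp add: times_f4_def one_f4_def)
  show "inj code4"
  proof (rule injI)
    fix a b assume "code4 a = code4 b"
    then show "a = b"
      by (cases a; cases b) simp_all
  qed
  show "length (code4 a) = 2" for a
    by (cases a) simp_all
  show "certificate [F0, F1, Fw, Fv] Fw code4 points4 planes4 table4"
    by (rule certificate4)
qed

theorem theorem1p1:
  fixes q :: nat
  assumes "q \<in> {2, 4}"
    and "CARD('a::{field, finite}) = q"
  shows "\<not> (\<exists>X. distance_2_ovoid
           (dual_split_Cayley_hexagon :: (('a ^ 7) set, ('a ^ 7) set) geometry) X)"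
proof -
  from assms consider "CARD('a) = 2" | "CARD('a) = 4"
    by auto
  then show ?thesis
  proof cases
    case 1
    then show ?thesis
      using parity_certificate.no_ovoid[OF parity_certificate_2 field_iso_2] by blast
  next
    case 2
    then obtain w :: 'a where "field_iso (to4 w)"
      using field_iso_4 by blast
    then show ?thesis
      using parity_certificate.no_ovoid[OF parity_certificate_4] by blast
  qed
qed

end
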